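(* Let $X = Y$ and $S$ be completely regular topological spaces, let $\pi^{+} \in \mathcal M_{+}(X \times S)$ and $\pi^{-}\in \mathcal M_{+}(Y \times S)$ be nonnegative Radon measures, and let $c \colon S \to \mathbb R$ be a positive Borel measurable cost function. Then $$\max_{\gamma\in\Gamma(\pi^{+},\pi^{-},c)} \int_{X \times Y \times S} c(s)\, d\gamma = \inf_{(f,g,h)} \Bigl\{\int_{X \times S} f(x, s)\, d\pi^{+} + \int_{Y \times S} g(y, s)\, d \pi^{-}\Bigr\},$$ where the infimum is taken over all triples of Borel measurable functions $f \colon X \times S \to [0,\infty)$, $g \colon Y \times S \to [0,\infty)$, $h \colon X \to \mathbb R$ satisfying $$f(x, s) + g(y, s) + c(s) h(x) - c(s) h(y) \ge c(s)\quad\text{for all } x\in X,\ y\in Y,\ s\in S.$$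
   Context: For a topological space $Z$, $\mathcal M_{+}(Z)$ denotes the set of (finite) nonnegative Radon measures on $Z$: Borel measures $\mu$ such that for every Borel set $B$ and every $\varepsilon>0$ there is a compact set $K\subset B$ with $\mu(B\setminus K)<\varepsilon$. For a measure $\gamma$ on $X\times Y\times S$, $Pr_{X\times S}(\gamma)$ and $Pr_{Y\times S}(\gamma)$ denote its projections (image measures under the coordinate projections) on the indicated factors. Inequalities between measures are setwise on Borel sets. Here $Y$ is a copy of $X$. $\Gamma(\pi^{+}, \pi^{-}, c)$ is the set of all $\gamma \in \mathcal M_{+}(X \times Y \times S)$ such that $Pr_{X \times S}(\gamma) \le \pi^{+}$, $Pr_{Y \times S}(\gamma) \le \pi^{-}$, and the balance condition "$\int_{Y \times S} c(s)\, d\gamma = \int_{X \times S} c(s)\, d\gamma$" holds; the latter is an equality of measures on $X=Y$, i.e. for every Borel set $A\subset X$, $$\int_{A\times Y\times S} c(s)\,d\gamma=\int_{X\times A\times S} c(s)\,d\gamma .$$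
   Formalization: The cost c is additionally assumed integrable with respect to at least one of π⁺, π⁻; without such a condition the maximum can be infinite while the infimum is 0, or no maximum exists. *)

theory Defs
  imports "HOL-Analysis.Analysis"
begin

(* The underlying space is a whole type.  No separation axiom is built in, so a compact set need
   not be Borel; K is therefore required to be Borel explicitly, since otherwise the measure of
   B - K would have no meaning.  In a Hausdorff space that requirement is automatic. *)
definition radon_measures :: "'z::topological_space measure set" where
  "radon_measures = {\<mu>. sets \<mu> = sets borel \<and> finite_measure \<mu> \<and>
     (\<forall>B\<in>sets borel. \<forall>\<epsilon>>0. \<exists>K. compact K \<and> K \<in> sets borel \<and> K \<subseteq> B \<and> measure \<mu> (B - K) < \<epsilon>)}"

definition proj_XS ::
    "('x::topological_space \<times> 'x \<times> 's::topological_space) measure \<Rightarrow> ('x \<times> 's) measure" where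
  "proj_XS \<gamma> = distr \<gamma> borel (\<lambda>(x, y, s). (x, s))"

definition proj_YS ::
    "('x::topological_space \<times> 'x \<times> 's::topological_space) measure \<Rightarrow> ('x \<times> 's) measure" where
  "proj_YS \<gamma> = distr \<gamma> borel (\<lambda>(x, y, s). (y, s))"

(* Measures on products live on the Borel sigma-algebra of the product topology, which may be
   strictly larger than the product of the Borel sigma-algebras. *)
definition \<Gamma> ::
    "('x::topological_space \<times> 's::topological_space) measure \<Rightarrow> ('x \<times> 's) measure \<Rightarrow> ('s \<Rightarrow> real)
      \<Rightarrow> ('x \<times> 'x \<times> 's) measure set" where
  "\<Gamma> \<pi>p \<pi>m c = {\<gamma> \<in> radon_measures.
     (\<forall>B\<in>sets borel. emeasure (proj_XS \<gamma>) B \<le> emeasure \<pi>p B) \<and>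
     (\<forall>B\<in>sets borel. emeasure (proj_YS \<gamma>) B \<le> emeasure \<pi>m B) \<and>
     (\<forall>A\<in>sets borel.
        set_nn_integral \<gamma> (A \<times> UNIV \<times> UNIV) (\<lambda>(x, y, s). ennreal (c s)) =
        set_nn_integral \<gamma> (UNIV \<times> A \<times> UNIV) (\<lambda>(x, y, s). ennreal (c s)))}"

definition total_cost ::
    "('s \<Rightarrow> real) \<Rightarrow> ('x::topological_space \<times> 'x \<times> 's::topological_space) measure \<Rightarrow> ennreal" where
  "total_cost c \<gamma> = (\<integral>\<^sup>+(x, y, s). ennreal (c s) \<partial>\<gamma>)"

definition dual_admissible ::
    "('s::topological_space \<Rightarrow> real)
      \<Rightarrow> (('x::topological_space \<times> 's \<Rightarrow> real) \<times> ('x \<times> 's \<Rightarrow> real) \<times> ('x \<Rightarrow> real)) set" where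
  "dual_admissible c = {(f, g, h).
     f \<in> borel_measurable borel \<and> (\<forall>z. 0 \<le> f z) \<and>
     g \<in> borel_measurable borel \<and> (\<forall>z. 0 \<le> g z) \<and>
     h \<in> borel_measurable borel \<and>
     (\<forall>x y s. f (x, s) + g (y, s) + c s * h x - c s * h y \<ge> c s)}"

end

theory Submission
  imports Defs
begin

text \<open>
  The constraint on \<open>\<gamma>\<close> only concerns its projections, which are \<open>u \<pi>\<^sup>+\<close> and \<open>v \<pi>\<^sup>-\<close> with densities \<open>u\<close>, \<open>v\<close>
  between 0 and 1, subject to \<open>u \<pi>\<^sup>+\<close> and \<open>v \<pi>\<^sup>-\<close> having equal \<open>S\<close>-marginals and \<open>u c \<pi>\<^sup>+\<close> and \<open>v c \<pi>\<^sup>-\<close> having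
  equal \<open>X\<close>-marginals; conversely, two such Radon measures can be glued along \<open>S\<close>. The dual becomes
  the minimisation of \<open>\<integral> c (1 - h - k)\<^sup>+ d\<pi>\<^sup>+ + \<integral> c (h + k)\<^sup>+ d\<pi>\<^sup>-\<close> over functions \<open>h\<close> of \<open>x\<close> and \<open>k\<close> of \<open>s\<close>.
  Replacing the positive part by a Huber function, first-order optimality at near-minimisers produces
  densities that satisfy all constraints approximately and have almost the dual value. Convexity
  extracts an almost everywhere convergent sequence of such pairs, whose limit is optimal. The glued
  measure is a finitely additive, tight set function on finite unions of slabs \<open>D \<times> B\<close> with \<open>D \<subseteq> X \<times> S\<close>
  and \<open>B \<subseteq> Y\<close>, extended to the Borel sets of the product topology.
\<close>

section \<open>Smoothing the positive part\<close>

text \<open>In the minimisation over \<open>h\<close> and \<open>k\<close>, the function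
  \<open>k\<close> is the multiplier of the equality of the \<open>S\<close>-marginals and
  \<open>h\<close> that of the balance condition. No minimiser is known to exist: nothing makes
  minimising sequences compact, and \<open>h\<close>, \<open>k\<close> need not be integrable. Only
  near-minimisers are available, and there the kink of the positive part is an obstacle; a smooth
  integrand with a quadratic remainder turns near-minimality into approximate stationarity with an
  explicit error. The cost may be unbounded and need be integrable for only one of the two measures,
  which explains the asymmetric weights and the one-sided estimates for the
  \<open>X\<close>-marginals. The gluing cannot rest on a disintegration, since the spaces need not
  be Polish and no regular conditional probabilities are at hand; conditional probabilities of
  single sets, additive almost everywhere for each finite family, are enough once compactness
  supplies countable additivity.\<close>

definition ramp :: "real \<Rightarrow> real \<Rightarrow> real" where
  "ramp \<epsilon> a = max 0 (min 1 (a / \<epsilon>))"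

text \<open>This is the maximum of \<open>w * a - \<epsilon> * w^2 / 2\<close> over \<open>w\<close>
  in [0, 1], attained at \<open>ramp \<epsilon> a\<close>. For positive \<open>\<epsilon>\<close> it
  is an antiderivative of \<open>ramp \<epsilon>\<close>, at most the positive part of
  \<open>a\<close> and at least that minus \<open>\<epsilon> / 2\<close>.\<close>

definition huber :: "real \<Rightarrow> real \<Rightarrow> real" where
  "huber \<epsilon> a = ramp \<epsilon> a * a - \<epsilon> * (ramp \<epsilon> a)\<^sup>2 / 2"

lemma ramp_nonneg: "0 \<le> ramp \<epsilon> a" and ramp_le_1: "ramp \<epsilon> a \<le> 1"
  by (auto simp: ramp_def)

text \<open>First-order optimality: \<open>ramp \<epsilon> a\<close> is the projection of
  \<open>a / \<epsilon>\<close> onto [0, 1] and so maximises the concave quadratic with gradient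
  \<open>a - \<epsilon> * w\<close> there.\<close>

lemma ramp_variational:
  assumes "0 < \<epsilon>" "0 \<le> w" "w \<le> 1"
  shows "(w - ramp \<epsilon> a) * (a - \<epsilon> * ramp \<epsilon> a) \<le> 0"
proof (cases "a \<le> 0")
  case True
  then have "ramp \<epsilon> a = 0"
    using assms by (simp add: ramp_def divide_nonpos_pos min.absorb2)
  then show ?thesis
    using True assms by (simp add: mult_nonneg_nonpos)
next
  case False
  show ?thesis
  proof (cases "a \<le> \<epsilon>")
    case True
    then have "ramp \<epsilon> a = a / \<epsilon>"
      using False assms by (simp add: ramp_def min.absorb2)
    then show ?thesis
      using assms by simp
  next
    case False
    then have "ramp \<epsilon> a = 1"
      using assms by (simp add: ramp_def)
    then show ?thesis
      using False assms by (simp add: mult_nonpos_nonneg)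
  qed
qed

text \<open>The gap is the square \<open>\<epsilon> * (w - u)^2 / 2\<close> minus the term
  controlled by \<open>ramp_variational\<close>. With \<open>huber\<close> as a maximum of functions
  affine in \<open>a\<close>, monotonicity and scaling follow by inserting a maximiser, without
  distinguishing three regimes.\<close>

lemma huber_ge:
  assumes "0 < \<epsilon>" "0 \<le> w" "w \<le> 1"
  shows "w * a - \<epsilon> * w\<^sup>2 / 2 \<le> huber \<epsilon> a"
proof -
  define u where "u = ramp \<epsilon> a"
  have "huber \<epsilon> a - (w * a - \<epsilon> * w\<^sup>2 / 2) = \<epsilon> * (w - u)\<^sup>2 / 2 - (w - u) * (a - \<epsilon> * u)"
    by (simp add: huber_def u_def[symmetric] power2_eq_square algebra_simps) (simp add: field_simps)
  moreover have "(w - u) * (a - \<epsilon> * u) \<le> 0"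
    unfolding u_def by (rule ramp_variational[OF assms])
  moreover have "0 \<le> \<epsilon> * (w - u)\<^sup>2 / 2"
    using assms by simp
  ultimately show ?thesis by linarith
qed

lemma huber_nonneg: "0 < \<epsilon> \<Longrightarrow> 0 \<le> huber \<epsilon> a"
  using huber_ge[of \<epsilon> 0 a] by simp

lemma le_huber: "0 < \<epsilon> \<Longrightarrow> a \<le> huber \<epsilon> a + \<epsilon> / 2"
  using huber_ge[of \<epsilon> 1 a] by simp

lemma huber_0 [simp]: "huber \<epsilon> 0 = 0"
  by (simp add: huber_def ramp_def)

lemma huber_mono:
  assumes "0 < \<epsilon>" "a \<le> b"
  shows "huber \<epsilon> a \<le> huber \<epsilon> b"
proof -
  have "huber \<epsilon> a \<le> ramp \<epsilon> a * b - \<epsilon> * (ramp \<epsilon> a)\<^sup>2 / 2"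
    unfolding huber_def using mult_left_mono[OF assms(2) ramp_nonneg] by simp
  also have "\<dots> \<le> huber \<epsilon> b"
    using assms ramp_nonneg ramp_le_1 by (intro huber_ge)
  finally show ?thesis .
qed

text \<open>Convexity on the segment from 0 to \<open>a\<close>, with value 0 at 0: the maximiser
  for \<open>r * a\<close> is a competitor for \<open>a\<close>, and the factor \<open>r\<close>
  only decreases its quadratic penalty.\<close>

lemma huber_scale:
  assumes "0 < \<epsilon>" "0 \<le> r" "r \<le> 1"
  shows "huber \<epsilon> (r * a) \<le> r * huber \<epsilon> a"
proof -
  define w where "w = ramp \<epsilon> (r * a)"
  have "r * (\<epsilon> * w\<^sup>2 / 2) \<le> \<epsilon> * w\<^sup>2 / 2"
    using assms by (intro mult_left_le_one_le) auto
  then have "huber \<epsilon> (r * a) \<le> r * (w * a - \<epsilon> * w\<^sup>2 / 2)"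
    unfolding huber_def w_def[symmetric] by (simp add: algebra_simps)
  also have "\<dots> \<le> r * huber \<epsilon> a"
    using assms by (intro mult_left_mono huber_ge) (auto simp: w_def ramp_nonneg ramp_le_1)
  finally show ?thesis .
qed

lemma ramp_scale:
  assumes "0 < \<epsilon>" "0 \<le> r" "r \<le> 1"
  shows "ramp \<epsilon> (r * a) \<le> ramp \<epsilon> a"
proof (cases "a \<le> 0")
  case True
  then have "r * a / \<epsilon> \<le> 0"
    using assms by (simp add: divide_nonpos_pos mult_nonneg_nonpos)
  then show ?thesis by (auto simp: ramp_def)
next
  case False
  then have "r * a / \<epsilon> \<le> a / \<epsilon>"
    using assms by (intro divide_right_mono) (auto intro: mult_left_le_one_le)
  then show ?thesis by (auto simp: ramp_def)
qed

text \<open>The derivative \<open>ramp \<epsilon>\<close> is Lipschitz with constant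
  \<open>1 / \<epsilon>\<close>. For a step of length \<open>t\<close> the remainder is of order
  \<open>t^2\<close>, hence negligible after division by \<open>t\<close>.\<close>

lemma huber_add_le:
  assumes "0 < \<epsilon>"
  shows "huber \<epsilon> (a + d) \<le> huber \<epsilon> a + ramp \<epsilon> a * d + d\<^sup>2 / (2 * \<epsilon>)"
proof -
  define u where "u = ramp \<epsilon> a"
  define w where "w = ramp \<epsilon> (a + d)"
  have "huber \<epsilon> (a + d) - huber \<epsilon> a - u * d
      = (w - u) * (a - \<epsilon> * u) + (w - u) * d - \<epsilon> * (w - u)\<^sup>2 / 2"
    by (simp add: huber_def u_def[symmetric] w_def[symmetric] power2_eq_square algebra_simps)
      (simp add: field_simps)
  moreover have "(w - u) * (a - \<epsilon> * u) \<le> 0"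
    unfolding u_def by (rule ramp_variational) (auto simp: assms w_def ramp_nonneg ramp_le_1)
  moreover have "(w - u) * d - \<epsilon> * (w - u)\<^sup>2 / 2 = d\<^sup>2 / (2 * \<epsilon>) - (d - \<epsilon> * (w - u))\<^sup>2 / (2 * \<epsilon>)"
    using assms by (simp add: power2_eq_square field_simps)
  moreover have "0 \<le> (d - \<epsilon> * (w - u))\<^sup>2 / (2 * \<epsilon>)"
    using assms by simp
  ultimately show ?thesis unfolding u_def by linarith
qed

lemma ramp_measurable [measurable]: "ramp \<epsilon> \<in> borel_measurable borel"
  unfolding ramp_def[abs_def] by measurable

lemma huber_measurable [measurable]: "huber \<epsilon> \<in> borel_measurable borel"
  unfolding huber_def[abs_def] by measurable

section \<open>Optimal densities\<close>

text \<open>Here \<open>P\<close>, \<open>N\<close> and \<open>e\<close> stand for \<open>c \<cdot> \<pi>\<^sup>+\<close>, \<open>min 1 c \<cdot> \<pi>\<^sup>-\<close> and \<open>max 1 c\<close>; this keeps \<open>N\<close>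
  finite when \<open>c\<close> is not \<open>\<pi>\<^sup>-\<close>-integrable. The densities \<open>u\<close> and \<open>v\<close> are the derivatives of the smoothed
  positive parts at a near-minimiser of the smoothed dual, and the approximate constraints say that
  the smoothed dual cannot decrease much in the directions \<open>k \<plusminus> t 1\<^sub>B / e\<close> and \<open>h - t 1\<^sub>A\<close>.\<close>

lemma approximate_circulation:
  fixes P N :: "'m measure" and e :: "'s \<Rightarrow> real" and p :: "'m \<Rightarrow> 'x" and q :: "'m \<Rightarrow> 's"
    and D E j :: real
  assumes fin: "finite_measure P" "finite_measure N"
    and sets [measurable_cong]: "sets P = sets M" "sets N = sets M"
    and p [measurable]: "p \<in> measurable M XM" and q [measurable]: "q \<in> measurable M SM"
    and e [measurable]: "e \<in> borel_measurable SM" and e_ge_1: "\<And>s. 1 \<le> e s"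
    and D: "\<And>h k. h \<in> borel_measurable XM \<Longrightarrow> k \<in> borel_measurable SM \<Longrightarrow>
      ennreal D \<le> (\<integral>\<^sup>+z. ennreal (1 - h (p z) - k (q z)) \<partial>P)
        + (\<integral>\<^sup>+z. ennreal (e (q z) * (h (p z) + k (q z))) \<partial>N)"
    and E: "0 < E" and j: "1 \<le> j"
  obtains u v where "u \<in> borel_measurable M" "v \<in> borel_measurable M"
    "\<And>z. 0 \<le> u z \<and> u z \<le> 1" "\<And>z. 0 \<le> v z \<and> v z \<le> 1"
    "\<And>B. B \<in> sets SM \<Longrightarrow>
      \<bar>(\<integral>z. u z * (indicator B (q z) / e (q z)) \<partial>P) - (\<integral>z. v z * indicator B (q z) \<partial>N)\<bar> \<le> E"
    "\<And>A. A \<in> sets XM \<Longrightarrow>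
      (\<integral>z. v z * (min (e (q z)) j * indicator A (p z)) \<partial>N) \<le> (\<integral>z. u z * indicator A (p z) \<partial>P) + E"
    "D \<le> (\<integral>z. u z \<partial>P) + E"
proof -
  interpret P: finite_measure P by fact
  interpret N: finite_measure N by fact
  define C where "C = measure P (space P) + measure N (space N)"
  have "0 \<le> C" by (simp add: C_def)
  \<comment> \<open>With this choice the loss by smoothing, at most \<open>\<epsilon> / 2\<close>
    pointwise and \<open>\<epsilon> / 2 * C\<close> in total, is no more than
    \<open>E / 2\<close>.\<close>
  define \<epsilon> where "\<epsilon> = E / (C + 1)"
  have \<epsilon>: "0 < \<epsilon>" using E \<open>0 \<le> C\<close> by (simp add: \<epsilon>_def)
  \<comment> \<open>\<open>t^2 * K\<close> is the total error of one test step: \<open>t^2\<close>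
    because \<open>w\<close> is only a near-minimiser, plus \<open>C * r\<close> from the quadratic
    remainders of increments bounded by \<open>t * j\<close>. Dividing by \<open>t\<close> leaves
    \<open>t * K\<close>, and \<open>t\<close> is chosen to make this at most
    \<open>E / 2\<close>.\<close>
  define K where "K = 1 + C * (j\<^sup>2 / (2 * \<epsilon>))"
  have "1 \<le> K" using \<open>0 \<le> C\<close> \<epsilon> by (simp add: K_def)
  define t where "t = min 1 (E / (2 * K))"
  have t: "0 < t" "t \<le> 1" using E \<open>1 \<le> K\<close> by (auto simp: t_def)
  have tK: "t * K \<le> E / 2"
  proof -
    have "t * K \<le> E / (2 * K) * K"
      using \<open>1 \<le> K\<close> by (intro mult_right_mono) (auto simp: t_def)
    then show ?thesis using \<open>1 \<le> K\<close> by simp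
  qed
  define r where "r = t\<^sup>2 * (j\<^sup>2 / (2 * \<epsilon>))"
  have r_nonneg: "0 \<le> r" using \<epsilon> by (simp add: r_def)
  have r_ge: "d\<^sup>2 / (2 * \<epsilon>) \<le> r" if "\<bar>d\<bar> \<le> t * j" for d
  proof -
    have "d\<^sup>2 \<le> (t * j)\<^sup>2" using that j t by (simp add: abs_le_square_iff[symmetric])
    then show ?thesis using \<epsilon> by (simp add: r_def power_mult_distrib divide_right_mono)
  qed
  have tKr: "t * (t * K) = t\<^sup>2 + C * r"
    by (simp add: K_def r_def power2_eq_square algebra_simps)

  \<comment> \<open>The smoothed dual functional and a near-minimiser\<close>
  define a where "a w z = 1 - fst w (p z) - snd w (q z)" for w :: "('x \<Rightarrow> real) \<times> ('s \<Rightarrow> real)" and z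
  define b where "b w z = e (q z) * (fst w (p z) + snd w (q z))" for w :: "('x \<Rightarrow> real) \<times> ('s \<Rightarrow> real)" and z
  \<comment> \<open>Integrability is part of \<open>W\<close> because the Bochner integral of a
    non-integrable function is 0, which would spoil the infimum of \<open>J\<close>.\<close>
  define W where "W = {w. fst w \<in> borel_measurable XM \<and> snd w \<in> borel_measurable SM \<and>
    integrable P (\<lambda>z. huber \<epsilon> (a w z)) \<and> integrable N (\<lambda>z. huber \<epsilon> (b w z))}"
  define J where "J w = (\<integral>z. huber \<epsilon> (a w z) \<partial>P) + (\<integral>z. huber \<epsilon> (b w z) \<partial>N)" for w
  have J_nonneg: "0 \<le> J w" for w
    unfolding J_def using \<epsilon> by (intro add_nonneg_nonneg integral_nonneg_AE AE_I2 huber_nonneg)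
  have bdd: "bdd_below (J ` W)"
    using J_nonneg by (auto intro!: bdd_belowI)
  have "(\<lambda>_. 0, \<lambda>_. 0) \<in> W"
    by (simp add: W_def a_def b_def)
  then have "J ` W \<noteq> {}" by blast
  then obtain w where w: "w \<in> W" "J w < Inf (J ` W) + t\<^sup>2"
    using cInf_less_iff[OF _ bdd, of "Inf (J ` W) + t\<^sup>2"] t by auto
  obtain h k where hk: "w = (h, k)" by force
  have hk_meas [measurable]: "h \<in> borel_measurable XM" "k \<in> borel_measurable SM"
    using w by (auto simp: W_def hk)
  have int_w: "integrable P (\<lambda>z. huber \<epsilon> (a w z))" "integrable N (\<lambda>z. huber \<epsilon> (b w z))"
    using w by (auto simp: W_def)
  have [measurable]: "a w \<in> borel_measurable M" "b w \<in> borel_measurable M"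
    unfolding a_def[abs_def] b_def[abs_def] hk by auto
  define u where "u z = ramp \<epsilon> (a w z)" for z
  define v where "v z = ramp \<epsilon> (b w z)" for z
  have [measurable]: "u \<in> borel_measurable M" "v \<in> borel_measurable M"
    unfolding u_def[abs_def] v_def[abs_def] by auto
  have u01: "0 \<le> u z" "u z \<le> 1" and v01: "0 \<le> v z" "v z \<le> 1" for z
    by (auto simp: u_def v_def ramp_nonneg ramp_le_1)

  \<comment> \<open>The majorants \<open>F\<close> and \<open>G\<close> put the perturbed pair into
    \<open>W\<close> and also bound its value, so integrability of the perturbed integrands need not
    be known in advance.\<close>
  have perturb: "J w - t\<^sup>2 \<le> (\<integral>z. F z \<partial>P) + (\<integral>z. G z \<partial>N)"
    if [measurable]: "h' \<in> borel_measurable XM" "k' \<in> borel_measurable SM"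
      and F: "integrable P F" "\<And>z. huber \<epsilon> (a (h', k') z) \<le> F z"
      and G: "integrable N G" "\<And>z. huber \<epsilon> (b (h', k') z) \<le> G z" for h' k' F G
  proof -
    have [measurable]: "a (h', k') \<in> borel_measurable M" "b (h', k') \<in> borel_measurable M"
      unfolding a_def[abs_def] b_def[abs_def] by auto
    have iP: "integrable P (\<lambda>z. huber \<epsilon> (a (h', k') z))"
      by (rule Bochner_Integration.integrable_bound[OF F(1)])
        (use F(2) huber_nonneg[OF \<epsilon>] in \<open>auto intro!: order_trans[OF F(2)]\<close>)
    have iN: "integrable N (\<lambda>z. huber \<epsilon> (b (h', k') z))"
      by (rule Bochner_Integration.integrable_bound[OF G(1)])
        (use G(2) huber_nonneg[OF \<epsilon>] in \<open>auto intro!: order_trans[OF G(2)]\<close>)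
    have "(h', k') \<in> W" using iP iN that by (simp add: W_def)
    then have "Inf (J ` W) \<le> J (h', k')" using bdd by (intro cInf_lower) auto
    also have "\<dots> \<le> (\<integral>z. F z \<partial>P) + (\<integral>z. G z \<partial>N)"
      unfolding J_def by (intro add_mono integral_mono iP iN F G)
    finally show ?thesis using w by linarith
  qed

  have bounded_int: "integrable P f" "integrable N f"
    if [measurable]: "f \<in> borel_measurable M" and "\<And>z. \<bar>f z\<bar> \<le> B" for f and B :: real
    using that by (auto intro!: P.integrable_const_bound[of _ B] N.integrable_const_bound[of _ B])

  have step: "t * ((\<integral>z. x z \<partial>P) + (\<integral>z. y z \<partial>N)) + t * (t * K) \<ge> 0"
    if [measurable]: "h' \<in> borel_measurable XM" "k' \<in> borel_measurable SM"
      and x: "integrable P x" "\<And>z. huber \<epsilon> (a (h', k') z) \<le> huber \<epsilon> (a w z) + t * x z + r"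
      and y: "integrable N y" "\<And>z. huber \<epsilon> (b (h', k') z) \<le> huber \<epsilon> (b w z) + t * y z + r"
    for h' k' x y
  proof -
    have "J w - t\<^sup>2 \<le> (\<integral>z. huber \<epsilon> (a w z) + t * x z + r \<partial>P) + (\<integral>z. huber \<epsilon> (b w z) + t * y z + r \<partial>N)"
      using x y int_w by (intro perturb[of h' k']) auto
    also have "\<dots> = J w + t * ((\<integral>z. x z \<partial>P) + (\<integral>z. y z \<partial>N)) + C * r"
      using x y int_w by (simp add: J_def C_def algebra_simps)
    finally show ?thesis using tKr by linarith
  qed
  have cancel: "0 \<le> X + t * K" if "t * X + t * (t * K) \<ge> 0" for X
  proof -
    have "0 \<le> t * (X + t * K)" using that by (simp add: algebra_simps)
    then show ?thesis using t by (simp add: zero_le_mult_iff)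
  qed

  \<comment> \<open>Dividing by \<open>e\<close> makes the increment of \<open>b\<close> exactly
    \<open>t * \<sigma> * indicator B\<close>, so both increments are bounded even though
    \<open>e\<close> need not be. Both signs of \<open>\<sigma>\<close> are allowed, so the
    \<open>S\<close>-marginals obey a two-sided estimate.\<close>
  have S_dir: "0 \<le> - \<sigma> * (\<integral>z. u z * (indicator B (q z) / e (q z)) \<partial>P)
      + \<sigma> * (\<integral>z. v z * indicator B (q z) \<partial>N) + t * K"
    if [measurable]: "B \<in> sets SM" and \<sigma>: "\<bar>\<sigma>\<bar> \<le> 1" for B and \<sigma> :: real
  proof -
    define i :: "'s \<Rightarrow> real" where "i = indicator B"
    have i01: "0 \<le> i s" "i s \<le> 1" for s by (auto simp: i_def indicator_def)
    have [measurable]: "i \<in> borel_measurable SM" unfolding i_def by measurable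
    have ie01: "0 \<le> i s / e s" "i s / e s \<le> 1" for s
    proof -
      show "0 \<le> i s / e s" using i01[of s] e_ge_1[of s] by simp
      have "i s / e s \<le> 1 / 1" using i01[of s] e_ge_1[of s] by (intro frac_le) auto
      then show "i s / e s \<le> 1" by simp
    qed
    have small: "\<bar>t * \<sigma> * y\<bar> \<le> t * j" if "0 \<le> y" "y \<le> 1" for y
    proof -
      have "\<bar>\<sigma>\<bar> * y \<le> 1 * 1" using that \<sigma> by (intro mult_mono) auto
      then have "t * (\<bar>\<sigma>\<bar> * y) \<le> t * j" using t j by (intro mult_left_mono) auto
      then show ?thesis using t that by (simp add: abs_mult mult.assoc)
    qed
    have "t * ((\<integral>z. - \<sigma> * (u z * (i (q z) / e (q z))) \<partial>P) + (\<integral>z. \<sigma> * (v z * i (q z)) \<partial>N)) + t * (t * K) \<ge> 0"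
    proof (rule step[of h "\<lambda>s. k s + t * \<sigma> * (i s / e s)"])
      fix z
      have "huber \<epsilon> (a (h, \<lambda>s. k s + t * \<sigma> * (i s / e s)) z)
          = huber \<epsilon> (a w z + - (t * \<sigma> * (i (q z) / e (q z))))"
        by (simp add: a_def hk algebra_simps)
      also have "\<dots> \<le> huber \<epsilon> (a w z) + ramp \<epsilon> (a w z) * - (t * \<sigma> * (i (q z) / e (q z)))
          + (- (t * \<sigma> * (i (q z) / e (q z))))\<^sup>2 / (2 * \<epsilon>)"
        by (rule huber_add_le[OF \<epsilon>])
      also have "\<dots> \<le> huber \<epsilon> (a w z) + t * (- \<sigma> * (u z * (i (q z) / e (q z)))) + r"
        using r_ge[of "- (t * \<sigma> * (i (q z) / e (q z)))"] small[OF ie01, of "q z"]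
        by (simp add: u_def mult_ac)
      finally show "huber \<epsilon> (a (h, \<lambda>s. k s + t * \<sigma> * (i s / e s)) z)
        \<le> huber \<epsilon> (a w z) + t * (- \<sigma> * (u z * (i (q z) / e (q z)))) + r" .
      have "huber \<epsilon> (b (h, \<lambda>s. k s + t * \<sigma> * (i s / e s)) z) = huber \<epsilon> (b w z + t * \<sigma> * i (q z))"
        using e_ge_1[of "q z"] by (simp add: b_def hk algebra_simps)
      also have "\<dots> \<le> huber \<epsilon> (b w z) + ramp \<epsilon> (b w z) * (t * \<sigma> * i (q z))
          + (t * \<sigma> * i (q z))\<^sup>2 / (2 * \<epsilon>)"
        by (rule huber_add_le[OF \<epsilon>])
      also have "\<dots> \<le> huber \<epsilon> (b w z) + t * (\<sigma> * (v z * i (q z))) + r"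
        using r_ge[of "t * \<sigma> * i (q z)"] small[OF i01, of "q z"] by (simp add: v_def mult_ac)
      finally show "huber \<epsilon> (b (h, \<lambda>s. k s + t * \<sigma> * (i s / e s)) z)
        \<le> huber \<epsilon> (b w z) + t * (\<sigma> * (v z * i (q z))) + r" .
    next
      show "integrable P (\<lambda>z. - \<sigma> * (u z * (i (q z) / e (q z))))"
      proof (rule bounded_int(1)[of _ 1])
        fix z
        have "\<bar>\<sigma>\<bar> * (u z * (i (q z) / e (q z))) \<le> 1 * (1 * 1)"
          using \<sigma> u01 ie01 by (intro mult_mono mult_nonneg_nonneg) auto
        then show "\<bar>- \<sigma> * (u z * (i (q z) / e (q z)))\<bar> \<le> 1"
          using u01 ie01[of "q z"] by (simp only: abs_mult abs_minus_cancel abs_of_nonneg)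
      qed auto
      show "integrable N (\<lambda>z. \<sigma> * (v z * i (q z)))"
      proof (rule bounded_int(2)[of _ 1])
        fix z
        have "\<bar>\<sigma>\<bar> * (v z * i (q z)) \<le> 1 * (1 * 1)"
          using \<sigma> v01 i01 by (intro mult_mono mult_nonneg_nonneg) auto
        then show "\<bar>\<sigma> * (v z * i (q z))\<bar> \<le> 1"
          using v01 i01 by (simp only: abs_mult abs_of_nonneg)
      qed auto
    qed auto
    from cancel[OF this] show ?thesis by (simp only: integral_mult_right_zero i_def)
  qed

  \<comment> \<open>Here the increment of \<open>b\<close> is \<open>- t * e\<close> on
    \<open>A\<close>, possibly unbounded. Since it is negative and \<open>huber\<close> is monotone,
    \<open>e\<close> may be replaced by \<open>min e j\<close>; the opposite direction would not
    allow this, hence only one inequality.\<close>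
  have X_dir: "0 \<le> (\<integral>z. u z * indicator A (p z) \<partial>P)
      - (\<integral>z. v z * (min (e (q z)) j * indicator A (p z)) \<partial>N) + t * K"
    if [measurable]: "A \<in> sets XM" for A
  proof -
    define i :: "'x \<Rightarrow> real" where "i = indicator A"
    have i01: "0 \<le> i s" "i s \<le> 1" for s by (auto simp: i_def indicator_def)
    have [measurable]: "i \<in> borel_measurable XM" unfolding i_def by measurable
    have m: "0 \<le> min (e s) j" "min (e s) j \<le> j" for s
      using e_ge_1[of s] j by auto
    have m': "0 \<le> min (e s) j * i x" "min (e s) j * i x \<le> j" for s x
    proof -
      show "0 \<le> min (e s) j * i x" using m i01 by simp
      have "min (e s) j * i x \<le> j * 1" using m i01 j by (intro mult_mono) auto
      then show "min (e s) j * i x \<le> j" by simp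
    qed
    have "t * ((\<integral>z. u z * i (p z) \<partial>P) + (\<integral>z. - (v z * (min (e (q z)) j * i (p z))) \<partial>N)) + t * (t * K) \<ge> 0"
    proof (rule step[of "\<lambda>x. h x - t * i x" k])
      fix z
      have small: "\<bar>t * i (p z)\<bar> \<le> t * j" "\<bar>- (t * (min (e (q z)) j * i (p z)))\<bar> \<le> t * j"
        using t j i01[of "p z"] m'[of "q z" "p z"] by (simp_all add: abs_mult)
      have "huber \<epsilon> (a (\<lambda>x. h x - t * i x, k) z) = huber \<epsilon> (a w z + t * i (p z))"
        by (simp add: a_def hk algebra_simps)
      also have "\<dots> \<le> huber \<epsilon> (a w z) + ramp \<epsilon> (a w z) * (t * i (p z)) + (t * i (p z))\<^sup>2 / (2 * \<epsilon>)"
        by (rule huber_add_le[OF \<epsilon>])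
      also have "\<dots> \<le> huber \<epsilon> (a w z) + t * (u z * i (p z)) + r"
        using r_ge[OF small(1)] by (simp add: u_def)
      finally show "huber \<epsilon> (a (\<lambda>x. h x - t * i x, k) z) \<le> huber \<epsilon> (a w z) + t * (u z * i (p z)) + r" .
      have "t * (min (e (q z)) j * i (p z)) \<le> t * (e (q z) * i (p z))"
        using t i01 by (intro mult_left_mono mult_right_mono) auto
      then have "b (\<lambda>x. h x - t * i x, k) z \<le> b w z + - (t * (min (e (q z)) j * i (p z)))"
        by (simp add: b_def hk algebra_simps)
      then have "huber \<epsilon> (b (\<lambda>x. h x - t * i x, k) z)
          \<le> huber \<epsilon> (b w z + - (t * (min (e (q z)) j * i (p z))))"
        by (rule huber_mono[OF \<epsilon>])
      also have "\<dots> \<le> huber \<epsilon> (b w z) + ramp \<epsilon> (b w z) * - (t * (min (e (q z)) j * i (p z)))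
          + (- (t * (min (e (q z)) j * i (p z))))\<^sup>2 / (2 * \<epsilon>)"
        by (rule huber_add_le[OF \<epsilon>])
      also have "\<dots> \<le> huber \<epsilon> (b w z) + t * (- (v z * (min (e (q z)) j * i (p z)))) + r"
        using r_ge[OF small(2)] by (simp add: v_def)
      finally show "huber \<epsilon> (b (\<lambda>x. h x - t * i x, k) z)
        \<le> huber \<epsilon> (b w z) + t * (- (v z * (min (e (q z)) j * i (p z)))) + r" .
    next
      show "integrable P (\<lambda>z. u z * i (p z))"
      proof (rule bounded_int(1)[of _ 1])
        fix z
        have "u z * i (p z) \<le> 1 * 1" using u01 i01 by (intro mult_mono) auto
        then show "\<bar>u z * i (p z)\<bar> \<le> 1" using u01 i01 by (simp only: abs_mult abs_of_nonneg)
      qed auto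
      show "integrable N (\<lambda>z. - (v z * (min (e (q z)) j * i (p z))))"
      proof (rule bounded_int(2)[of _ j])
        fix z
        have "v z * (min (e (q z)) j * i (p z)) \<le> 1 * j" using v01 m' by (intro mult_mono) auto
        then show "\<bar>- (v z * (min (e (q z)) j * i (p z)))\<bar> \<le> j"
          using mult_nonneg_nonneg[OF v01(1) m'(1)] by (simp only: abs_minus_cancel abs_of_nonneg)
      qed auto
    qed auto
    from cancel[OF this] show ?thesis by (simp add: i_def)
  qed

  \<comment> \<open>Shrinking \<open>(h, k)\<close> by the factor \<open>1 - t\<close> and using convexity bounds the value of the smoothed
    dual by the primal value.\<close>
  have primal: "J w \<le> (\<integral>z. u z \<partial>P) + t * K"
  proof -
    have int_u: "integrable P u" using u01 by (intro bounded_int(1)[of _ 1]) auto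
    have "t * ((\<integral>z. u z - huber \<epsilon> (a w z) \<partial>P) + (\<integral>z. - huber \<epsilon> (b w z) \<partial>N)) + t * (t * K) \<ge> 0"
    proof (rule step[of "\<lambda>x. (1 - t) * h x" "\<lambda>s. (1 - t) * k s"])
      fix z
      have "huber \<epsilon> (a (\<lambda>x. (1 - t) * h x, \<lambda>s. (1 - t) * k s) z) = huber \<epsilon> ((1 - t) * a w z + t)"
        by (simp add: a_def hk algebra_simps)
      also have "\<dots> \<le> huber \<epsilon> ((1 - t) * a w z) + ramp \<epsilon> ((1 - t) * a w z) * t + t\<^sup>2 / (2 * \<epsilon>)"
        by (rule huber_add_le[OF \<epsilon>])
      also have "\<dots> \<le> (1 - t) * huber \<epsilon> (a w z) + u z * t + r"
        unfolding u_def
        using t j \<epsilon> by (intro add_mono mult_right_mono huber_scale ramp_scale r_ge) auto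
      finally show "huber \<epsilon> (a (\<lambda>x. (1 - t) * h x, \<lambda>s. (1 - t) * k s) z)
        \<le> huber \<epsilon> (a w z) + t * (u z - huber \<epsilon> (a w z)) + r"
        by (simp add: algebra_simps)
      have "huber \<epsilon> (b (\<lambda>x. (1 - t) * h x, \<lambda>s. (1 - t) * k s) z) = huber \<epsilon> ((1 - t) * b w z)"
        by (simp add: b_def hk algebra_simps)
      also have "\<dots> \<le> (1 - t) * huber \<epsilon> (b w z)"
        using t \<epsilon> by (intro huber_scale) auto
      finally show "huber \<epsilon> (b (\<lambda>x. (1 - t) * h x, \<lambda>s. (1 - t) * k s) z)
        \<le> huber \<epsilon> (b w z) + t * (- huber \<epsilon> (b w z)) + r"
        using r_nonneg by (simp add: algebra_simps)
    qed (use int_u int_w in auto)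
    from cancel[OF this] show ?thesis using int_u int_w by (simp add: J_def)
  qed
  have "D \<le> J w + \<epsilon> / 2 * C"
  proof -
    have "ennreal D \<le> (\<integral>\<^sup>+z. ennreal (a w z) \<partial>P) + (\<integral>\<^sup>+z. ennreal (b w z) \<partial>N)"
      using D[OF hk_meas] by (simp add: a_def b_def hk)
    also have "\<dots> \<le> (\<integral>\<^sup>+z. ennreal (huber \<epsilon> (a w z) + \<epsilon> / 2) \<partial>P) + (\<integral>\<^sup>+z. ennreal (huber \<epsilon> (b w z) + \<epsilon> / 2) \<partial>N)"
      by (intro add_mono nn_integral_mono ennreal_leI le_huber \<epsilon>)
    also have "\<dots> = ennreal (\<integral>z. huber \<epsilon> (a w z) + \<epsilon> / 2 \<partial>P) + ennreal (\<integral>z. huber \<epsilon> (b w z) + \<epsilon> / 2 \<partial>N)"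
      using int_w \<epsilon> huber_nonneg[OF \<epsilon>]
      by (intro arg_cong2[where f = "(+)"] nn_integral_eq_integral) (auto intro!: AE_I2 add_nonneg_nonneg)
    also have "\<dots> = ennreal ((\<integral>z. huber \<epsilon> (a w z) + \<epsilon> / 2 \<partial>P) + (\<integral>z. huber \<epsilon> (b w z) + \<epsilon> / 2 \<partial>N))"
      using \<epsilon> huber_nonneg[OF \<epsilon>]
      by (intro ennreal_plus[symmetric] integral_nonneg_AE AE_I2) (auto intro!: add_nonneg_nonneg)
    also have "\<dots> = ennreal (J w + \<epsilon> / 2 * C)"
      using int_w by (simp add: J_def C_def algebra_simps)
    finally have "ennreal D \<le> ennreal (J w + \<epsilon> / 2 * C)" .
    moreover have "0 \<le> J w + \<epsilon> / 2 * C"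
      using J_nonneg[of w] \<epsilon> \<open>0 \<le> C\<close> by simp
    ultimately show ?thesis by (simp only: ennreal_le_iff)
  qed
  moreover have "\<epsilon> * C \<le> E"
    using E \<open>0 \<le> C\<close> by (simp add: \<epsilon>_def field_simps)
  ultimately have "D \<le> (\<integral>z. u z \<partial>P) + E"
    using primal tK by simp
  then show thesis
  proof (rule that[of u v, rotated -1])
    fix B assume B: "B \<in> sets SM"
    show "\<bar>(\<integral>z. u z * (indicator B (q z) / e (q z)) \<partial>P) - (\<integral>z. v z * indicator B (q z) \<partial>N)\<bar> \<le> E"
      using S_dir[OF B, of 1] S_dir[OF B, of "-1"] tK E by simp
  next
    fix A assume "A \<in> sets XM"
    from X_dir[OF this] show "(\<integral>z. v z * (min (e (q z)) j * indicator A (p z)) \<partial>N)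
        \<le> (\<integral>z. u z * indicator A (p z) \<partial>P) + E"
      using tK E by simp
  qed (use u01 v01 in auto)
qed

text \<open>Elements of nearly minimal \<open>L\<^sup>2\<close> norm in a decreasing sequence of convex sets form a Cauchy
  sequence by the parallelogram law.\<close>

lemma nested_convex_AE_limit:
  fixes P N :: "'m measure" and Q :: "nat \<Rightarrow> ('m \<Rightarrow> real) \<Rightarrow> ('m \<Rightarrow> real) \<Rightarrow> bool"
  assumes fin: "finite_measure P" "finite_measure N"
    and sets [measurable_cong]: "sets P = sets M" "sets N = sets M"
    and meas: "\<And>n u v. Q n u v \<Longrightarrow> u \<in> borel_measurable M \<and> v \<in> borel_measurable M"
    and range: "\<And>n u v z. Q n u v \<Longrightarrow> u z \<in> {0..1} \<and> v z \<in> {0..1}"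
    and mid: "\<And>n u v u' v'. Q n u v \<Longrightarrow> Q n u' v' \<Longrightarrow> Q n (\<lambda>z. (u z + u' z) / 2) (\<lambda>z. (v z + v' z) / 2)"
    and dec: "\<And>m n u v. Q n u v \<Longrightarrow> m \<le> n \<Longrightarrow> Q m u v"
    and ex: "\<And>n. \<exists>u v. Q n u v"
  obtains us vs u v where "\<And>n. Q n (us n) (vs n)"
    "u \<in> borel_measurable M" "v \<in> borel_measurable M"
    "\<And>z. u z \<in> {0..1}" "\<And>z. v z \<in> {0..1}"
    "AE z in P. (\<lambda>n. us n z) \<longlonglongrightarrow> u z" "AE z in N. (\<lambda>n. vs n z) \<longlonglongrightarrow> v z"
proof -
  interpret P: finite_measure P by fact
  interpret N: finite_measure N by fact
  define C where "C = measure P (space P) + measure N (space N)"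
  have "0 \<le> C" by (simp add: C_def)
  define R where "R u v = (\<integral>z. (u z)\<^sup>2 \<partial>P) + (\<integral>z. (v z)\<^sup>2 \<partial>N)" for u v :: "'m \<Rightarrow> real"
  have R_nonneg: "0 \<le> R u v" for u v
    by (auto simp: R_def intro!: add_nonneg_nonneg)
  define S where "S n = {R u v |u v. Q n u v}" for n
  define d where "d n = Inf (S n)" for n
  have bdd: "bdd_below (S n)" for n
    using R_nonneg by (auto simp: S_def intro!: bdd_belowI)
  have S_ne: "S n \<noteq> {}" for n using ex[of n] by (auto simp: S_def)
  have sq_le_1: "x\<^sup>2 \<le> 1" "\<bar>x\<bar> \<le> 1" if "x \<in> {0..1}" for x :: real
    using that by (auto simp: power_le_one)
  have sq_int: "integrable P (\<lambda>z. (u z)\<^sup>2)" "integrable N (\<lambda>z. (v z)\<^sup>2)"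
    "integrable P u" "integrable N v" if "Q n u v" for n u v
    using meas[OF that] sq_le_1[OF conjunct1[OF range[OF that]]] sq_le_1[OF conjunct2[OF range[OF that]]]
    by (auto intro!: P.integrable_const_bound[of _ 1] N.integrable_const_bound[of _ 1])
  have R_le: "R u v \<le> C" if "Q n u v" for n u v
  proof -
    have "R u v \<le> (\<integral>z. 1 \<partial>P) + (\<integral>z. 1 \<partial>N)"
      unfolding R_def using sq_int[OF that] range[OF that]
      by (intro add_mono integral_mono) (auto intro!: power_le_one)
    then show ?thesis by (simp add: C_def)
  qed
  have d_le: "d n \<le> R u v" if "Q n u v" for n u v
    unfolding d_def using that bdd by (intro cInf_lower) (auto simp: S_def)
  \<comment> \<open>The infima increase because the admissible sets shrink. Being bounded by the
    total mass \<open>C\<close> as well, they form a Cauchy sequence, which is what the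
    parallelogram law needs.\<close>
  have "incseq d"
    unfolding d_def
  proof (rule incseq_SucI)
    fix n
    have "S (Suc n) \<subseteq> S n" using dec[of "Suc n" _ _ n] unfolding S_def by fastforce
    then show "Inf (S n) \<le> Inf (S (Suc n))"
      by (rule cInf_superset_mono[OF S_ne bdd])
  qed
  moreover have "d n \<le> C" for n
    using ex[of n] d_le R_le by (meson order_trans)
  ultimately have "Cauchy d"
    by (metis LIMSEQ_imp_Cauchy incseq_convergent)
  have "\<exists>w. Q n (fst w) (snd w) \<and> R (fst w) (snd w) < d n + 1 / Suc n" for n
  proof -
    have "Inf (S n) < d n + 1 / Suc n" by (simp add: d_def)
    then show ?thesis
      using cInf_less_iff[OF S_ne bdd] by (fastforce simp: S_def)
  qed
  then obtain w where w: "\<And>n. Q n (fst (w n)) (snd (w n))"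
      "\<And>n. R (fst (w n)) (snd (w n)) < d n + 1 / Suc n"
    by metis
  define us where "us n = fst (w n)" for n
  define vs where "vs n = snd (w n)" for n
  have Q: "Q n (us n) (vs n)" for n using w by (simp add: us_def vs_def)
  have [measurable]: "us n \<in> borel_measurable M" "vs n \<in> borel_measurable M" for n
    using meas[OF Q] by auto
  have us01: "us n z \<in> {0..1}" and vs01: "vs n z \<in> {0..1}" for n z using range[OF Q] by auto

  \<comment> \<open>For \<open>n \<le> m\<close> the later element also satisfies
    \<open>Q n\<close>, hence so does the midpoint, whose squared norm is therefore at least
    \<open>d n\<close>.\<close>
  have parallelogram: "R (\<lambda>z. us n z - us m z) (\<lambda>z. vs n z - vs m z)
      \<le> 2 * (d m - d n) + 2 * (1 / Suc n) + 2 * (1 / Suc m)" if "n \<le> m" for n m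
  proof -
    have m: "Q n (us m) (vs m)" using Q dec that by blast
    note i = sq_int[OF Q[of n]] sq_int[OF m]
    have mid': "Q n (\<lambda>z. (us n z + us m z) / 2) (\<lambda>z. (vs n z + vs m z) / 2)"
      using mid[OF Q m] .
    have "R (\<lambda>z. us n z - us m z) (\<lambda>z. vs n z - vs m z)
      = (\<integral>z. 2 * (us n z)\<^sup>2 + 2 * (us m z)\<^sup>2 - 4 * ((us n z + us m z) / 2)\<^sup>2 \<partial>P)
        + (\<integral>z. 2 * (vs n z)\<^sup>2 + 2 * (vs m z)\<^sup>2 - 4 * ((vs n z + vs m z) / 2)\<^sup>2 \<partial>N)"
      unfolding R_def by (intro arg_cong2[where f = "(+)"] Bochner_Integration.integral_cong)
        (auto simp: power2_eq_square field_simps)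
    also have "\<dots> = 2 * R (us n) (vs n) + 2 * R (us m) (vs m)
        - 4 * R (\<lambda>z. (us n z + us m z) / 2) (\<lambda>z. (vs n z + vs m z) / 2)"
      unfolding R_def using i sq_int[OF mid'] by (simp del: power_divide)
    also have "\<dots> \<le> 2 * (d n + 1 / Suc n) + 2 * (d m + 1 / Suc m) - 4 * d n"
      using w(2)[of n] w(2)[of m] d_le[OF mid'] by (simp add: us_def vs_def)
    finally show ?thesis by argo
  qed
  have R_Cauchy: "\<exists>n0. \<forall>n\<ge>n0. \<forall>m\<ge>n0. R (\<lambda>z. us n z - us m z) (\<lambda>z. vs n z - vs m z) \<le> \<delta>" if "0 < \<delta>" for \<delta>
  proof -
    from \<open>Cauchy d\<close> that obtain n1 where n1: "\<And>n m. n \<ge> n1 \<Longrightarrow> m \<ge> n1 \<Longrightarrow> \<bar>d m - d n\<bar> < \<delta> / 6"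
      unfolding Cauchy_def dist_real_def by (metis divide_pos_pos zero_less_numeral)
    from that have "0 < \<delta> / 6" by simp
    then obtain n2 where n2: "1 / real (Suc n2) < \<delta> / 6"
      by (rule nat_approx_posE)
    have "R (\<lambda>z. us n z - us m z) (\<lambda>z. vs n z - vs m z) \<le> \<delta>"
      if nm: "max n1 n2 \<le> n" "n \<le> m" for n m
    proof -
      have "1 / real (Suc k) \<le> 1 / real (Suc n2)" if "n2 \<le> k" for k
        using that by (intro divide_left_mono) auto
      then have "1 / real (Suc n) < \<delta> / 6" "1 / real (Suc m) < \<delta> / 6"
        using n2 nm by (meson le_less_trans max.bounded_iff order_trans)+
      moreover have "\<bar>d m - d n\<bar> < \<delta> / 6" using nm by (intro n1) auto
      ultimately show ?thesis using parallelogram[OF nm(2)] by argo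
    qed
    moreover have "R (\<lambda>z. us n z - us m z) (\<lambda>z. vs n z - vs m z) = R (\<lambda>z. us m z - us n z) (\<lambda>z. vs m z - vs n z)" for n m
      unfolding R_def by (simp add: power2_commute)
    ultimately show ?thesis by (metis linear)
  qed

  \<comment> \<open>From square norm to L1 norm by \<open>2 * |x| \<le> s + x^2 / s\<close> in place
    of Cauchy-Schwarz; \<open>s = \<eta> / (C + 1)\<close> keeps \<open>s * C\<close> below
    \<open>\<eta>\<close>. The L1 form is the one from which almost everywhere convergent
    subsequences are extracted.\<close>
  have L1_le: "(\<integral>z. norm (f z - g z) \<partial>F) < \<eta>"
    if \<eta>: "0 < \<eta>" and F: "finite_measure F" and FC: "measure F (space F) \<le> C"
      and f: "f \<in> borel_measurable F" "g \<in> borel_measurable F" "\<And>z. f z \<in> {0..1}" "\<And>z. g z \<in> {0..1}"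
      and le: "(\<integral>z. (f z - g z)\<^sup>2 \<partial>F) \<le> \<eta> / (C + 1) * \<eta>" for f g :: "'m \<Rightarrow> real" and F \<eta>
  proof -
    interpret F: finite_measure F by fact
    define s where "s = \<eta> / (C + 1)"
    have s: "0 < s" using \<eta> \<open>0 \<le> C\<close> by (simp add: s_def)
    have ab: "\<bar>f z - g z\<bar> \<le> 1" for z using f(3)[of z] f(4)[of z] by auto
    have i: "integrable F (\<lambda>z. f z - g z)" "integrable F (\<lambda>z. (f z - g z)\<^sup>2)"
      using f(1,2) ab by (auto intro!: F.integrable_const_bound[of _ 1] simp: abs_square_le_1)
    have "(\<integral>z. norm (f z - g z) \<partial>F) \<le> (\<integral>z. (s + (f z - g z)\<^sup>2 / s) / 2 \<partial>F)"
    proof (rule integral_mono)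
      fix z
      have "0 \<le> (s - \<bar>f z - g z\<bar>)\<^sup>2 / s" using s by simp
      also have "\<dots> = s + (f z - g z)\<^sup>2 / s - 2 * \<bar>f z - g z\<bar>"
        using s by (simp add: power2_diff field_simps) (simp add: power2_eq_square)
      finally show "norm (f z - g z) \<le> (s + (f z - g z)\<^sup>2 / s) / 2" by simp
    qed (use i in auto)
    also have "\<dots> = (s * measure F (space F) + (\<integral>z. (f z - g z)\<^sup>2 \<partial>F) / s) / 2"
      using i by simp
    also have "\<dots> \<le> (s * C + \<eta>) / 2"
      using s FC le by (intro divide_right_mono add_mono mult_left_mono) (auto simp: s_def[symmetric] pos_divide_le_eq mult.commute)
    also have "s * C < \<eta>" using \<eta> \<open>0 \<le> C\<close> by (simp add: s_def field_simps)
    finally show ?thesis by simp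
  qed
  have PC: "measure P (space P) \<le> C" and NC: "measure N (space N) \<le> C" by (auto simp: C_def)
  have R_ge: "(\<integral>z. (f z)\<^sup>2 \<partial>P) \<le> R f g" "(\<integral>z. (g z)\<^sup>2 \<partial>N) \<le> R f g" for f g
    by (auto simp: R_def)
  have "\<exists>n0. \<forall>n\<ge>n0. \<forall>m\<ge>n0. (\<integral>z. norm (us n z - us m z) \<partial>P) < \<eta> \<and> (\<integral>z. norm (vs n z - vs m z) \<partial>N) < \<eta>"
    if \<eta>: "0 < \<eta>" for \<eta>
  proof -
    have "0 < \<eta> / (C + 1) * \<eta>" using \<eta> \<open>0 \<le> C\<close> by simp
    from R_Cauchy[OF this] obtain n0 where n0: "\<And>n m. n \<ge> n0 \<Longrightarrow> m \<ge> n0 \<Longrightarrow>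
        R (\<lambda>z. us n z - us m z) (\<lambda>z. vs n z - vs m z) \<le> \<eta> / (C + 1) * \<eta>" by blast
    have "(\<integral>z. norm (us n z - us m z) \<partial>P) < \<eta>" "(\<integral>z. norm (vs n z - vs m z) \<partial>N) < \<eta>"
      if "n \<ge> n0" "m \<ge> n0" for n m
      using order_trans[OF R_ge(1) n0[OF that]] order_trans[OF R_ge(2) n0[OF that]] us01 vs01
      by (auto intro!: L1_le \<eta> fin PC NC simp del: real_norm_def)
    then show ?thesis by blast
  qed
  note L1_Cauchy = this
  have int: "integrable P (us n)" "integrable N (vs n)" for n using sq_int[OF Q] by auto
  obtain r1 where r1: "strict_mono r1" "AE z in P. Cauchy (\<lambda>i. us (r1 i) z)"
  proof (rule cauchy_L1_AE_cauchy_subseq[where s = us and M = P])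
    show "\<exists>n0. \<forall>n\<ge>n0. \<forall>m\<ge>n0. (\<integral>z. norm (us n z - us m z) \<partial>P) < \<eta>" if "0 < \<eta>" for \<eta>
      using L1_Cauchy[OF that] by blast
  qed (rule int)
  have "\<exists>n0. \<forall>n\<ge>n0. \<forall>m\<ge>n0. (\<integral>z. norm (vs (r1 n) z - vs (r1 m) z) \<partial>N) < \<eta>" if "0 < \<eta>" for \<eta>
    using L1_Cauchy[OF that] seq_suble[OF r1(1)] by (meson order_trans)
  \<comment> \<open>The second subsequence is taken inside the first, so that their composition
    works for \<open>P\<close> and \<open>N\<close> simultaneously.\<close>
  then obtain r2 where r2: "strict_mono r2" "AE z in N. Cauchy (\<lambda>i. vs (r1 (r2 i)) z)"
    using cauchy_L1_AE_cauchy_subseq[where s = "\<lambda>n. vs (r1 n)" and M = N, OF int(2)] by blast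
  define r where "r n = r1 (r2 n)" for n
  have r: "strict_mono r" using strict_mono_o[OF r1(1) r2(1)] by (simp add: r_def[abs_def] o_def)
  have AEP: "AE z in P. convergent (\<lambda>i. us (r i) z)"
    using r1(2)
  proof eventually_elim
    case (elim z)
    then have "Cauchy ((\<lambda>i. us (r1 i) z) \<circ> r2)" using r2(1) by (rule Cauchy_subseq_Cauchy)
    then show ?case by (simp add: r_def o_def Cauchy_convergent_iff)
  qed
  have AEN: "AE z in N. convergent (\<lambda>i. vs (r i) z)"
    using r2(2) by (simp add: r_def Cauchy_convergent_iff)
  \<comment> \<open>Clamping gives values in [0, 1] everywhere, also on the null set where the
    sequence may diverge and \<open>lim\<close> is unspecified.\<close>
  define u where "u z = max 0 (min 1 (lim (\<lambda>i. us (r i) z)))" for z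
  define v where "v z = max 0 (min 1 (lim (\<lambda>i. vs (r i) z)))" for z
  have clamp: "X \<longlonglongrightarrow> max 0 (min 1 (lim X))" if "convergent X" "\<And>i. X i \<in> {0..1}" for X :: "nat \<Rightarrow> real"
  proof -
    have X: "X \<longlonglongrightarrow> lim X" using that(1) by (simp add: convergent_LIMSEQ_iff)
    have "lim X \<le> 1" by (rule LIMSEQ_le_const2[OF X]) (use that(2) in auto)
    moreover have "0 \<le> lim X" by (rule LIMSEQ_le_const[OF X]) (use that(2) in auto)
    ultimately show ?thesis using X by simp
  qed
  show thesis
  proof (rule that[of "\<lambda>n. us (r n)" "\<lambda>n. vs (r n)" u v])
    show "Q n (us (r n)) (vs (r n))" for n using Q dec seq_suble[OF r] by blast
    show "u \<in> borel_measurable M" "v \<in> borel_measurable M"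
      unfolding u_def[abs_def] v_def[abs_def] by measurable
    show "AE z in P. (\<lambda>n. us (r n) z) \<longlonglongrightarrow> u z" using AEP
      by eventually_elim (use us01 in \<open>auto simp: u_def intro!: clamp\<close>)
    show "AE z in N. (\<lambda>n. vs (r n) z) \<longlonglongrightarrow> v z" using AEN
      by eventually_elim (use vs01 in \<open>auto simp: v_def intro!: clamp\<close>)
  qed (auto simp: u_def v_def)
qed

text \<open>\<open>Q n\<close> collects the constraints with tolerance \<open>1 / Suc n\<close>.
  They are affine in \<open>(u, v)\<close>, so \<open>Q n\<close> is stable under midpoints;
  \<open>approximate_circulation\<close> shows that it can be satisfied, and bounded weights let
  each constraint pass to the almost everywhere limit.\<close>

lemma exact_circulation_normalized:
  fixes P N :: "'m measure" and e :: "'s \<Rightarrow> real" and p :: "'m \<Rightarrow> 'x" and q :: "'m \<Rightarrow> 's" and D :: real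
  assumes fin: "finite_measure P" "finite_measure N"
    and sets [measurable_cong]: "sets P = sets M" "sets N = sets M"
    and p [measurable]: "p \<in> measurable M XM" and q [measurable]: "q \<in> measurable M SM"
    and e [measurable]: "e \<in> borel_measurable SM" and e_ge_1: "\<And>s. 1 \<le> e s"
    and D: "\<And>h k. h \<in> borel_measurable XM \<Longrightarrow> k \<in> borel_measurable SM \<Longrightarrow>
      ennreal D \<le> (\<integral>\<^sup>+z. ennreal (1 - h (p z) - k (q z)) \<partial>P)
        + (\<integral>\<^sup>+z. ennreal (e (q z) * (h (p z) + k (q z))) \<partial>N)"
  obtains u v :: "'m \<Rightarrow> real" where "u \<in> borel_measurable M" "v \<in> borel_measurable M"
    "\<And>z. u z \<in> {0..1}" "\<And>z. v z \<in> {0..1}"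
    "\<And>B. B \<in> sets SM \<Longrightarrow>
      (\<integral>\<^sup>+z. ennreal (u z / e (q z)) * indicator B (q z) \<partial>P) = (\<integral>\<^sup>+z. ennreal (v z) * indicator B (q z) \<partial>N)"
    "\<And>A. A \<in> sets XM \<Longrightarrow>
      (\<integral>\<^sup>+z. ennreal (v z * e (q z)) * indicator A (p z) \<partial>N) = (\<integral>\<^sup>+z. ennreal (u z) * indicator A (p z) \<partial>P)"
    "ennreal D \<le> (\<integral>\<^sup>+z. ennreal (u z) \<partial>P)"
proof -
  interpret P: finite_measure P by fact
  interpret N: finite_measure N by fact
  have e_pos: "0 < e s" "0 \<le> e s" for s using e_ge_1[of s] by auto
  define IP where "IP B u = (\<integral>z. u z * (indicator B (q z) / e (q z)) \<partial>P)" for B and u :: "'m \<Rightarrow> real"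
  define IN where "IN B v = (\<integral>z. v z * indicator B (q z) \<partial>N)" for B and v :: "'m \<Rightarrow> real"
  define XP where "XP A u = (\<integral>z. u z * indicator A (p z) \<partial>P)" for A and u :: "'m \<Rightarrow> real"
  define XN where "XN j A v = (\<integral>z. v z * (min (e (q z)) j * indicator A (p z)) \<partial>N)" for j A and v :: "'m \<Rightarrow> real"
  define ok :: "('m \<Rightarrow> real) \<Rightarrow> bool" where "ok u \<longleftrightarrow> u \<in> borel_measurable M \<and> (\<forall>z. u z \<in> {0..1})" for u
  \<comment> \<open>All truncation levels \<open>j\<close> up to \<open>Suc n\<close> are required,
    so that \<open>Q\<close> decreases in \<open>n\<close> by plain inclusion and each fixed
    \<open>j\<close> is available for all large \<open>n\<close>.\<close>
  define Q where "Q n u v \<longleftrightarrow> ok u \<and> ok v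
    \<and> (\<forall>B\<in>sets SM. \<bar>IP B u - IN B v\<bar> \<le> 1 / Suc n)
    \<and> (\<forall>A\<in>sets XM. \<forall>j\<in>{1..real (Suc n)}. XN j A v \<le> XP A u + 1 / Suc n)
    \<and> D \<le> integral\<^sup>L P u + 1 / Suc n" for n u v
  have wIP: "\<bar>indicator B (q z) / e (q z)\<bar> \<le> 1" for B z
    using e_ge_1[of "q z"] by (auto simp: indicator_def)
  have wXN: "\<bar>min (e (q z)) j * indicator A (p z)\<bar> \<le> j" if "1 \<le> j" for A z j
    using e_ge_1[of "q z"] that by (auto simp: indicator_def)
  have int: "integrable P (\<lambda>z. u z * f z)" "integrable N (\<lambda>z. u z * f z)"
    if [measurable]: "f \<in> borel_measurable M" and "ok u" "\<And>z. \<bar>f z\<bar> \<le> K" for u f and K :: real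
  proof -
    have [measurable]: "u \<in> borel_measurable M" and u: "\<And>z. 0 \<le> u z" "\<And>z. u z \<le> 1"
      using \<open>ok u\<close> by (auto simp: ok_def)
    have "\<bar>u z * f z\<bar> \<le> K" for z
    proof -
      have "u z * \<bar>f z\<bar> \<le> 1 * K" using u that(3) by (intro mult_mono) auto
      then show ?thesis using u by (simp add: abs_mult)
    qed
    then show "integrable P (\<lambda>z. u z * f z)" "integrable N (\<lambda>z. u z * f z)"
      by (auto intro!: P.integrable_const_bound[of _ K] N.integrable_const_bound[of _ K])
  qed
  \<comment> \<open>Dominated convergence on a finite measure space with a bounded weight; this is
    why \<open>e\<close> enters the \<open>X\<close>-constraints only as
    \<open>min e j\<close>.\<close>
  have lim: "(\<lambda>n. \<integral>z. us n z * f z \<partial>F) \<longlonglongrightarrow> (\<integral>z. u z * f z \<partial>F)"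
    if F: "finite_measure F" "sets F = sets M" and [measurable]: "f \<in> borel_measurable M"
      and us: "\<And>n. ok (us n)" and "ok u" "\<And>z. \<bar>f z\<bar> \<le> K" and ae: "AE z in F. (\<lambda>n. us n z) \<longlonglongrightarrow> u z"
    for us u f F and K :: real
  proof -
    interpret F: finite_measure F by fact
    note F(2) [measurable_cong]
    have [measurable]: "u \<in> borel_measurable M" "us n \<in> borel_measurable M" for n
      using us \<open>ok u\<close> by (auto simp: ok_def)
    show ?thesis
    proof (rule integral_dominated_convergence[where w = "\<lambda>_. K"])
      show "AE z in F. (\<lambda>n. us n z * f z) \<longlonglongrightarrow> u z * f z"
        using ae by eventually_elim (auto intro!: tendsto_intros)
      have "\<bar>us n z * f z\<bar> \<le> K" for z n
      proof -
        have "us n z * \<bar>f z\<bar> \<le> 1 * K" using us[of n] that(6) by (intro mult_mono) (auto simp: ok_def)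
        then show ?thesis using us[of n] by (simp add: abs_mult ok_def)
      qed
      then show "AE z in F. norm (us n z * f z) \<le> K" for n by simp
    qed auto
  qed
  have ok_mid: "ok (\<lambda>z. (u z + u' z) / 2)" if "ok u" "ok u'" for u u'
    unfolding ok_def
  proof (intro conjI allI)
    have [measurable]: "u \<in> borel_measurable M" "u' \<in> borel_measurable M"
      using that by (auto simp: ok_def)
    show "(\<lambda>z. (u z + u' z) / 2) \<in> borel_measurable M" by measurable
    fix z
    have "u z \<in> {0..1}" "u' z \<in> {0..1}" using that by (simp_all only: ok_def)
    then show "(u z + u' z) / 2 \<in> {0..1}" by simp
  qed
  have ex: "\<exists>u v. Q n u v" for n
  proof -
    obtain u v where uv: "u \<in> borel_measurable M" "v \<in> borel_measurable M"
      "\<And>z. 0 \<le> u z \<and> u z \<le> 1" "\<And>z. 0 \<le> v z \<and> v z \<le> 1"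
      "\<And>B. B \<in> sets SM \<Longrightarrow> \<bar>IP B u - IN B v\<bar> \<le> 1 / Suc n"
      "\<And>A. A \<in> sets XM \<Longrightarrow> XN (Suc n) A v \<le> XP A u + 1 / Suc n"
      "D \<le> integral\<^sup>L P u + 1 / Suc n"
      by (rule approximate_circulation[OF fin sets p q e e_ge_1 D, of "1 / Suc n" "real (Suc n)",
            folded IP_def IN_def XP_def XN_def])
        ((assumption, assumption, simp, simp), (rule that; assumption))
    have ok: "ok u" "ok v" using uv by (auto simp: ok_def)
    \<comment> \<open>The approximate constraints are known at the level \<open>Suc n\<close> only;
      lower levels follow by monotonicity in \<open>j\<close>.\<close>
    have "XN j A v \<le> XN (Suc n) A v" if [measurable]: "A \<in> sets XM" and j: "1 \<le> j" "j \<le> Suc n" for j :: real and A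
    proof -
      have "\<bar>min (e (q z)) j * indicator A (p z)\<bar> \<le> real (Suc n)" for z
        using wXN[OF j(1)] j(2) by (rule order_trans)
      moreover have "min (e (q z)) j \<le> min (e (q z)) (real (Suc n))" for z using j by auto
      ultimately show ?thesis
        unfolding XN_def using ok uv(4) wXN[of "real (Suc n)"]
        by (intro integral_mono int[where K = "real (Suc n)"] mult_left_mono mult_right_mono) simp_all
    qed
    then have "Q n u v" using uv ok unfolding Q_def by (fastforce intro: order_trans)
    then show ?thesis by blast
  qed
  have mid: "Q n (\<lambda>z. (u z + u' z) / 2) (\<lambda>z. (v z + v' z) / 2)" if Q: "Q n u v" "Q n u' v'" for n u v u' v'
  proof -
    have ok: "ok u" "ok v" "ok u'" "ok v'" using Q by (auto simp: Q_def)
    have avg: "(\<integral>z. (f z + f' z) / 2 * w z \<partial>F) = ((\<integral>z. f z * w z \<partial>F) + (\<integral>z. f' z * w z \<partial>F)) / 2"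
      if "integrable F (\<lambda>z. f z * w z)" "integrable F (\<lambda>z. f' z * w z)" for f f' w :: "'m \<Rightarrow> real" and F
    proof -
      have "(\<integral>z. (f z + f' z) / 2 * w z \<partial>F) = (\<integral>z. (f z * w z + f' z * w z) / 2 \<partial>F)"
        by (intro Bochner_Integration.integral_cong) (auto simp: field_simps)
      then show ?thesis using that by simp
    qed
    have eIP: "IP B (\<lambda>z. (u z + u' z) / 2) = (IP B u + IP B u') / 2" if [measurable]: "B \<in> sets SM" for B
      unfolding IP_def using ok wIP by (intro avg int[where K = 1]) auto
    have eIN: "IN B (\<lambda>z. (v z + v' z) / 2) = (IN B v + IN B v') / 2" if [measurable]: "B \<in> sets SM" for B
      unfolding IN_def using ok by (intro avg int[where K = 1]) auto
    have eXP: "XP A (\<lambda>z. (u z + u' z) / 2) = (XP A u + XP A u') / 2" if [measurable]: "A \<in> sets XM" for A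
      unfolding XP_def using ok by (intro avg int[where K = 1]) auto
    have eXN: "XN j A (\<lambda>z. (v z + v' z) / 2) = (XN j A v + XN j A v') / 2"
      if [measurable]: "A \<in> sets XM" and "1 \<le> j" for A j
      unfolding XN_def using ok wXN[OF that(2)] by (intro avg int[where K = j]) auto
    have eP: "integral\<^sup>L P (\<lambda>z. (u z + u' z) / 2) = (integral\<^sup>L P u + integral\<^sup>L P u') / 2"
      using avg[of P u "\<lambda>_. 1" u'] int(1)[of "\<lambda>_. 1" _ 1] ok by simp
    show ?thesis
      unfolding Q_def
    proof (intro conjI ballI ok_mid ok)
      fix B assume B: "B \<in> sets SM"
      then have "\<bar>IP B u - IN B v\<bar> \<le> 1 / real (Suc n)" "\<bar>IP B u' - IN B v'\<bar> \<le> 1 / real (Suc n)"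
        using Q by (simp_all only: Q_def)
      then show "\<bar>IP B (\<lambda>z. (u z + u' z) / 2) - IN B (\<lambda>z. (v z + v' z) / 2)\<bar> \<le> 1 / real (Suc n)"
        unfolding eIP[OF B] eIN[OF B] by argo
    next
      fix A j assume A: "A \<in> sets XM" and j: "j \<in> {1..real (Suc n)}"
      then have "XN j A v \<le> XP A u + 1 / real (Suc n)" "XN j A v' \<le> XP A u' + 1 / real (Suc n)"
        using Q by (simp_all only: Q_def)
      moreover have "1 \<le> j" using j by simp
      ultimately show "XN j A (\<lambda>z. (v z + v' z) / 2) \<le> XP A (\<lambda>z. (u z + u' z) / 2) + 1 / real (Suc n)"
        unfolding eXP[OF A] eXN[OF A \<open>1 \<le> j\<close>] by argo
    next
      have "D \<le> integral\<^sup>L P u + 1 / real (Suc n)" "D \<le> integral\<^sup>L P u' + 1 / real (Suc n)"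
        using Q by (simp_all only: Q_def)
      then show "D \<le> integral\<^sup>L P (\<lambda>z. (u z + u' z) / 2) + 1 / real (Suc n)"
        unfolding eP by argo
    qed
  qed
  have dec: "Q m u v" if "Q n u v" "m \<le> n" for m n u v
  proof -
    have "1 / real (Suc n) \<le> 1 / real (Suc m)" using that by (intro divide_left_mono) auto
    moreover have "{1..real (Suc m)} \<subseteq> {1..real (Suc n)}" using that by auto
    ultimately show ?thesis using that unfolding Q_def by (blast intro: order_trans add_left_mono)
  qed
  obtain us vs u v where Q: "\<And>n. Q n (us n) (vs n)"
    and uv: "u \<in> borel_measurable M" "v \<in> borel_measurable M" "\<And>z. u z \<in> {0..1}" "\<And>z. v z \<in> {0..1}"
    and ae: "AE z in P. (\<lambda>n. us n z) \<longlonglongrightarrow> u z" "AE z in N. (\<lambda>n. vs n z) \<longlonglongrightarrow> v z"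
  proof (rule nested_convex_AE_limit[OF fin sets, of Q])
    show "\<And>n u v. Q n u v \<Longrightarrow> u \<in> borel_measurable M \<and> v \<in> borel_measurable M"
      "\<And>n u v z. Q n u v \<Longrightarrow> u z \<in> {0..1} \<and> v z \<in> {0..1}"
      by (auto simp: Q_def ok_def)
  qed (use mid dec ex in \<open>blast+\<close>)
  have ok: "ok (us n)" "ok (vs n)" "ok u" "ok v" for n using Q[of n] uv by (auto simp: Q_def ok_def)
  have [measurable]: "u \<in> borel_measurable M" "v \<in> borel_measurable M" by (fact uv)+
  have inv: "(\<lambda>n. 1 / real (Suc n)) \<longlonglongrightarrow> 0"
    using LIMSEQ_inverse_real_of_nat by (simp add: inverse_eq_divide)
  have u01: "0 \<le> u z" "u z \<le> 1" and v01: "0 \<le> v z" "v z \<le> 1" for z using uv(3)[of z] uv(4)[of z] by auto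

  have S_eq: "IP B u = IN B v" if [measurable]: "B \<in> sets SM" for B
  proof -
    have "(\<lambda>n. IP B (us n)) \<longlonglongrightarrow> IP B u"
      unfolding IP_def by (intro lim[where K = 1] fin sets ok ae wIP) auto
    moreover have "(\<lambda>n. IN B (vs n)) \<longlonglongrightarrow> IN B v"
      unfolding IN_def by (intro lim[where K = 1] fin sets ok ae) auto
    ultimately have "(\<lambda>n. \<bar>IP B (us n) - IN B (vs n)\<bar>) \<longlonglongrightarrow> \<bar>IP B u - IN B v\<bar>"
      by (intro tendsto_intros)
    from LIMSEQ_le[OF this inv] have "\<bar>IP B u - IN B v\<bar> \<le> 0"
      using Q that by (auto simp: Q_def)
    then show ?thesis by simp
  qed
  have X_le: "XN j A v \<le> XP A u" if [measurable]: "A \<in> sets XM" and j: "1 \<le> j" for A j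
  proof -
    have "(\<lambda>n. XN j A (vs n)) \<longlonglongrightarrow> XN j A v"
      unfolding XN_def by (intro lim[where K = j] fin sets ok ae wXN j) auto
    moreover have "(\<lambda>n. XP A (us n)) \<longlonglongrightarrow> XP A u"
      unfolding XP_def by (intro lim[where K = 1] fin sets ok ae) auto
    then have "(\<lambda>n. XP A (us n) + 1 / real (Suc n)) \<longlonglongrightarrow> XP A u + 0"
      by (intro tendsto_add inv)
    ultimately have "XN j A v \<le> XP A u + 0"
    proof (rule LIMSEQ_le)
      obtain n0 where n0: "j \<le> real n0" using real_arch_simple by blast
      have "XN j A (vs n) \<le> XP A (us n) + 1 / real (Suc n)" if "n \<ge> n0" for n
      proof -
        have "j \<in> {1..real (Suc n)}" using j n0 that by simp
        then show ?thesis using Q[of n] \<open>A \<in> sets XM\<close> unfolding Q_def by blast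
      qed
      then show "\<exists>n0. \<forall>n\<ge>n0. XN j A (vs n) \<le> XP A (us n) + 1 / real (Suc n)" by blast
    qed
    then show ?thesis by simp
  qed
  have D_le: "D \<le> integral\<^sup>L P u"
  proof -
    have "(\<lambda>n. integral\<^sup>L P (us n)) \<longlonglongrightarrow> integral\<^sup>L P u"
      using lim[OF fin(1) sets(1), of "\<lambda>_. 1" us u 1] ok ae by simp
    then have "(\<lambda>n. integral\<^sup>L P (us n) + 1 / real (Suc n)) \<longlonglongrightarrow> integral\<^sup>L P u + 0"
      by (intro tendsto_add inv)
    then show ?thesis
      using LIMSEQ_le_const[of _ "integral\<^sup>L P u" D] Q by (auto simp: Q_def)
  qed

  have S_nn: "(\<integral>\<^sup>+z. ennreal (u z / e (q z)) * indicator B (q z) \<partial>P) = (\<integral>\<^sup>+z. ennreal (v z) * indicator B (q z) \<partial>N)"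
    if [measurable]: "B \<in> sets SM" for B
  proof -
    have "(\<integral>\<^sup>+z. ennreal (u z / e (q z)) * indicator B (q z) \<partial>P)
        = (\<integral>\<^sup>+z. ennreal (u z * (indicator B (q z) / e (q z))) \<partial>P)"
      by (intro nn_integral_cong) (auto simp: indicator_def)
    also have "\<dots> = ennreal (IP B u)"
      unfolding IP_def using ok u01 e_pos wIP
      by (intro nn_integral_eq_integral int[where K = 1] AE_I2) auto
    also have "\<dots> = ennreal (IN B v)" by (simp add: S_eq)
    also have "\<dots> = (\<integral>\<^sup>+z. ennreal (v z * indicator B (q z)) \<partial>N)"
      unfolding IN_def using ok v01
      by (intro nn_integral_eq_integral[symmetric] int[where K = 1] AE_I2) auto
    also have "\<dots> = (\<integral>\<^sup>+z. ennreal (v z) * indicator B (q z) \<partial>N)"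
      by (intro nn_integral_cong) (auto simp: indicator_def)
    finally show ?thesis .
  qed
  have XP_nn: "(\<integral>\<^sup>+z. ennreal (u z) * indicator A (p z) \<partial>P) = ennreal (XP A u)" if [measurable]: "A \<in> sets XM" for A
  proof -
    have "ennreal (XP A u) = (\<integral>\<^sup>+z. ennreal (u z * indicator A (p z)) \<partial>P)"
      unfolding XP_def using ok u01
      by (intro nn_integral_eq_integral[symmetric] int[where K = 1] AE_I2) auto
    also have "\<dots> = (\<integral>\<^sup>+z. ennreal (u z) * indicator A (p z) \<partial>P)"
      by (intro nn_integral_cong) (auto simp: indicator_def)
    finally show ?thesis by simp
  qed
  define XN' where "XN' A = (\<integral>\<^sup>+z. ennreal (v z * e (q z)) * indicator A (p z) \<partial>N)" for A
  \<comment> \<open>Fatou's lemma removes the truncation: at each point \<open>f n\<close> is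
    constant once \<open>n\<close> is at least the value of \<open>e\<close>.\<close>
  have X_nn_le: "XN' A \<le> ennreal (XP A u)" if [measurable]: "A \<in> sets XM" for A
  proof -
    define f where "f n z = ennreal (v z * (min (e (q z)) (real (Suc n)) * indicator A (p z)))" for n z
    have [measurable]: "f n \<in> borel_measurable N" for n unfolding f_def by measurable
    have f_le: "(\<integral>\<^sup>+z. f n z \<partial>N) \<le> ennreal (XP A u)" for n
    proof -
      have "(\<integral>\<^sup>+z. f n z \<partial>N) = ennreal (XN (Suc n) A v)"
        unfolding f_def XN_def using ok v01 e_pos wXN
        by (intro nn_integral_eq_integral int[where K = "Suc n"] AE_I2 mult_nonneg_nonneg) auto
      also have "\<dots> \<le> ennreal (XP A u)" using X_le by (intro ennreal_leI) auto
      finally show ?thesis .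
    qed
    have "XN' A = (\<integral>\<^sup>+z. liminf (\<lambda>n. f n z) \<partial>N)"
      unfolding XN'_def
    proof (intro nn_integral_cong)
      fix z
      obtain n0 where n0: "e (q z) \<le> real n0" using real_arch_simple by blast
      have "eventually (\<lambda>n. ennreal (v z * e (q z)) * indicator A (p z) = f n z) sequentially"
        using n0 by (intro eventually_sequentiallyI[of n0]) (auto simp: f_def indicator_def)
      then have "(\<lambda>n. f n z) \<longlonglongrightarrow> ennreal (v z * e (q z)) * indicator A (p z)"
        by (rule Lim_transform_eventually[OF tendsto_const])
      then show "ennreal (v z * e (q z)) * indicator A (p z) = liminf (\<lambda>n. f n z)"
        by (intro lim_imp_Liminf[symmetric]) auto
    qed
    also have "\<dots> \<le> liminf (\<lambda>n. \<integral>\<^sup>+z. f n z \<partial>N)"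
      by (intro nn_integral_liminf) auto
    also have "\<dots> \<le> ennreal (XP A u)"
      using f_le by (intro Liminf_le) auto
    finally show ?thesis .
  qed
  \<comment> \<open>As \<open>e\<close> is unbounded, only an inequality between the \<open>X\<close>-marginals survives the limit. The
    \<open>S\<close>-marginals give equal total masses, which turns it into an equality.\<close>
  have total: "XN' (space XM) = ennreal (XP (space XM) u)"
  proof -
    define \<mu> where "\<mu> = distr (density P (\<lambda>z. ennreal (u z / e (q z)))) SM q"
    define \<nu> where "\<nu> = distr (density N (\<lambda>z. ennreal (v z))) SM q"
    have [measurable_cong]: "sets \<mu> = sets SM" "sets \<nu> = sets SM" by (auto simp: \<mu>_def \<nu>_def)
    have sp: "space P = space M" "space N = space M"
      using sets_eq_imp_space_eq[OF sets(1)] sets_eq_imp_space_eq[OF sets(2)] by auto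
    have "\<mu> = \<nu>"
    proof (rule measure_eqI)
      fix B assume "B \<in> sets \<mu>"
      then have [measurable]: "B \<in> sets SM" by (simp add: \<mu>_def)
      have "emeasure \<mu> B = (\<integral>\<^sup>+z. ennreal (u z / e (q z)) * indicator B (q z) \<partial>P)"
        unfolding \<mu>_def by (subst emeasure_distr, simp, simp, subst emeasure_density)
          (auto intro!: nn_integral_cong simp: indicator_def)
      moreover have "emeasure \<nu> B = (\<integral>\<^sup>+z. ennreal (v z) * indicator B (q z) \<partial>N)"
        unfolding \<nu>_def by (subst emeasure_distr, simp, simp, subst emeasure_density)
          (auto intro!: nn_integral_cong simp: indicator_def)
      ultimately show "emeasure \<mu> B = emeasure \<nu> B" by (simp add: S_nn)
    qed (simp add: \<mu>_def \<nu>_def)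
    have "(\<integral>\<^sup>+s. ennreal (e s) \<partial>\<mu>) = (\<integral>\<^sup>+z. ennreal (u z / e (q z)) * ennreal (e (q z)) \<partial>P)"
      unfolding \<mu>_def by (simp add: nn_integral_distr nn_integral_density)
    also have "\<dots> = (\<integral>\<^sup>+z. ennreal (u z) * indicator (space XM) (p z) \<partial>P)"
    proof (intro nn_integral_cong)
      fix z assume "z \<in> space P"
      then have "p z \<in> space XM" using measurable_space[OF p] by (simp add: sp)
      then show "ennreal (u z / e (q z)) * ennreal (e (q z)) = ennreal (u z) * indicator (space XM) (p z)"
        using e_pos[of "q z"] u01 by (simp add: ennreal_mult'[symmetric])
    qed
    also have "\<dots> = ennreal (XP (space XM) u)" by (rule XP_nn) simp
    finally have 1: "(\<integral>\<^sup>+s. ennreal (e s) \<partial>\<mu>) = ennreal (XP (space XM) u)" .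
    have "(\<integral>\<^sup>+s. ennreal (e s) \<partial>\<nu>) = (\<integral>\<^sup>+z. ennreal (v z) * ennreal (e (q z)) \<partial>N)"
      unfolding \<nu>_def by (simp add: nn_integral_distr nn_integral_density)
    also have "\<dots> = XN' (space XM)"
      unfolding XN'_def
    proof (intro nn_integral_cong)
      fix z assume "z \<in> space N"
      then have "p z \<in> space XM" using measurable_space[OF p] by (simp add: sp)
      then show "ennreal (v z) * ennreal (e (q z)) = ennreal (v z * e (q z)) * indicator (space XM) (p z)"
        using e_pos[of "q z"] v01 by (simp add: ennreal_mult'[symmetric])
    qed
    finally show ?thesis using 1 \<open>\<mu> = \<nu>\<close> by simp
  qed
  \<comment> \<open>The inequality holds on \<open>A\<close> and on its complement, while the sums
    agree and are finite, so neither inequality can be strict.\<close>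
  have X_eq: "XN' A = (\<integral>\<^sup>+z. ennreal (u z) * indicator A (p z) \<partial>P)" if [measurable]: "A \<in> sets XM" for A
  proof -
    let ?Ac = "space XM - A"
    have ind: "indicator (space XM) x = (indicator A x + indicator ?Ac x :: 'b :: semiring_1)" for x
      using sets.sets_into_space[OF that] by (auto simp: indicator_def)
    have "XN' (space XM) = XN' A + XN' ?Ac"
      unfolding XN'_def ind distrib_left by (intro nn_integral_add) auto
    moreover have "(\<integral>\<^sup>+z. ennreal (u z) * indicator (space XM) (p z) \<partial>P)
      = (\<integral>\<^sup>+z. ennreal (u z) * indicator A (p z) \<partial>P) + (\<integral>\<^sup>+z. ennreal (u z) * indicator ?Ac (p z) \<partial>P)"
      unfolding ind distrib_left by (intro nn_integral_add) auto
    ultimately have "XN' A + XN' ?Ac = ennreal (XP A u) + ennreal (XP ?Ac u)"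
      using total by (simp add: XP_nn)
    moreover have "XN' A \<le> ennreal (XP A u)" "XN' ?Ac \<le> ennreal (XP ?Ac u)"
      by (auto intro!: X_nn_le)
    moreover from this(2) have "XN' ?Ac \<noteq> \<infinity>" by (auto simp: top_unique)
    ultimately have "XN' ?Ac + ennreal (XP A u) \<le> XN' ?Ac + XN' A" "XN' ?Ac \<noteq> \<infinity>"
      by (metis add.commute add_left_mono)+
    then have "ennreal (XP A u) \<le> XN' A"
      by (simp only: ennreal_add_left_cancel_le simp_thms)
    then show ?thesis using X_nn_le[OF that] by (simp add: XP_nn)
  qed
  have "ennreal D \<le> ennreal (integral\<^sup>L P u)" using D_le by (rule ennreal_leI)
  also have "\<dots> = (\<integral>\<^sup>+z. ennreal (u z) \<partial>P)"
    using int(1)[of "\<lambda>_. 1" u 1] ok u01 by (intro nn_integral_eq_integral[symmetric]) auto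
  finally have "ennreal D \<le> (\<integral>\<^sup>+z. ennreal (u z) \<partial>P)" .
  show thesis
    by (rule that[of u v]) (fact uv S_nn X_eq[unfolded XN'_def] \<open>ennreal D \<le> (\<integral>\<^sup>+z. ennreal (u z) \<partial>P)\<close>)+
qed

text \<open>Apply the normalised form to \<open>P\<close> weighted by \<open>c\<close> and
  \<open>N\<close> weighted by \<open>l = min 1 c\<close>, where \<open>c = l * e\<close>: the first
  is finite by the cost assumption, the second because \<open>l\<close> is at most 1. The
  \<open>S\<close>-marginals then agree only after weighting by \<open>l\<close>, and as
  \<open>l\<close> is positive the weight can be divided out.\<close>

lemma exact_circulation:
  fixes P N :: "'m measure" and c :: "'s \<Rightarrow> real" and p :: "'m \<Rightarrow> 'x" and q :: "'m \<Rightarrow> 's" and D :: real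
  assumes fin: "finite_measure P" "finite_measure N"
    and sets [measurable_cong]: "sets P = sets M" "sets N = sets M"
    and p [measurable]: "p \<in> measurable M XM" and q [measurable]: "q \<in> measurable M SM"
    and c [measurable]: "c \<in> borel_measurable SM" and c_pos: "\<And>s. 0 < c s"
    and cost: "(\<integral>\<^sup>+z. ennreal (c (q z)) \<partial>P) < \<infinity>"
    and D: "\<And>h k. h \<in> borel_measurable XM \<Longrightarrow> k \<in> borel_measurable SM \<Longrightarrow>
      ennreal D \<le> (\<integral>\<^sup>+z. ennreal (c (q z) * (1 - h (p z) - k (q z))) \<partial>P)
        + (\<integral>\<^sup>+z. ennreal (c (q z) * (h (p z) + k (q z))) \<partial>N)"
  obtains u v :: "'m \<Rightarrow> real" where "u \<in> borel_measurable M" "v \<in> borel_measurable M"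
    "\<And>z. u z \<in> {0..1}" "\<And>z. v z \<in> {0..1}"
    "distr (density P (\<lambda>z. ennreal (u z))) SM q = distr (density N (\<lambda>z. ennreal (v z))) SM q"
    "\<And>A. A \<in> sets XM \<Longrightarrow>
      (\<integral>\<^sup>+z. ennreal (u z * c (q z)) * indicator A (p z) \<partial>P) = (\<integral>\<^sup>+z. ennreal (v z * c (q z)) * indicator A (p z) \<partial>N)"
    "ennreal D \<le> (\<integral>\<^sup>+z. ennreal (u z * c (q z)) \<partial>P)"
proof -
  interpret P: finite_measure P by fact
  interpret N: finite_measure N by fact
  define l where "l s = min 1 (c s)" for s
  define e where "e s = max 1 (c s)" for s
  have [measurable]: "l \<in> borel_measurable SM" "e \<in> borel_measurable SM"
    unfolding l_def[abs_def] e_def[abs_def] by auto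
  have le: "l s * e s = c s" "0 < l s" "0 \<le> l s" "1 \<le> e s" "c s / e s = l s" "0 \<le> c s" for s
    using c_pos[of s] by (auto simp: l_def e_def min_def max_def)
  define P' where "P' = density P (\<lambda>z. ennreal (c (q z)))"
  define N' where "N' = density N (\<lambda>z. ennreal (l (q z)))"
  have sets' [measurable_cong]: "sets P' = sets M" "sets N' = sets M"
    by (simp_all add: P'_def N'_def sets)
  have sp: "space P = space M" "space N = space M"
    using sets_eq_imp_space_eq[OF sets(1)] sets_eq_imp_space_eq[OF sets(2)] by auto
  have fin': "finite_measure P'" "finite_measure N'"
  proof -
    show "finite_measure P'"
      using cost by (intro finite_measureI) (simp add: P'_def emeasure_density nn_integral_density
          cong: nn_integral_cong)
    have "(\<integral>\<^sup>+z. ennreal (l (q z)) \<partial>N) \<le> (\<integral>\<^sup>+z. 1 \<partial>N)"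
      by (intro nn_integral_mono) (simp add: l_def)
    also have "\<dots> < \<infinity>" using N.emeasure_finite by (simp add: less_top[symmetric])
    finally show "finite_measure N'"
      by (intro finite_measureI) (simp add: N'_def emeasure_density cong: nn_integral_cong)
  qed
  have intP': "(\<integral>\<^sup>+z. f z \<partial>P') = (\<integral>\<^sup>+z. ennreal (c (q z)) * f z \<partial>P)"
    if [measurable]: "f \<in> borel_measurable M" for f
    unfolding P'_def by (rule nn_integral_density) auto
  have intN': "(\<integral>\<^sup>+z. f z \<partial>N') = (\<integral>\<^sup>+z. ennreal (l (q z)) * f z \<partial>N)"
    if [measurable]: "f \<in> borel_measurable M" for f
    unfolding N'_def by (rule nn_integral_density) auto
  have D': "ennreal D \<le> (\<integral>\<^sup>+z. ennreal (1 - h (p z) - k (q z)) \<partial>P')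
        + (\<integral>\<^sup>+z. ennreal (e (q z) * (h (p z) + k (q z))) \<partial>N')"
    if [measurable]: "h \<in> borel_measurable XM" "k \<in> borel_measurable SM" for h k
  proof -
    have "(\<integral>\<^sup>+z. ennreal (1 - h (p z) - k (q z)) \<partial>P') = (\<integral>\<^sup>+z. ennreal (c (q z) * (1 - h (p z) - k (q z))) \<partial>P)"
      by (subst intP') (auto intro!: nn_integral_cong simp: ennreal_mult' le)
    moreover have "(\<integral>\<^sup>+z. ennreal (e (q z) * (h (p z) + k (q z))) \<partial>N') = (\<integral>\<^sup>+z. ennreal (c (q z) * (h (p z) + k (q z))) \<partial>N)"
    proof (subst intN')
      have "ennreal (l s) * ennreal (e s * x) = ennreal (c s * x)" for s x
        by (simp add: ennreal_mult'[symmetric] le mult.assoc[symmetric])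
      then show "(\<integral>\<^sup>+z. ennreal (l (q z)) * ennreal (e (q z) * (h (p z) + k (q z))) \<partial>N)
          = (\<integral>\<^sup>+z. ennreal (c (q z) * (h (p z) + k (q z))) \<partial>N)" by simp
    qed auto
    ultimately show ?thesis using D[OF that] by simp
  qed
  obtain u v where uv [measurable]: "u \<in> borel_measurable M" "v \<in> borel_measurable M"
    and range: "\<And>z. u z \<in> {0..1}" "\<And>z. v z \<in> {0..1}"
    and S: "\<And>B. B \<in> sets SM \<Longrightarrow>
      (\<integral>\<^sup>+z. ennreal (u z / e (q z)) * indicator B (q z) \<partial>P') = (\<integral>\<^sup>+z. ennreal (v z) * indicator B (q z) \<partial>N')"
    and X: "\<And>A. A \<in> sets XM \<Longrightarrow>
      (\<integral>\<^sup>+z. ennreal (v z * e (q z)) * indicator A (p z) \<partial>N') = (\<integral>\<^sup>+z. ennreal (u z) * indicator A (p z) \<partial>P')"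
    and val: "ennreal D \<le> (\<integral>\<^sup>+z. ennreal (u z) \<partial>P')"
    by (rule exact_circulation_normalized[OF fin' sets' p q \<open>e \<in> borel_measurable SM\<close> le(4) D'])
      ((assumption, assumption), (rule that; assumption))
  have u0: "0 \<le> u z" and v0: "0 \<le> v z" for z using range[of z] by auto
  define \<mu> where "\<mu> = distr (density P (\<lambda>z. ennreal (u z))) SM q"
  define \<nu> where "\<nu> = distr (density N (\<lambda>z. ennreal (v z))) SM q"
  have [measurable_cong]: "sets \<mu> = sets SM" "sets \<nu> = sets SM" by (simp_all add: \<mu>_def \<nu>_def)
  have int_\<mu>: "(\<integral>\<^sup>+s. f s \<partial>\<mu>) = (\<integral>\<^sup>+z. ennreal (u z) * f (q z) \<partial>P)" if [measurable]: "f \<in> borel_measurable SM" for f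
    unfolding \<mu>_def by (simp add: nn_integral_distr nn_integral_density)
  have int_\<nu>: "(\<integral>\<^sup>+s. f s \<partial>\<nu>) = (\<integral>\<^sup>+z. ennreal (v z) * f (q z) \<partial>N)" if [measurable]: "f \<in> borel_measurable SM" for f
    unfolding \<nu>_def by (simp add: nn_integral_distr nn_integral_density)
  have l_eq: "density \<mu> (\<lambda>s. ennreal (l s)) = density \<nu> (\<lambda>s. ennreal (l s))"
  proof (rule measure_eqI)
    fix B assume "B \<in> sets (density \<mu> (\<lambda>s. ennreal (l s)))"
    then have [measurable]: "B \<in> sets SM" by (simp add: \<mu>_def)
    have "ennreal (u z) * (ennreal (l (q z)) * i) = ennreal (c (q z)) * (ennreal (u z / e (q z)) * i)" for z i
    proof -
      have "u z * l (q z) = c (q z) * (u z / e (q z))" by (simp add: le(5)[symmetric])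
      moreover have "0 \<le> u z / e (q z)" using u0[of z] le(4)[of "q z"] by simp
      ultimately show ?thesis using u0[of z] le[of "q z"] by (simp add: mult.assoc[symmetric] ennreal_mult[symmetric])
    qed
    then have "emeasure (density \<mu> (\<lambda>s. ennreal (l s))) B = (\<integral>\<^sup>+z. ennreal (u z / e (q z)) * indicator B (q z) \<partial>P')"
      by (simp add: emeasure_density int_\<mu> intP')
    also have "\<dots> = (\<integral>\<^sup>+z. ennreal (v z) * indicator B (q z) \<partial>N')" by (rule S) simp
    also have "\<dots> = emeasure (density \<nu> (\<lambda>s. ennreal (l s))) B"
      by (simp add: emeasure_density int_\<nu> intN' mult_ac)
    finally show "emeasure (density \<mu> (\<lambda>s. ennreal (l s))) B = emeasure (density \<nu> (\<lambda>s. ennreal (l s))) B" .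
  qed (simp add: \<mu>_def \<nu>_def)
  have "\<mu> = \<nu>"
  proof (rule measure_eqI)
    fix B assume "B \<in> sets \<mu>"
    then have [measurable]: "B \<in> sets SM" by (simp add: \<mu>_def)
    have "emeasure \<rho> B = (\<integral>\<^sup>+s. ennreal (1 / l s) * indicator B s \<partial>density \<rho> (\<lambda>s. ennreal (l s)))"
      if [measurable_cong]: "sets \<rho> = sets SM" for \<rho>
    proof -
      have "ennreal (l s) * (ennreal (1 / l s) * i) = i" for s i
        using le(2)[of s] by (simp add: mult.assoc[symmetric] ennreal_mult[symmetric])
      then show ?thesis by (simp add: nn_integral_density)
    qed
    then show "emeasure \<mu> B = emeasure \<nu> B" using l_eq by (simp add: \<mu>_def \<nu>_def)
  qed (simp add: \<mu>_def \<nu>_def)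
  have X': "(\<integral>\<^sup>+z. ennreal (u z * c (q z)) * indicator A (p z) \<partial>P) = (\<integral>\<^sup>+z. ennreal (v z * c (q z)) * indicator A (p z) \<partial>N)"
    if [measurable]: "A \<in> sets XM" for A
  proof -
    have 1: "ennreal (u z * c (q z)) * i = ennreal (c (q z)) * (ennreal (u z) * i)" for z i
      using u0[of z] le(6)[of "q z"] by (simp add: ennreal_mult mult_ac)
    have 2: "ennreal (v z * c (q z)) * i = ennreal (l (q z)) * (ennreal (v z * e (q z)) * i)" for z i
    proof -
      have "v z * c (q z) = l (q z) * (v z * e (q z))" by (simp add: le(1)[symmetric])
      moreover have "0 \<le> v z * e (q z)" using v0[of z] le(4)[of "q z"] by simp
      ultimately show ?thesis by (simp only: ennreal_mult[OF le(3)] mult.assoc)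
    qed
    show ?thesis using X[OF that] by (simp add: intP' intN' 1 2)
  qed
  have "ennreal D \<le> (\<integral>\<^sup>+z. ennreal (u z * c (q z)) \<partial>P)"
    using val u0 le(6) by (simp add: intP' ennreal_mult mult.commute)
  then show thesis
    using \<open>\<mu> = \<nu>\<close>[unfolded \<mu>_def \<nu>_def] X' uv range by (intro that[of u v])
qed

section \<open>Extension of tight volumes to Radon measures\<close>

text \<open>Without a separation axiom compact sets need not be closed. Borel sets, however, do not separate
  topologically indistinguishable points.\<close>

lemma borel_saturated:
  assumes "B \<in> sets borel" "\<And>U. open U \<Longrightarrow> x \<in> U \<longleftrightarrow> y \<in> U"
  shows "x \<in> B \<longleftrightarrow> y \<in> B"
  using assms(1) unfolding sets_borel
  by (induction rule: sigma_sets.induct) (use assms(2) in auto)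

text \<open>A point \<open>y\<close> outside \<open>B\<close> is told apart from each point of
  \<open>L\<close> by some open set, by \<open>borel_saturated\<close>; regularity improves this to
  disjoint neighbourhoods, and compactness to one neighbourhood of \<open>y\<close> that misses
  \<open>L\<close>.\<close>

lemma regular_compact_closure_subset_borel:
  fixes L :: "'a::topological_space set"
  assumes reg: "regular_space (euclidean :: 'a topology)"
    and L: "compact L" "L \<subseteq> B" and B: "B \<in> sets borel"
  shows "closure L \<subseteq> B"
proof
  fix y assume y: "y \<in> closure L"
  show "y \<in> B"
  proof (rule ccontr)
    assume "y \<notin> B"
    have sep: "\<exists>U V. open U \<and> open V \<and> x \<in> U \<and> y \<in> V \<and> U \<inter> V = {}" if "x \<in> L" for x
    proof -
      have "x \<in> B" using that L by blast
      then obtain W where W: "open W" "x \<in> W \<longleftrightarrow> y \<notin> W"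
        using borel_saturated[OF B] \<open>y \<notin> B\<close> by blast
      have *: "\<exists>U V. open U \<and> open V \<and> a \<in> U \<and> b \<in> V \<and> U \<inter> V = {}" if "a \<in> W" "b \<notin> W" for a b
      proof -
        have "closedin euclidean (- W)" "a \<in> topspace euclidean - (- W)" using W that by auto
        then obtain U V where "open U" "open V" "a \<in> U" "- W \<subseteq> V" "disjnt U V"
          using reg unfolding regular_space_def by (metis open_openin)
        then show ?thesis using that unfolding disjnt_def by blast
      qed
      show ?thesis using *[of x y] *[of y x] W by blast
    qed
    then obtain U V where UV: "\<And>x. x \<in> L \<Longrightarrow> open (U x) \<and> open (V x) \<and> x \<in> U x \<and> y \<in> V x \<and> U x \<inter> V x = {}"
      by metis
    then have "L \<subseteq> (\<Union>x\<in>L. U x)" by blast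
    then obtain F where F: "F \<subseteq> L" "finite F" "L \<subseteq> (\<Union>x\<in>F. U x)"
      using compactE_image[OF L(1), of L U] UV by metis
    have "open (\<Inter>x\<in>F. V x)" "y \<in> (\<Inter>x\<in>F. V x)" using F UV by blast+
    moreover have "(\<Inter>x\<in>F. V x) \<inter> L = {}" using F UV by blast
    ultimately show False using y by (metis disjoint_iff closure_iff_nhds_not_empty order_refl Int_commute)
  qed
qed

text \<open>The union of a finite subcover of \<open>L\<close> is open, hence Borel, and so already
  contains the closure of \<open>L\<close>.\<close>

lemma regular_compact_closure:
  fixes L :: "'a::topological_space set"
  assumes reg: "regular_space (euclidean :: 'a topology)" and L: "compact L"
  shows "compact (closure L)"
proof (rule compactI)
  fix C assume C: "\<forall>T\<in>C. open T" "closure L \<subseteq> \<Union>C"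
  then have "L \<subseteq> \<Union>C" using closure_subset by blast
  then obtain D where D: "D \<subseteq> C" "finite D" "L \<subseteq> \<Union>D"
    using compactE[OF L, of C] C by metis
  have "open (\<Union>D)" using D C by blast
  then have "closure L \<subseteq> \<Union>D"
    using regular_compact_closure_subset_borel[OF reg L D(3)] by simp
  then show "\<exists>C'\<subseteq>C. finite C' \<and> closure L \<subseteq> \<Union>C'" using D by blast
qed

text \<open>A Borel compact set contains its own closure, by the inclusion above with the set itself
  as \<open>B\<close>. Closedness is wanted because complements of the approximating sets must be
  open.\<close>

lemma radon_measures_closed_compact:
  fixes \<mu> :: "'a::topological_space measure"
  assumes reg: "regular_space (euclidean :: 'a topology)"
    and \<mu>: "\<mu> \<in> radon_measures" and B: "B \<in> sets borel" and "0 < \<epsilon>"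
  obtains K where "compact K" "closed K" "K \<subseteq> B" "measure \<mu> (B - K) < \<epsilon>"
proof -
  obtain K where K: "compact K" "K \<in> sets borel" "K \<subseteq> B" "measure \<mu> (B - K) < \<epsilon>"
    using assms unfolding radon_measures_def by blast
  have "closure K \<subseteq> K"
    using regular_compact_closure_subset_borel[OF reg K(1) subset_refl K(2)] .
  then have "closed K" by (simp add: closure_subset_eq)
  then show thesis using that K by blast
qed

text \<open>\<open>volume\<close> sums over a set of pieces, in which two equal pieces would be
  counted once. Disjointness makes equal pieces empty, whence the separate case.\<close>

lemma volume_Un:
  assumes "volume R m" "A \<in> R" "B \<in> R" "A \<union> B \<in> R" "A \<inter> B = {}"
  shows "m (A \<union> B) = m A + m B"
proof (cases "A = B")
  case True
  then show ?thesis using assms volume_empty[OF assms(1)] by simp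
next
  case False
  have "disjoint {A, B}" "{A, B} \<subseteq> R" "finite {A, B}" "\<Union>{A, B} \<in> R"
    using assms by (auto simp: disjoint_def)
  then have "m (\<Union>{A, B}) = (\<Sum>C\<in>{A, B}. m C)"
    using assms(1) unfolding volume_def by blast
  then show ?thesis using False by simp
qed

text \<open>Countable additivity comes from tightness, since compact subsets turn countable open
  covers into finite ones. The base contained in \<open>R\<close> lets open sets be measured from
  inside by members of \<open>R\<close>; all other sets are then measured from outside by open
  sets.\<close>

proposition tight_volume_extends_to_radon_measure:
  fixes R :: "'z::topological_space set set" and m :: "'z set \<Rightarrow> ennreal"
  assumes ring: "ring_of_sets UNIV R" and UNIV: "UNIV \<in> R" and R_borel: "R \<subseteq> sets borel"
    and vol: "volume R m" and fin: "m UNIV < \<infinity>"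
    and base: "\<And>U z. open U \<Longrightarrow> z \<in> U \<Longrightarrow> \<exists>W\<in>R. open W \<and> z \<in> W \<and> W \<subseteq> U"
    and tight: "\<And>A \<epsilon>. A \<in> R \<Longrightarrow> 0 < \<epsilon> \<Longrightarrow>
      \<exists>K\<in>R. compact K \<and> closed K \<and> K \<subseteq> A \<and> m (A - K) \<le> ennreal \<epsilon>"
  obtains \<gamma> where "\<gamma> \<in> radon_measures" "\<And>A. A \<in> R \<Longrightarrow> emeasure \<gamma> A = m A"
proof -
  interpret ring_of_sets UNIV R by fact
  have m_Un: "m (A \<union> B) = m A + m B" if "A \<in> R" "B \<in> R" "A \<inter> B = {}" for A B
    using volume_Un[OF vol] that by blast
  have m_split: "m A = m B + m (A - B)" if "A \<in> R" "B \<in> R" "B \<subseteq> A" for A B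
    using m_Un[of B "A - B"] that by (simp add: Diff Un_absorb1)
  have m_mono: "m B \<le> m A" if "A \<in> R" "B \<in> R" "B \<subseteq> A" for A B
    using m_split[OF that] by simp
  have m_sub: "m (\<Union>i\<in>I. A i) \<le> (\<Sum>i\<in>I. m (A i))" if "finite I" "\<And>i. i \<in> I \<Longrightarrow> A i \<in> R" for A and I :: "nat set"
    using that
  proof (induction I rule: finite_induct)
    case empty
    then show ?case using volume_empty[OF vol] by simp
  next
    case (insert i I)
    have R: "A i \<in> R" "(\<Union>i\<in>I. A i) \<in> R" using insert by auto
    have "(\<Union>i\<in>insert i I. A i) = A i \<union> ((\<Union>i\<in>I. A i) - A i)" by auto
    moreover have "m (A i \<union> ((\<Union>i\<in>I. A i) - A i)) = m (A i) + m ((\<Union>i\<in>I. A i) - A i)"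
      using R by (intro m_Un) auto
    moreover have "m ((\<Union>i\<in>I. A i) - A i) \<le> m (\<Union>i\<in>I. A i)"
      using R by (intro m_mono) auto
    ultimately show ?case using insert by (auto intro: add_left_mono order_trans)
  qed

  \<comment> \<open>Inner content on open sets\<close>
  define \<tau> where "\<tau> U = (SUP A\<in>{A\<in>R. A \<subseteq> U}. m A)" for U
  have \<tau>_upper: "m A \<le> \<tau> U" if "A \<in> R" "A \<subseteq> U" for A U
    unfolding \<tau>_def using that by (intro SUP_upper) auto
  have \<tau>_le: "\<tau> U \<le> x" if "\<And>A. A \<in> R \<Longrightarrow> A \<subseteq> U \<Longrightarrow> m A \<le> x" for U x
    unfolding \<tau>_def using that by (intro SUP_least) auto
  have \<tau>_mono: "\<tau> U \<le> \<tau> V" if "U \<subseteq> V" for U V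
    using that by (intro \<tau>_le \<tau>_upper) auto
  have \<tau>_R: "\<tau> A = m A" if "A \<in> R" for A
    using that by (intro antisym \<tau>_le \<tau>_upper m_mono) auto
  have \<tau>_fin: "\<tau> U \<le> m UNIV" for U using UNIV by (intro \<tau>_le m_mono) auto

  \<comment> \<open>Finitely many base sets cover a compact \<open>K\<close> inside
    \<open>A\<close>, each contained in a single \<open>U i\<close>; collecting them by index gives
    members \<open>G i\<close> of \<open>R\<close> inside \<open>U i\<close>, to which finite
    subadditivity of \<open>m\<close> applies.\<close>
  have \<tau>_UN: "\<tau> (\<Union>i. U i) \<le> (\<Sum>i. \<tau> (U i))" if U: "\<And>i. open (U i)" for U :: "nat \<Rightarrow> 'z set"
  proof (rule \<tau>_le)
    fix A assume A: "A \<in> R" "A \<subseteq> (\<Union>i. U i)"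
    show "m A \<le> (\<Sum>i. \<tau> (U i))"
    proof (rule ennreal_le_epsilon)
      fix \<epsilon> :: real assume "0 < \<epsilon>"
      then obtain K where K: "K \<in> R" "compact K" "K \<subseteq> A" "m (A - K) \<le> ennreal \<epsilon>"
        using tight[OF A(1)] by blast
      define \<W> where "\<W> = {W\<in>R. open W \<and> (\<exists>i. W \<subseteq> U i)}"
      have "K \<subseteq> \<Union>\<W>"
      proof
        fix z assume "z \<in> K"
        then obtain i where "z \<in> U i" using K A by blast
        then show "z \<in> \<Union>\<W>" using base[OF U] unfolding \<W>_def by blast
      qed
      moreover have "\<And>W. W \<in> \<W> \<Longrightarrow> open W" by (simp add: \<W>_def)
      ultimately obtain D where D: "D \<subseteq> \<W>" "finite D" "K \<subseteq> \<Union>D"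
        using compactE[OF K(2)] by metis
      have "\<forall>W\<in>D. \<exists>i. W \<subseteq> U i" using D by (auto simp: \<W>_def)
      then obtain f where f: "\<And>W. W \<in> D \<Longrightarrow> W \<subseteq> U (f W)" by metis
      define G where "G i = \<Union>{W\<in>D. f W = i}" for i
      have G: "G i \<in> R" "G i \<subseteq> U i" for i
      proof -
        show "G i \<in> R" using D unfolding G_def \<W>_def by (intro finite_Union) auto
        show "G i \<subseteq> U i" using f unfolding G_def by blast
      qed
      have "K \<subseteq> (\<Union>i\<in>f ` D. G i)" using D(3) unfolding G_def by blast
      then have "m K \<le> m (\<Union>i\<in>f ` D. G i)"
        using G D K by (intro m_mono finite_UN) auto
      also have "\<dots> \<le> (\<Sum>i\<in>f ` D. m (G i))" using D G by (intro m_sub) auto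
      also have "\<dots> \<le> (\<Sum>i\<in>f ` D. \<tau> (U i))" using G by (intro sum_mono \<tau>_upper) auto
      also have "\<dots> \<le> (\<Sum>i. \<tau> (U i))" using D by (intro sum_le_suminf) auto
      finally have "m K + m (A - K) \<le> (\<Sum>i. \<tau> (U i)) + ennreal \<epsilon>" using K by (intro add_mono)
      then show "m A \<le> (\<Sum>i. \<tau> (U i)) + ennreal \<epsilon>" using m_split A K by metis
    qed
  qed
  have \<tau>_empty: "\<tau> {} = 0" using \<tau>_R[of "{}"] volume_empty[OF vol] by simp

  \<comment> \<open>The outer measure and measurability of open sets\<close>
  define om where "om E = (INF U\<in>{U. open U \<and> E \<subseteq> U}. \<tau> U)" for E
  have om_le: "om E \<le> \<tau> U" if "open U" "E \<subseteq> U" for E U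
    unfolding om_def using that by (intro INF_lower) auto
  have om_ge: "x \<le> om E" if "\<And>U. open U \<Longrightarrow> E \<subseteq> U \<Longrightarrow> x \<le> \<tau> U" for E x
    unfolding om_def using that by (intro INF_greatest) auto
  have om_mono: "om E \<le> om F" if "E \<subseteq> F" for E F
    using that by (intro om_ge om_le) auto
  have om_open: "om U = \<tau> U" if "open U" for U
    using that by (intro antisym om_le om_ge \<tau>_mono) auto
  have om_fin: "om E < \<infinity>" for E
    using om_le[of UNIV E] \<tau>_fin[of UNIV] fin by (auto intro: le_less_trans)
  have om_approx: "\<exists>U. open U \<and> E \<subseteq> U \<and> \<tau> U < om E + ennreal \<epsilon>" if "0 < \<epsilon>" for E \<epsilon>
    using INF_approx_ennreal[OF that om_def[of E]] om_fin[of E] by (simp add: less_top)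
  have om_UN: "om (\<Union>i. E i) \<le> (\<Sum>i. om (E i))" for E :: "nat \<Rightarrow> 'z set"
  proof (rule ennreal_le_epsilon)
    fix \<epsilon> :: real assume \<epsilon>: "0 < \<epsilon>"
    have "\<forall>i. \<exists>U. open U \<and> E i \<subseteq> U \<and> \<tau> U < om (E i) + ennreal (\<epsilon> * (1/2) ^ Suc i)"
      using \<epsilon> by (intro allI om_approx) simp
    then obtain U where U: "\<And>i. open (U i)" "\<And>i. E i \<subseteq> U i" "\<And>i. \<tau> (U i) < om (E i) + ennreal (\<epsilon> * (1/2) ^ Suc i)"
      by metis
    have "om (\<Union>i. E i) \<le> \<tau> (\<Union>i. U i)" using U by (intro om_le) blast+
    also have "\<dots> \<le> (\<Sum>i. \<tau> (U i))" by (intro \<tau>_UN U)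
    also have "\<dots> \<le> (\<Sum>i. om (E i) + ennreal (\<epsilon> * (1/2) ^ Suc i))"
      using U by (intro suminf_le less_imp_le) auto
    also have "\<dots> = (\<Sum>i. om (E i)) + (\<Sum>i. ennreal \<epsilon> * ennreal ((1/2) ^ Suc i))"
      using \<epsilon> by (subst suminf_add[symmetric])
        (auto simp del: ennreal_suminf_cmult simp add: ennreal_mult[symmetric])
    also have "\<dots> = (\<Sum>i. om (E i)) + ennreal \<epsilon>"
      unfolding ennreal_suminf_cmult
      by (subst suminf_ennreal_eq[OF zero_le_power power_half_series]) auto
    finally show "om (\<Union>i. E i) \<le> (\<Sum>i. om (E i)) + ennreal \<epsilon>" .
  qed
  have oms: "outer_measure_space (Pow UNIV) om"
    unfolding outer_measure_space_def positive_def increasing_def countably_subadditive_def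
    using om_open[of "{}"] \<tau>_empty om_mono om_UN by auto
  interpret Pow: sigma_algebra UNIV "Pow UNIV :: 'z set set" by (rule sigma_algebra_Pow)
  define L where "L = lambda_system UNIV (Pow UNIV) om"
  have L: "measure_space UNIV L om" unfolding L_def by (rule Pow.caratheodory_lemma[OF oms])
  have om_Un2: "om (E \<union> F) \<le> om E + om F" for E F
  proof -
    have "om (E \<union> F) = om (\<Union>i. if i = 0 then E else if i = Suc 0 then F else {})"
      by (rule arg_cong[where f = om]) (auto split: if_splits)
    also have "\<dots> \<le> (\<Sum>i. om (if i = 0 then E else if i = Suc 0 then F else {}))" by (rule om_UN)
    also have "\<dots> = (\<Sum>i<2. om (if i = 0 then E else if i = Suc 0 then F else {}))"
      using om_open[of "{}"] \<tau>_empty by (intro suminf_finite) auto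
    finally show ?thesis by (simp add: numeral_2_eq_2)
  qed
  have open_L: "U \<in> L" if U: "open U" for U
  proof -
    \<comment> \<open>A set \<open>A\<close> from \<open>R\<close> inside
      \<open>V \<inter> U\<close> is shrunk to a closed \<open>K\<close>: then \<open>V - K\<close>
      is open, contains \<open>V - U\<close> and is disjoint from \<open>K\<close>, so additivity of
      \<open>m\<close> gives the bound. General test sets follow by enclosing them in an open
      \<open>V\<close>.\<close>
    have open_case: "\<tau> (V \<inter> U) + om (V - U) \<le> \<tau> V" if V: "open V" for V
    proof -
      have "m A + om (V - U) \<le> \<tau> V" if A: "A \<in> R" "A \<subseteq> V \<inter> U" for A
      proof (rule ennreal_le_epsilon)
        fix \<epsilon> :: real assume "0 < \<epsilon>"
        then obtain K where K: "K \<in> R" "closed K" "K \<subseteq> A" "m (A - K) \<le> ennreal \<epsilon>"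
          using tight[OF A(1)] by blast
        have "om (V - U) \<le> \<tau> (V - K)" using V K A by (intro om_le) auto
        moreover have "m K + \<tau> (V - K) \<le> \<tau> V"
        proof -
          have "m K + m B \<le> \<tau> V" if B: "B \<in> R" "B \<subseteq> V - K" for B
          proof -
            have "m K + m B = m (K \<union> B)" using B K by (intro m_Un[symmetric]) auto
            also have "\<dots> \<le> \<tau> V" using B K A by (intro \<tau>_upper) auto
            finally show ?thesis .
          qed
          then have "(SUP B\<in>{B\<in>R. B \<subseteq> V - K}. m K + m B) \<le> \<tau> V" by (intro SUP_least) auto
          moreover have "(SUP B\<in>{B\<in>R. B \<subseteq> V - K}. m K + m B) = m K + \<tau> (V - K)"
            unfolding \<tau>_def by (intro ennreal_SUP_add_right[symmetric]) auto
          ultimately show ?thesis by simp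
        qed
        ultimately have "m K + om (V - U) \<le> \<tau> V" by (meson add_left_mono order_trans)
        then have "m K + om (V - U) + m (A - K) \<le> \<tau> V + ennreal \<epsilon>" using K(4) by (rule add_mono)
        moreover have "m A = m K + m (A - K)" using m_split A K by blast
        ultimately show "m A + om (V - U) \<le> \<tau> V + ennreal \<epsilon>" by (simp add: ac_simps)
      qed
      then have "(SUP A\<in>{A\<in>R. A \<subseteq> V \<inter> U}. m A + om (V - U)) \<le> \<tau> V" by (intro SUP_least) auto
      moreover have "(SUP A\<in>{A\<in>R. A \<subseteq> V \<inter> U}. m A + om (V - U)) = \<tau> (V \<inter> U) + om (V - U)"
        unfolding \<tau>_def by (intro ennreal_SUP_add_left) auto
      ultimately show ?thesis by simp
    qed
    have "om (E \<inter> U) + om (E - U) = om E" for E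
    proof (rule antisym)
      show "om E \<le> om (E \<inter> U) + om (E - U)" using om_Un2[of "E \<inter> U" "E - U"] by (simp add: Int_Diff_Un)
      show "om (E \<inter> U) + om (E - U) \<le> om E"
      proof (rule om_ge)
        fix V assume V: "open V" "E \<subseteq> V"
        have "om (E \<inter> U) + om (E - U) \<le> \<tau> (V \<inter> U) + om (V - U)"
          using V U by (intro add_mono om_le om_mono) auto
        also have "\<dots> \<le> \<tau> V" by (rule open_case[OF V(1)])
        finally show "om (E \<inter> U) + om (E - U) \<le> \<tau> V" .
      qed
    qed
    then show ?thesis unfolding L_def Pow.lambda_system_eq by auto
  qed
  interpret L: sigma_algebra UNIV L using L by (simp add: measure_space_def)
  have borel_L: "sets borel \<subseteq> L"
    unfolding sets_borel using open_L by (intro L.sigma_sets_subset) auto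
  define \<gamma> where "\<gamma> = measure_of UNIV (sets borel) om"
  have sets_\<gamma>: "sets \<gamma> = sets borel"
    using sets.sigma_sets_eq[of "borel :: 'z measure"] by (simp add: \<gamma>_def)
  have em: "emeasure \<gamma> B = om B" if "B \<in> sets borel" for B
    unfolding \<gamma>_def
  proof (rule emeasure_measure_of_sigma[OF _ _ _ that])
    show "sigma_algebra UNIV (sets (borel :: 'z measure))"
      using sets.sigma_algebra_axioms[of "borel :: 'z measure"] by simp
    show "positive (sets borel) om" using L by (simp add: measure_space_def positive_def)
    show "countably_additive (sets borel) om"
      using L borel_L unfolding measure_space_def countably_additive_def by (meson order_trans subsetD)
  qed
  have space_\<gamma>: "space \<gamma> = UNIV" by (simp add: \<gamma>_def)
  interpret \<gamma>: finite_measure \<gamma>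
    using em[of UNIV] om_fin[of UNIV] by (intro finite_measureI) (simp add: space_\<gamma>)
  \<comment> \<open>The upper bound uses tightness of the complement: a closed \<open>K\<close>
    filling \<open>UNIV - A\<close> up to \<open>\<epsilon>\<close> leaves the open superset
    \<open>UNIV - K\<close> of \<open>A\<close>, which exceeds \<open>A\<close> by at most
    \<open>\<epsilon>\<close> in \<open>m\<close>.\<close>
  have om_R: "om A = m A" if A: "A \<in> R" for A
  proof (rule antisym)
    show "m A \<le> om A" using A by (intro om_ge \<tau>_upper)
    show "om A \<le> m A"
    proof (rule ennreal_le_epsilon)
      fix \<epsilon> :: real assume "0 < \<epsilon>"
      then obtain K where K: "K \<in> R" "closed K" "K \<subseteq> UNIV - A" "m (UNIV - A - K) \<le> ennreal \<epsilon>"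
        using tight[of "UNIV - A" \<epsilon>] A UNIV by blast
      have "UNIV - K \<in> R" using K UNIV by blast
      have "om A \<le> \<tau> (UNIV - K)" using K by (intro om_le) (auto simp: Compl_eq_Diff_UNIV[symmetric])
      also have "\<dots> = m A + m (UNIV - K - A)"
        using \<open>UNIV - K \<in> R\<close> A K by (subst \<tau>_R, simp, intro m_split) auto
      also have "UNIV - K - A = UNIV - A - K" by auto
      finally show "om A \<le> m A + ennreal \<epsilon>" using K(4) by (meson add_left_mono order_trans)
    qed
  qed
  have "\<gamma> \<in> radon_measures"
    unfolding radon_measures_def
  proof (safe)
    fix B :: "'z set" and \<epsilon> :: real assume B: "B \<in> sets borel" and \<epsilon>: "0 < \<epsilon>"
    have nB: "- B \<in> sets borel" using B by simp
    \<comment> \<open>Outer regularity at the complement of \<open>B\<close> provides a closed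
      subset of \<open>B\<close>, namely \<open>- U\<close>; cutting it with a compact
      \<open>K\<close> that carries all but \<open>\<epsilon> / 2\<close> of the mass makes it
      compact.\<close>
    obtain U where U: "open U" "- B \<subseteq> U" "\<tau> U < om (- B) + ennreal (\<epsilon> / 2)"
      using om_approx[of "\<epsilon> / 2"] \<epsilon> by auto
    have "emeasure \<gamma> U < emeasure \<gamma> (- B) + ennreal (\<epsilon> / 2)"
      using U em[OF nB] em[of U] om_open by simp
    then have "ennreal (measure \<gamma> U) < ennreal (measure \<gamma> (- B) + \<epsilon> / 2)"
      using \<epsilon> by (simp add: \<gamma>.emeasure_eq_measure ennreal_plus)
    then have U_lt: "measure \<gamma> U < measure \<gamma> (- B) + \<epsilon> / 2" by (simp add: ennreal_less_iff)
    have "measure \<gamma> (U - (- B)) = measure \<gamma> U - measure \<gamma> (- B)"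
      using U nB by (intro \<gamma>.finite_measure_Diff) (auto simp: sets_\<gamma>)
    then have BU: "measure \<gamma> (U \<inter> B) < \<epsilon> / 2" using U_lt by (simp add: Diff_eq)
    obtain K where K: "K \<in> R" "compact K" "closed K" "m (UNIV - K) \<le> ennreal (\<epsilon> / 2)"
      using tight[OF UNIV, of "\<epsilon> / 2"] \<epsilon> by auto
    have "UNIV - K \<in> R" using K UNIV by blast
    then have "emeasure \<gamma> (UNIV - K) \<le> ennreal (\<epsilon> / 2)"
      using K R_borel em om_R by auto
    then have K_le: "measure \<gamma> (UNIV - K) \<le> \<epsilon> / 2"
      using \<epsilon> by (simp add: \<gamma>.emeasure_eq_measure)
    define F where "F = K \<inter> - U"
    have "compact F" "closed F" using K U by (auto simp: F_def intro: compact_Int_closed)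
    have "B - F \<subseteq> (U \<inter> B) \<union> (UNIV - K)" by (auto simp: F_def)
    then have "measure \<gamma> (B - F) \<le> measure \<gamma> ((U \<inter> B) \<union> (UNIV - K))"
      using B U K by (intro \<gamma>.finite_measure_mono) (auto simp: sets_\<gamma>)
    also have "\<dots> \<le> measure \<gamma> (U \<inter> B) + measure \<gamma> (UNIV - K)"
      using B U K by (intro measure_Un_le) (auto simp: sets_\<gamma>)
    also have "\<dots> < \<epsilon>" using BU K_le by simp
    finally show "\<exists>K. compact K \<and> K \<in> sets borel \<and> K \<subseteq> B \<and> measure \<gamma> (B - K) < \<epsilon>"
      using \<open>compact F\<close> \<open>closed F\<close> U by (intro exI[of _ F]) (auto simp: F_def)
  qed (simp_all add: sets_\<gamma> \<gamma>.finite_measure_axioms)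
  moreover have "emeasure \<gamma> A = m A" if "A \<in> R" for A
    using em om_R R_borel that by auto
  ultimately show thesis using that by blast
qed

section \<open>Gluing Radon measures along a common marginal\<close>

text \<open>Compactness is used in the domain of \<open>\<phi>\<close>: the image of a compact
  subset of the preimage of \<open>U\<close> is compact and covered by finitely many open rectangles
  inside \<open>U\<close>. That image need not be Borel, so only the compact set upstairs is
  measured.\<close>

lemma finite_rectangle_approx:
  fixes \<gamma> :: "'z::topological_space measure" and \<phi> :: "'z \<Rightarrow> 'a::topological_space \<times> 'b::topological_space"
  assumes \<gamma>: "\<gamma> \<in> radon_measures" and \<phi>: "continuous_on UNIV \<phi>" and U: "open U" and "0 < \<epsilon>"
  obtains F where "finite F" "\<And>W. W \<in> F \<Longrightarrow> \<exists>A B. open A \<and> open B \<and> W = A \<times> B" "\<Union>F \<subseteq> U"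
    "measure (distr \<gamma> borel \<phi>) U \<le> measure (distr \<gamma> borel \<phi>) (\<Union>F) + \<epsilon>"
proof -
  have sets_\<gamma> [measurable_cong]: "sets \<gamma> = sets borel" and fin: "finite_measure \<gamma>"
    using \<gamma> by (auto simp: radon_measures_def)
  interpret finite_measure \<gamma> by fact
  have space_\<gamma>: "space \<gamma> = UNIV" using sets_eq_imp_space_eq[OF sets_\<gamma>] by simp
  have \<phi>_meas [measurable]: "\<phi> \<in> measurable borel borel" by (rule borel_measurable_continuous_onI[OF \<phi>])
  have U': "\<phi> -` U \<in> sets borel" using open_vimage[OF U \<phi>] by simp
  then obtain K where K: "compact K" "K \<in> sets borel" "K \<subseteq> \<phi> -` U" "measure \<gamma> (\<phi> -` U - K) < \<epsilon>"
    using \<gamma> \<open>0 < \<epsilon>\<close> unfolding radon_measures_def by blast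
  have "compact (\<phi> ` K)" using K(1) \<phi> by (meson compact_continuous_image continuous_on_subset subset_UNIV)
  define \<W> where "\<W> = {W. W \<subseteq> U \<and> (\<exists>A B. open A \<and> open B \<and> W = A \<times> B)}"
  have opn: "\<And>W. W \<in> \<W> \<Longrightarrow> open W" by (auto simp: \<W>_def intro: open_Times)
  have "\<phi> ` K \<subseteq> \<Union>\<W>"
  proof
    fix z assume "z \<in> \<phi> ` K"
    then have "z \<in> U" using K by auto
    with U obtain A B where "open A" "open B" "z \<in> A \<times> B" "A \<times> B \<subseteq> U" by (rule open_prod_elim)
    then show "z \<in> \<Union>\<W>" unfolding \<W>_def by blast
  qed
  then obtain F where F: "F \<subseteq> \<W>" "finite F" "\<phi> ` K \<subseteq> \<Union>F"
    using compactE[OF \<open>compact (\<phi> ` K)\<close>] opn by metis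
  have FU: "\<Union>F \<subseteq> U" and Fo: "open (\<Union>F)" using F opn unfolding \<W>_def by blast+
  have F': "\<phi> -` \<Union>F \<in> sets borel" using open_vimage[OF Fo \<phi>] by simp
  have "measure \<gamma> (\<phi> -` U) \<le> measure \<gamma> (\<phi> -` \<Union>F \<union> (\<phi> -` U - K))"
    using F U' F' K by (intro finite_measure_mono) (auto simp: sets_\<gamma>)
  also have "\<dots> \<le> measure \<gamma> (\<phi> -` \<Union>F) + measure \<gamma> (\<phi> -` U - K)"
    using U' F' K by (intro measure_Un_le) (auto simp: sets_\<gamma>)
  finally have "measure (distr \<gamma> borel \<phi>) U \<le> measure (distr \<gamma> borel \<phi>) (\<Union>F) + \<epsilon>"
    using K(4) U Fo by (simp add: measure_distr space_\<gamma>)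
  then show thesis using F FU by (intro that[of F]) (auto simp: \<W>_def)
qed

text \<open>Rectangles need not generate the Borel sets of the product topology; compactness reaches the open
  sets from finite unions of rectangles.\<close>

lemma distr_radon_eqI_rectangles:
  fixes \<phi> :: "'z::topological_space \<Rightarrow> 'a::topological_space \<times> 'b::topological_space"
    and \<psi> :: "'y::topological_space \<Rightarrow> 'a \<times> 'b"
  assumes \<mu>: "\<mu> \<in> radon_measures" and \<phi>: "continuous_on UNIV \<phi>"
    and \<nu>: "\<nu> \<in> radon_measures" and \<psi>: "continuous_on UNIV \<psi>"
    and eq: "\<And>A B. A \<in> sets borel \<Longrightarrow> B \<in> sets borel \<Longrightarrow>
      emeasure (distr \<mu> borel \<phi>) (A \<times> B) = emeasure (distr \<nu> borel \<psi>) (A \<times> B)"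
  shows "distr \<mu> borel \<phi> = distr \<nu> borel \<psi>"
proof -
  have sets [measurable_cong]: "sets \<mu> = sets borel" "sets \<nu> = sets borel"
    and fin: "finite_measure \<mu>" "finite_measure \<nu>"
    using \<mu> \<nu> by (auto simp: radon_measures_def)
  have [measurable]: "\<phi> \<in> measurable borel borel" "\<psi> \<in> measurable borel borel"
    using \<phi> \<psi> by (auto intro: borel_measurable_continuous_onI)
  define M where "M = distr \<mu> borel \<phi>"
  define N where "N = distr \<nu> borel \<psi>"
  interpret M: finite_measure M unfolding M_def by (intro finite_measure.finite_measure_distr fin) measurable
  interpret N: finite_measure N unfolding N_def by (intro finite_measure.finite_measure_distr fin) measurable
  have [measurable_cong]: "sets M = sets borel" "sets N = sets borel" by (auto simp: M_def N_def)
  have rect_borel: "A \<times> B \<in> sets borel" if "A \<in> sets borel" "B \<in> sets borel" for A :: "'a set" and B :: "'b set"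
  proof -
    have "fst -` A \<in> sets (borel :: ('a \<times> 'b) measure)" "snd -` B \<in> sets (borel :: ('a \<times> 'b) measure)"
      using that by (auto intro!: measurable_sets_borel[of _ borel] borel_measurable_continuous_onI continuous_intros)
    moreover have "A \<times> B = fst -` A \<inter> snd -` B" by auto
    ultimately show ?thesis by simp
  qed
  \<comment> \<open>This is the direction available in general: the Borel sets of the product
    topology include the product sigma-algebra. On the latter, rectangles form a generator stable
    under intersection.\<close>
  have id: "(\<lambda>z. z) \<in> measurable borel (borel \<Otimes>\<^sub>M (borel :: 'b measure) :: ('a \<times> 'b) measure)"
  proof -
    have "(\<lambda>z. (fst z, snd z)) \<in> measurable borel (borel \<Otimes>\<^sub>M (borel :: 'b measure) :: ('a \<times> 'b) measure)"
      by (intro measurable_Pair borel_measurable_continuous_onI continuous_intros)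
    then show ?thesis by simp
  qed
  have prod_eq: "distr M (borel \<Otimes>\<^sub>M borel) (\<lambda>z. z) = distr N (borel \<Otimes>\<^sub>M borel) (\<lambda>z. z)"
  proof (rule measure_eqI_generator_eq[where \<Omega> = UNIV and E = "{A \<times> B |A B. A \<in> sets borel \<and> B \<in> sets borel}" and A = "\<lambda>_. UNIV"])
    show "Int_stable {A \<times> B |A B. A \<in> sets (borel :: 'a measure) \<and> B \<in> sets (borel :: 'b measure)}"
      by (rule Int_stable_pair_measure_generator)
    show "emeasure (distr M (borel \<Otimes>\<^sub>M borel) (\<lambda>z. z)) X = emeasure (distr N (borel \<Otimes>\<^sub>M borel) (\<lambda>z. z)) X"
      if "X \<in> {A \<times> B |A B. A \<in> sets borel \<and> B \<in> sets borel}" for X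
      using that eq id by (auto simp: emeasure_distr M_def N_def rect_borel pair_measureI)
    show "emeasure (distr M (borel \<Otimes>\<^sub>M borel) (\<lambda>z. z)) UNIV \<noteq> \<infinity>"
    proof -
      have "(\<lambda>z. z) \<in> measurable M (borel \<Otimes>\<^sub>M borel)"
        using id by (simp add: M_def cong: measurable_cong_sets)
      then show ?thesis
        unfolding infinity_ennreal_def by (intro finite_measure.emeasure_finite M.finite_measure_distr)
    qed
  qed (auto simp: sets_pair_measure space_pair_measure intro!: exI[of _ UNIV])
  have eq_rect: "measure M (\<Union>F) = measure N (\<Union>F)"
    if F: "finite F" "\<And>W. W \<in> F \<Longrightarrow> \<exists>A B. open A \<and> open B \<and> W = A \<times> B" for F
  proof -
    have "\<Union>F \<in> sets (borel \<Otimes>\<^sub>M borel)"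
      using F by (intro sets.finite_Union) (auto dest!: F(2))
    moreover from this have "\<Union>F \<in> sets borel" using measurable_sets[OF id] by auto
    ultimately show ?thesis
      using arg_cong[OF prod_eq, of "\<lambda>m. measure m (\<Union>F)"] id by (simp add: measure_distr)
  qed
  have le: "measure M U = measure N U" if U: "open U" for U
  proof (rule antisym)
    show "measure M U \<le> measure N U"
    proof (rule field_le_epsilon)
      fix e :: real assume "0 < e"
      then obtain F where F: "finite F" "\<And>W. W \<in> F \<Longrightarrow> \<exists>A B. open A \<and> open B \<and> W = A \<times> B" "\<Union>F \<subseteq> U"
        "measure M U \<le> measure M (\<Union>F) + e"
        unfolding M_def by (rule finite_rectangle_approx[OF \<mu> \<phi> U]) blast
      have "measure N (\<Union>F) \<le> measure N U" using F U by (intro N.finite_measure_mono) auto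
      then show "measure M U \<le> measure N U + e" using F eq_rect[OF F(1,2)] by simp
    qed
    show "measure N U \<le> measure M U"
    proof (rule field_le_epsilon)
      fix e :: real assume "0 < e"
      then obtain F where F: "finite F" "\<And>W. W \<in> F \<Longrightarrow> \<exists>A B. open A \<and> open B \<and> W = A \<times> B" "\<Union>F \<subseteq> U"
        "measure N U \<le> measure N (\<Union>F) + e"
        unfolding N_def by (rule finite_rectangle_approx[OF \<nu> \<psi> U]) blast
      have "measure M (\<Union>F) \<le> measure M U" using F U by (intro M.finite_measure_mono) auto
      then show "measure N U \<le> measure M U + e" using F eq_rect[OF F(1,2)] by simp
    qed
  qed
  have "M = N"
  proof (rule measure_eqI_generator_eq[where \<Omega> = UNIV and E = "{S. open S}" and A = "\<lambda>_. UNIV"])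
    show "Int_stable {S. open (S :: ('a \<times> 'b) set)}" by (auto simp: Int_stable_def)
    show "emeasure M X = emeasure N X" if "X \<in> {S. open S}" for X
      using le that by (simp add: M.emeasure_eq_measure N.emeasure_eq_measure)
  qed (auto simp: M_def N_def sets_borel M.emeasure_finite[unfolded M_def])
  then show ?thesis by (simp add: M_def N_def)
qed

text \<open>Up to the order of coordinates this is the product of \<open>D\<close> and
  \<open>B\<close>. Letting \<open>D\<close> be any Borel set of \<open>X \<times> S\<close>, not
  only a rectangle, makes the slabs \<open>slab D UNIV\<close> determine the whole first
  projection.\<close>

definition slab :: "('x \<times> 's) set \<Rightarrow> 'x set \<Rightarrow> ('x \<times> 'x \<times> 's) set" where
  "slab D B = {(x, y, s). (x, s) \<in> D \<and> y \<in> B}"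

lemma mem_slab [simp]: "(x, y, s) \<in> slab D B \<longleftrightarrow> (x, s) \<in> D \<and> y \<in> B"
  by (simp add: slab_def)

text \<open>A non-empty slab determines its two sides, which allows a set function on slabs to be
  defined from the set alone.\<close>

lemma slab_sides:
  assumes "slab D B \<noteq> {}"
  shows "(\<lambda>(x, y, s). (x, s)) ` slab D B = D" "(\<lambda>(x, y, s). y) ` slab D B = B"
proof -
  obtain x y s where "(x, s) \<in> D" "y \<in> B" using assms by (auto simp: slab_def)
  then show "(\<lambda>(x, y, s). (x, s)) ` slab D B = D" "(\<lambda>(x, y, s). y) ` slab D B = B"
    by (force simp: slab_def image_iff)+
qed

lemma slab_borel:
  fixes D :: "('x::topological_space \<times> 's::topological_space) set"
  assumes "D \<in> sets borel" "B \<in> sets borel"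
  shows "slab D B \<in> sets borel"
proof -
  have "(\<lambda>z. (fst z, snd (snd z))) -` D \<in> sets (borel :: ('x \<times> 'x \<times> 's) measure)"
    by (rule measurable_sets_borel[OF _ assms(1)], intro borel_measurable_continuous_onI continuous_intros)
  moreover have "(\<lambda>z. fst (snd z)) -` B \<in> sets (borel :: ('x \<times> 'x \<times> 's) measure)"
    by (rule measurable_sets_borel[OF _ assms(2)], intro borel_measurable_continuous_onI continuous_intros)
  moreover have "slab D B = (\<lambda>z. (fst z, snd (snd z))) -` D \<inter> (\<lambda>z. fst (snd z)) -` B"
    by (auto simp: slab_def)
  ultimately show ?thesis by simp
qed

lemma slab_closed:
  fixes D :: "('x::topological_space \<times> 's::topological_space) set"
  assumes "closed D" "closed B"
  shows "closed (slab D B)"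
proof -
  have "slab D B = (\<lambda>z. (fst z, snd (snd z))) -` D \<inter> (\<lambda>z. fst (snd z)) -` B"
    by (auto simp: slab_def)
  then show ?thesis
    using assms by (auto intro!: closed_Int closed_vimage continuous_intros)
qed

lemma slab_compact:
  fixes D :: "('x::topological_space \<times> 's::topological_space) set"
  assumes "compact D" "compact B"
  shows "compact (slab D B)"
proof -
  have "slab D B = (\<lambda>z. (fst (fst z), snd z, snd (fst z))) ` (D \<times> B)"
    by (force simp: slab_def)
  then show ?thesis
    using assms by (auto intro!: compact_continuous_image compact_Times continuous_intros)
qed

text \<open>The projection of a compact subset of \<open>B \<times> UNIV\<close> is compact and
  inside \<open>B\<close>, and by regularity its closure stays compact and inside the Borel set
  \<open>B\<close>.\<close>

lemma radon_closed_compact_side: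
  fixes \<beta> :: "('x::topological_space \<times> 's::topological_space) measure"
  assumes reg: "regular_space (euclidean :: 'x topology)"
    and \<beta>: "\<beta> \<in> radon_measures" and B: "B \<in> sets borel" and "0 < \<epsilon>"
  obtains K where "compact K" "closed K" "K \<subseteq> B" "measure \<beta> ((B - K) \<times> UNIV) < \<epsilon>"
proof -
  have sets_\<beta>: "sets \<beta> = sets borel" and "finite_measure \<beta>"
    using \<beta> by (auto simp: radon_measures_def)
  interpret finite_measure \<beta> by fact
  have cyl: "A \<times> UNIV \<in> sets (borel :: ('x \<times> 's) measure)" if "A \<in> sets borel" for A
  proof -
    have "fst -` A \<in> sets (borel :: ('x \<times> 's) measure)"
      by (rule measurable_sets_borel[OF _ that], intro borel_measurable_continuous_onI continuous_intros)
    moreover have "fst -` A = A \<times> (UNIV :: 's set)" by auto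
    ultimately show ?thesis by simp
  qed
  obtain L where L: "compact L" "L \<in> sets borel" "L \<subseteq> B \<times> UNIV" "measure \<beta> (B \<times> UNIV - L) < \<epsilon>"
    using \<beta> cyl[OF B] \<open>0 < \<epsilon>\<close> unfolding radon_measures_def by blast
  have c: "compact (fst ` L)" using L(1) by (intro compact_continuous_image continuous_intros)
  have sub: "fst ` L \<subseteq> B" using L(3) by auto
  define K where "K = closure (fst ` L)"
  have K: "compact K" "closed K" "K \<subseteq> B"
    unfolding K_def using regular_compact_closure[OF reg c] regular_compact_closure_subset_borel[OF reg c sub B]
    by auto
  have "fst ` L \<subseteq> K" unfolding K_def by (rule closure_subset)
  then have "(B - K) \<times> UNIV \<subseteq> B \<times> UNIV - L" by force
  then have "measure \<beta> ((B - K) \<times> UNIV) \<le> measure \<beta> (B \<times> UNIV - L)"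
    using L cyl[OF B] by (intro finite_measure_mono) (auto simp: sets_\<beta>)
  then show thesis using L(4) K by (intro that[of K]) auto
qed

text \<open>Each \<open>b B\<close> is determined only up to a null set, and additivity in
  \<open>B\<close> holds off a null set that depends on the family. For finite families this does no
  harm under integration against \<open>\<alpha>\<close>, and closed compact sets for
  \<open>\<alpha>\<close> and \<open>\<beta>\<close> make the resulting volume tight.\<close>

proposition radon_measures_glue:
  fixes \<alpha> \<beta> :: "('x::topological_space \<times> 's::topological_space) measure"
  assumes regX: "regular_space (euclidean :: 'x topology)" and regS: "regular_space (euclidean :: 's topology)"
    and \<alpha>: "\<alpha> \<in> radon_measures" and \<beta>: "\<beta> \<in> radon_measures"
    and marginal: "distr \<alpha> borel snd = distr \<beta> borel snd"
  obtains \<gamma> where "\<gamma> \<in> radon_measures" "proj_XS \<gamma> = \<alpha>" "proj_YS \<gamma> = \<beta>"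
proof -
  have sets_\<alpha> [measurable_cong]: "sets \<alpha> = sets borel" and fin_\<alpha>: "finite_measure \<alpha>"
    and sets_\<beta> [measurable_cong]: "sets \<beta> = sets borel" and fin_\<beta>: "finite_measure \<beta>"
    using \<alpha> \<beta> by (auto simp: radon_measures_def)
  interpret \<alpha>: finite_measure \<alpha> by fact
  interpret \<beta>: finite_measure \<beta> by fact
  have space_\<alpha>: "space \<alpha> = UNIV" and space_\<beta>: "space \<beta> = UNIV"
    using sets_eq_imp_space_eq[OF sets_\<alpha>] sets_eq_imp_space_eq[OF sets_\<beta>] by auto
  have snd_meas [measurable]: "snd \<in> measurable (borel :: ('x \<times> 's) measure) borel"
    and fst_meas [measurable]: "fst \<in> measurable (borel :: ('x \<times> 's) measure) borel"
    by (intro borel_measurable_continuous_onI continuous_intros)+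
  have rect: "B \<times> C \<in> sets (borel :: ('x \<times> 's) measure)" if [measurable]: "B \<in> sets borel" "C \<in> sets borel" for B C
  proof -
    have "fst -` B \<in> sets (borel :: ('x \<times> 's) measure)" "snd -` C \<in> sets (borel :: ('x \<times> 's) measure)"
      using measurable_sets_borel[OF fst_meas that(1)] measurable_sets_borel[OF snd_meas that(2)] by auto
    moreover have "B \<times> C = fst -` B \<inter> snd -` C" by auto
    ultimately show ?thesis by simp
  qed
  define \<sigma> where "\<sigma> = distr \<beta> borel snd"
  interpret \<sigma>: finite_measure \<sigma> unfolding \<sigma>_def by (intro \<beta>.finite_measure_distr) measurable
  have sets_\<sigma> [measurable_cong]: "sets \<sigma> = sets borel" by (simp add: \<sigma>_def)
  have \<sigma>_alt: "\<sigma> = distr \<alpha> borel snd" using marginal by (simp add: \<sigma>_def)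
  have em_\<sigma>: "emeasure \<sigma> C = emeasure \<beta> (UNIV \<times> C)" if [measurable]: "C \<in> sets borel" for C
  proof -
    have "snd -` C = (UNIV :: 'x set) \<times> C" by auto
    then show ?thesis by (simp add: \<sigma>_def emeasure_distr space_\<beta>)
  qed
  define slice where "slice B = distr (density \<beta> (indicator (B \<times> UNIV))) borel snd" for B :: "'x set"
  have sets_slice: "sets (slice B) = sets borel" for B by (simp add: slice_def)
  have em_slice: "emeasure (slice B) C = emeasure \<beta> (B \<times> C)" if [measurable]: "B \<in> sets borel" "C \<in> sets borel" for B C
  proof -
    have BU: "B \<times> (UNIV :: 's set) \<in> sets \<beta>" using rect[of B UNIV] by (simp add: sets_\<beta>)
    have C: "snd -` C \<in> sets \<beta>" using measurable_sets_borel[OF snd_meas] by (simp add: sets_\<beta>)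
    have "emeasure (slice B) C = emeasure (density \<beta> (indicator (B \<times> UNIV))) (snd -` C)"
      unfolding slice_def using BU by (subst emeasure_distr) (auto simp: space_\<beta>)
    also have "\<dots> = (\<integral>\<^sup>+z. indicator (B \<times> C) z \<partial>\<beta>)"
      using BU C by (subst emeasure_density) (auto intro!: nn_integral_cong simp: indicator_def)
    also have "\<dots> = emeasure \<beta> (B \<times> C)" using rect by (simp add: sets_\<beta>)
    finally show ?thesis .
  qed
  \<comment> \<open>\<open>b B s\<close> is the conditional probability of \<open>y \<in> B\<close> given \<open>s\<close> under \<open>\<beta>\<close>; the coordinates \<open>x\<close> and \<open>y\<close>
    are glued to be conditionally independent given \<open>s\<close>.\<close>
  define b where "b B = RN_deriv \<sigma> (slice B)" for B
  have [measurable]: "b B \<in> borel_measurable borel" for B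
    unfolding b_def using borel_measurable_RN_deriv[of \<sigma> "slice B"] by (simp cong: measurable_cong_sets)
  have dens: "density \<sigma> (b B) = slice B" if B [measurable]: "B \<in> sets borel" for B
    unfolding b_def
  proof (rule \<sigma>.density_RN_deriv)
    show "absolutely_continuous \<sigma> (slice B)"
      unfolding absolutely_continuous_def
    proof
      fix C assume "C \<in> null_sets \<sigma>"
      then have C [measurable]: "C \<in> sets borel" and "emeasure \<sigma> C = 0" by (auto simp: sets_\<sigma>)
      then have "emeasure \<beta> (UNIV \<times> C) = 0" by (simp add: em_\<sigma>)
      moreover have "emeasure \<beta> (B \<times> C) \<le> emeasure \<beta> (UNIV \<times> C)"
        using rect[of UNIV C] by (intro emeasure_mono) (auto simp: sets_\<beta>)
      ultimately show "C \<in> null_sets (slice B)"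
        using C by (auto simp: null_sets_def em_slice sets_slice)
    qed
    show "sets (slice B) = sets \<sigma>" by (simp add: sets_slice sets_\<sigma>)
  qed
  have int_b: "(\<integral>\<^sup>+s. b B s * indicator C s \<partial>\<sigma>) = emeasure \<beta> (B \<times> C)"
    if [measurable]: "B \<in> sets borel" "C \<in> sets borel" for B C
  proof -
    have "(\<integral>\<^sup>+s. b B s * indicator C s \<partial>\<sigma>) = emeasure (density \<sigma> (b B)) C"
      by (rule emeasure_density[symmetric]) measurable
    then show ?thesis by (simp add: dens em_slice)
  qed
  \<comment> \<open>Both sides are densities with respect to \<open>\<sigma>\<close> of the part of
    \<open>\<beta>\<close> over the union, projected to \<open>S\<close>; densities are unique
    almost everywhere.\<close>
  have b_sum: "AE s in \<sigma>. b (\<Union>i\<in>I. B i) s = (\<Sum>i\<in>I. b (B i) s)"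
    if I: "finite I" and B [measurable]: "\<And>i. i \<in> I \<Longrightarrow> B i \<in> sets borel" and disj: "disjoint_family_on B I"
    for I and B :: "'i \<Rightarrow> 'x set"
  proof (rule \<sigma>.density_unique)
    have U [measurable]: "(\<Union>i\<in>I. B i) \<in> sets borel" using I by auto
    show "density \<sigma> (b (\<Union>i\<in>I. B i)) = density \<sigma> (\<lambda>s. \<Sum>i\<in>I. b (B i) s)"
    proof (rule measure_eqI)
      fix C assume "C \<in> sets (density \<sigma> (b (\<Union>i\<in>I. B i)))"
      then have C [measurable]: "C \<in> sets borel" by (simp add: sets_\<sigma>)
      have "emeasure (density \<sigma> (\<lambda>s. \<Sum>i\<in>I. b (B i) s)) C = (\<integral>\<^sup>+s. (\<Sum>i\<in>I. b (B i) s * indicator C s) \<partial>\<sigma>)"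
        by (subst emeasure_density) (auto simp: sum_distrib_right sets_\<sigma>)
      also have "\<dots> = (\<Sum>i\<in>I. \<integral>\<^sup>+s. b (B i) s * indicator C s \<partial>\<sigma>)"
        by (rule nn_integral_sum) measurable
      also have "\<dots> = (\<Sum>i\<in>I. emeasure \<beta> (B i \<times> C))" by (intro sum.cong int_b refl) auto
      also have "\<dots> = emeasure \<beta> (\<Union>i\<in>I. B i \<times> C)"
        using I disj rect by (intro sum_emeasure) (auto simp: sets_\<beta> disjoint_family_on_def)
      also have "(\<Union>i\<in>I. B i \<times> C) = (\<Union>i\<in>I. B i) \<times> C" by auto
      also have "emeasure \<beta> \<dots> = emeasure (density \<sigma> (b (\<Union>i\<in>I. B i))) C"
        by (simp add: dens em_slice)
      finally show "emeasure (density \<sigma> (b (\<Union>i\<in>I. B i))) C = emeasure (density \<sigma> (\<lambda>s. \<Sum>i\<in>I. b (B i) s)) C" ..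
    qed simp
  qed (auto cong: measurable_cong_sets)
  \<comment> \<open>The common marginal enters here: a null set for the \<open>S\<close>-marginal of
    \<open>\<beta>\<close> is one for that of \<open>\<alpha>\<close>.\<close>
  have AE_snd: "AE z in \<alpha>. P (snd z)" if "AE s in \<sigma>. P s" for P
  proof (rule AE_distrD[where M' = borel and f = snd and P = P])
    show "snd \<in> measurable \<alpha> borel" by measurable
    show "AE s in distr \<alpha> borel snd. P s" using that by (simp only: \<sigma>_alt)
  qed

  \<comment> \<open>The glued set function on slabs and its finite additivity\<close>
  define \<mu> where "\<mu> D B = (\<integral>\<^sup>+z. indicator D z * b B (snd z) \<partial>\<alpha>)" for D B
  have \<mu>_cyl: "\<mu> (UNIV \<times> C) B = emeasure \<beta> (B \<times> C)" if [measurable]: "B \<in> sets borel" "C \<in> sets borel" for B C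
  proof -
    have "\<mu> (UNIV \<times> C) B = (\<integral>\<^sup>+z. (b B (snd z) * indicator C (snd z)) \<partial>\<alpha>)"
      unfolding \<mu>_def by (intro nn_integral_cong) (auto simp: indicator_def)
    also have "\<dots> = (\<integral>\<^sup>+s. b B s * indicator C s \<partial>\<sigma>)"
      unfolding \<sigma>_alt by (subst nn_integral_distr) auto
    finally show ?thesis by (simp add: int_b)
  qed
  have \<mu>_UNIV: "\<mu> D UNIV = emeasure \<alpha> D" if [measurable]: "D \<in> sets borel" for D
  proof -
    have "AE s in \<sigma>. b UNIV s = 1"
    proof (rule \<sigma>.density_unique)
      show "density \<sigma> (b UNIV) = density \<sigma> (\<lambda>_. 1)"
        by (rule measure_eqI) (auto simp: dens em_slice em_\<sigma> sets_\<sigma> sets_slice density_1)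
    qed (auto cong: measurable_cong_sets)
    from AE_snd[OF this] have "\<mu> D UNIV = (\<integral>\<^sup>+z. indicator D z \<partial>\<alpha>)"
      unfolding \<mu>_def by (intro nn_integral_cong_AE) auto
    then show ?thesis by (simp add: sets_\<alpha>)
  qed
  have \<mu>_empty: "\<mu> {} B = 0" for B by (simp add: \<mu>_def)
  have \<mu>_mono: "\<mu> D B \<le> \<mu> D' B" if "D \<subseteq> D'" for D D' B
    unfolding \<mu>_def using that by (intro nn_integral_mono mult_right_mono) (auto simp: indicator_def)

  define \<B> where "\<B> = {slab D B |D B :: 'x set. D \<in> sets (borel :: ('x \<times> 's) measure) \<and> B \<in> sets borel}"
  have \<B>I: "slab D B \<in> \<B>" if "D \<in> sets borel" "B \<in> sets borel" for D :: "('x \<times> 's) set" and B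
    using that by (auto simp: \<B>_def)
  have semiring: "semiring_of_sets UNIV \<B>"
  proof
    have "slab {} {} = ({} :: ('x \<times> 'x \<times> 's) set)" by (auto simp: slab_def)
    then show "{} \<in> \<B>" using \<B>I[of "{}" "{}"] by simp
    fix U V assume "U \<in> \<B>" "V \<in> \<B>"
    then obtain D B D' B' where UV: "U = slab D B" "V = slab D' B'"
      and meas: "D \<in> sets borel" "B \<in> sets borel" "D' \<in> sets borel" "B' \<in> sets borel"
      by (auto simp: \<B>_def)
    have "U \<inter> V = slab (D \<inter> D') (B \<inter> B')" by (auto simp: UV slab_def)
    then show "U \<inter> V \<in> \<B>" using meas by (simp add: \<B>I)
    have "U - V = \<Union>{slab (D - D') B, slab (D \<inter> D') (B - B')}" by (auto simp: UV slab_def)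
    moreover have "disjoint {slab (D - D') B, slab (D \<inter> D') (B - B')}"
      by (auto simp: disjoint_def slab_def)
    ultimately show "\<exists>C\<subseteq>\<B>. finite C \<and> disjoint C \<and> U - V = \<Union>C"
      using meas by (intro exI[of _ "{slab (D - D') B, slab (D \<inter> D') (B - B')}"]) (auto intro!: \<B>I)
  qed auto
  interpret semiring_of_sets UNIV \<B> by (rule semiring)

  \<comment> \<open>Reading the sides off the set makes \<open>m\<close> well defined. An empty slab
    may also be written with one non-empty side, and consistency in the case \<open>B = {}\<close>
    rests on \<open>b {} = 0\<close> almost everywhere.\<close>
  define m where "m U = \<mu> ((\<lambda>(x, y, s). (x, s)) ` U) ((\<lambda>(x, y, s). y) ` U)" for U
  have b_empty: "AE s in \<sigma>. b {} s = 0" using b_sum[of "{}" "\<lambda>_. {}"] by (simp add: disjoint_family_on_def)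
  have m_slab: "m (slab D B) = \<mu> D B" if "D \<in> sets borel" "B \<in> sets borel" for D B
  proof (cases "slab D B = {}")
    case True
    have "\<mu> D B = 0"
    proof (cases "D = {}")
      case False
      with True have "B = {}" by (auto simp: slab_def)
      then have "\<mu> D B = (\<integral>\<^sup>+z. 0 \<partial>\<alpha>)"
        unfolding \<mu>_def using AE_snd[OF b_empty] by (intro nn_integral_cong_AE) auto
      then show ?thesis by simp
    qed (simp add: \<mu>_empty)
    then show ?thesis using True by (simp add: m_def \<mu>_empty)
  qed (simp add: m_def slab_sides)
  have vol_m: "volume \<B> m"
  proof (rule volumeI)
    show "m {} = 0" by (simp add: m_def \<mu>_empty)
    fix \<C> assume \<C>: "\<C> \<subseteq> \<B>" "disjoint \<C>" "finite \<C>" "\<Union>\<C> \<in> \<B>"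
    define dd where "dd = (\<lambda>U :: ('x \<times> 'x \<times> 's) set. (\<lambda>(x, y, s). (x, s)) ` U)"
    define bb where "bb = (\<lambda>U :: ('x \<times> 'x \<times> 's) set. (\<lambda>(x, y, s). y) ` U)"
    have sides: "U = slab (dd U) (bb U) \<and> dd U \<in> sets borel \<and> bb U \<in> sets borel" if "U \<in> \<B>" for U
    proof (cases "U = {}")
      case True
      then show ?thesis by (auto simp: dd_def bb_def slab_def)
    next
      case False
      obtain D B where U: "U = slab D B" "D \<in> sets borel" "B \<in> sets borel" using \<open>U \<in> \<B>\<close> by (auto simp: \<B>_def)
      then have "dd U = D" "bb U = B" using slab_sides[OF False[unfolded U(1)]] by (simp_all only: dd_def bb_def)
      then show ?thesis using U by simp
    qed
    then have sd: "U = slab (dd U) (bb U)" and meas [measurable]: "dd U \<in> sets borel" "bb U \<in> sets borel" if "U \<in> \<B>" for U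
      using that by blast+
    define E where "E = \<Union>\<C>"
    have E: "E \<in> \<B>" using \<C> by (simp add: E_def)
    have mem: "(x, y, s) \<in> U \<longleftrightarrow> (x, s) \<in> dd U \<and> y \<in> bb U" if "U \<in> \<B>" for U x y s
      by (subst sd[OF that]) simp
    \<comment> \<open>Additivity is wanted for the pieces \<open>U\<close> with \<open>z\<close> in
      \<open>dd U\<close>, a subfamily that varies with \<open>z\<close>; there are finitely many
      subfamilies, so one null set serves them all.\<close>
    have "AE s in \<sigma>. \<forall>I\<in>Pow \<C>. disjoint_family_on bb I \<longrightarrow> b (\<Union>U\<in>I. bb U) s = (\<Sum>U\<in>I. b (bb U) s)"
    proof (rule AE_finite_allI)
      fix I assume I: "I \<in> Pow \<C>"
      show "AE s in \<sigma>. disjoint_family_on bb I \<longrightarrow> b (\<Union>U\<in>I. bb U) s = (\<Sum>U\<in>I. b (bb U) s)"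
      proof (cases "disjoint_family_on bb I")
        case True
        have "AE s in \<sigma>. b (\<Union>U\<in>I. bb U) s = (\<Sum>U\<in>I. b (bb U) s)"
        proof (rule b_sum[OF _ _ True])
          show "finite I" using I \<C> finite_subset by blast
          show "bb U \<in> sets borel" if "U \<in> I" for U using that I \<C> meas by blast
        qed
        then show ?thesis by eventually_elim simp
      qed simp
    qed (use \<C> in simp)
    from AE_snd[OF this]
    have "AE z in \<alpha>. indicator (dd E) z * b (bb E) (snd z) = (\<Sum>U\<in>\<C>. indicator (dd U) z * b (bb U) (snd z))"
    proof eventually_elim
      fix z :: "'x \<times> 's" assume *: "\<forall>I\<in>Pow \<C>. disjoint_family_on bb I \<longrightarrow> b (\<Union>U\<in>I. bb U) (snd z) = (\<Sum>U\<in>I. b (bb U) (snd z))"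
      obtain x s where z: "z = (x, s)" by force
      define I where "I = {U\<in>\<C>. z \<in> dd U}"
      have "(\<Sum>U\<in>\<C>. indicator (dd U) z * b (bb U) (snd z)) = (\<Sum>U\<in>I. b (bb U) (snd z))"
        unfolding I_def using \<C> by (intro sum.mono_neutral_cong_right) (auto simp: indicator_def)
      moreover have "disjoint_family_on bb I"
        unfolding disjoint_family_on_def
      proof (intro ballI impI)
        fix U V assume UV: "U \<in> I" "V \<in> I" "U \<noteq> V"
        then have "U \<inter> V = {}" using \<C>(2) by (auto simp: I_def disjoint_def)
        moreover have "(x, y, s) \<in> U \<inter> V" if "y \<in> bb U \<inter> bb V" for y
          using that UV \<C>(1) mem by (auto simp: I_def z)
        ultimately show "bb U \<inter> bb V = {}" by blast
      qed
      then have "(\<Sum>U\<in>I. b (bb U) (snd z)) = b (\<Union>U\<in>I. bb U) (snd z)"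
        using * by (auto simp: I_def)
      \<comment> \<open>Over a point \<open>z\<close> of \<open>dd E\<close> the
        \<open>y\<close>-sides of the pieces in \<open>I\<close> fill \<open>bb E\<close>; over any
        other point there are no pieces at all.\<close>
      moreover have "(\<Union>U\<in>I. bb U) = bb E \<and> z \<in> dd E \<or> I = {} \<and> z \<notin> dd E"
      proof (cases "z \<in> dd E")
        case True
        have "y \<in> bb E \<longleftrightarrow> (\<exists>U\<in>I. y \<in> bb U)" for y
        proof -
          have "y \<in> bb E \<longleftrightarrow> (x, y, s) \<in> E" using True mem[OF E] by (simp add: z)
          also have "\<dots> \<longleftrightarrow> (\<exists>U\<in>\<C>. (x, y, s) \<in> U)" by (auto simp: E_def)
          also have "\<dots> \<longleftrightarrow> (\<exists>U\<in>\<C>. (x, s) \<in> dd U \<and> y \<in> bb U)"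
            using mem \<C>(1) by (intro bex_cong refl) auto
          also have "\<dots> \<longleftrightarrow> (\<exists>U\<in>I. y \<in> bb U)" by (auto simp: I_def z)
          finally show ?thesis .
        qed
        then show ?thesis using True by blast
      next
        case False
        have "U \<notin> I" for U
        proof
          assume "U \<in> I"
          then obtain y where "(x, y, s) \<in> U" by (auto simp: I_def dd_def z)
          then have "(x, y, s) \<in> E" using \<open>U \<in> I\<close> by (auto simp: I_def E_def)
          then show False using False mem[OF E] by (simp add: z)
        qed
        then show ?thesis using False by blast
      qed
      ultimately show "indicator (dd E) z * b (bb E) (snd z) = (\<Sum>U\<in>\<C>. indicator (dd U) z * b (bb U) (snd z))"
        by (auto simp: indicator_def)
    qed
    then have "m E = (\<integral>\<^sup>+z. (\<Sum>U\<in>\<C>. indicator (dd U) z * b (bb U) (snd z)) \<partial>\<alpha>)"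
      unfolding m_def \<mu>_def dd_def[symmetric] bb_def[symmetric] by (rule nn_integral_cong_AE)
    also have "\<dots> = (\<Sum>U\<in>\<C>. m U)"
    proof -
      have "(\<lambda>z. indicator (dd U) z * b (bb U) (snd z)) \<in> borel_measurable \<alpha>" if "U \<in> \<C>" for U
      proof -
        have [measurable]: "dd U \<in> sets borel" using that \<C>(1) meas by blast
        show ?thesis by measurable
      qed
      then show ?thesis unfolding m_def \<mu>_def dd_def[symmetric] bb_def[symmetric] by (rule nn_integral_sum)
    qed
    finally show "m (\<Union>\<C>) = (\<Sum>U\<in>\<C>. m U)" by (simp add: E_def)
  qed simp

  \<comment> \<open>Extension to the generated ring, and tightness there\<close>
  from extend_volume[OF vol_m] obtain m' where vol: "volume generated_ring m'" and m'_m: "\<And>U. U \<in> \<B> \<Longrightarrow> m' U = m U"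
    by blast
  interpret R: ring_of_sets UNIV generated_ring by (rule generating_ring)
  have m'_slab: "m' (slab D B) = \<mu> D B" if "D \<in> sets borel" "B \<in> sets borel" for D B
    using that by (simp add: m'_m \<B>I m_slab)
  have slab_R: "slab D B \<in> generated_ring" if "D \<in> sets borel" "B \<in> sets borel" for D :: "('x \<times> 's) set" and B
    using that by (intro generated_ringI_Basic \<B>I)
  have UNIV_slab: "UNIV = slab (UNIV :: ('x \<times> 's) set) UNIV" by (auto simp: slab_def)
  have \<mu>_le: "\<mu> D B \<le> emeasure \<alpha> D" if "D \<in> sets borel" "B \<in> sets borel" for D B
  proof -
    have "slab D UNIV = slab D B \<union> slab D (- B)" "slab D B \<inter> slab D (- B) = {}" by (auto simp: slab_def)
    moreover have "slab D B \<in> generated_ring" "slab D (- B) \<in> generated_ring" "slab D UNIV \<in> generated_ring"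
      using that by (auto intro!: slab_R)
    ultimately have "m' (slab D UNIV) = m' (slab D B) + m' (slab D (- B))"
      using volume_Un[OF vol, of "slab D B" "slab D (- B)"] by simp
    then show ?thesis using that by (simp add: m'_slab \<mu>_UNIV[symmetric])
  qed
  have reg: "regular_space (euclidean :: ('x \<times> 's) topology)"
    using regX regS regular_space_prod_topology[of "euclidean :: 'x topology" "euclidean :: 's topology"] by simp
  have tight_slab: "\<exists>K\<in>\<B>. compact K \<and> closed K \<and> K \<subseteq> U \<and> m' (U - K) \<le> ennreal \<epsilon>"
    if U: "U \<in> \<B>" and \<epsilon>: "0 < \<epsilon>" for U and \<epsilon> :: real
  proof -
    obtain D B where UDB: "U = slab D B" and D: "D \<in> sets borel" and B: "B \<in> sets borel"
      using U by (auto simp: \<B>_def)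
    have "0 < \<epsilon> / 2" using \<epsilon> by simp
    obtain K where K: "compact K" "closed K" "K \<subseteq> D" "measure \<alpha> (D - K) < \<epsilon> / 2"
      by (rule radon_measures_closed_compact[OF reg \<alpha> D \<open>0 < \<epsilon> / 2\<close>])
    obtain L where L: "compact L" "closed L" "L \<subseteq> B" "measure \<beta> ((B - L) \<times> UNIV) < \<epsilon> / 2"
      by (rule radon_closed_compact_side[OF regX \<beta> B \<open>0 < \<epsilon> / 2\<close>])
    have KL: "K \<in> sets borel" "L \<in> sets borel" using K L by auto
    have "U - slab K L = slab (D - K) B \<union> slab K (B - L)" "slab (D - K) B \<inter> slab K (B - L) = {}"
      using K L by (auto simp: UDB slab_def)
    moreover have "slab (D - K) B \<in> generated_ring" "slab K (B - L) \<in> generated_ring"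
      using D B KL by (auto intro!: slab_R)
    ultimately have "m' (U - slab K L) = m' (slab (D - K) B) + m' (slab K (B - L))"
      using volume_Un[OF vol, of "slab (D - K) B" "slab K (B - L)"] by (simp add: R.Un)
    also have "\<dots> = \<mu> (D - K) B + \<mu> K (B - L)" using D B KL by (simp add: m'_slab)
    \<comment> \<open>The slab over \<open>D - K\<close> is charged to \<open>\<alpha>\<close>, the
      other one to \<open>\<beta>\<close> by enlarging \<open>K\<close> to the whole space; each
      costs less than \<open>\<epsilon> / 2\<close>.\<close>
    also have "\<dots> \<le> emeasure \<alpha> (D - K) + \<mu> (UNIV \<times> UNIV) (B - L)"
      using D B KL by (intro add_mono \<mu>_le \<mu>_mono) auto
    also have "\<dots> = emeasure \<alpha> (D - K) + emeasure \<beta> ((B - L) \<times> UNIV)"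
      using B KL by (subst \<mu>_cyl) auto
    also have "\<dots> = ennreal (measure \<alpha> (D - K) + measure \<beta> ((B - L) \<times> UNIV))"
      by (simp add: \<alpha>.emeasure_eq_measure \<beta>.emeasure_eq_measure)
    also have "\<dots> \<le> ennreal \<epsilon>" using K L by (intro ennreal_leI) simp
    finally have "m' (U - slab K L) \<le> ennreal \<epsilon>" .
    moreover have "slab K L \<subseteq> U" using K L by (auto simp: UDB slab_def)
    moreover have "slab K L \<in> \<B>" using KL by (rule \<B>I)
    ultimately show ?thesis using K L slab_compact slab_closed by (intro bexI[of _ "slab K L"]) auto
  qed
  have tight: "\<exists>K\<in>generated_ring. compact K \<and> closed K \<and> K \<subseteq> U \<and> m' (U - K) \<le> ennreal \<epsilon>"
    if U: "U \<in> generated_ring" and \<epsilon>: "0 < \<epsilon>" for U and \<epsilon> :: real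
  proof -
    obtain \<C> where \<C>: "finite \<C>" "disjoint \<C>" "\<C> \<subseteq> \<B>" "U = \<Union>\<C>" using U by (rule generated_ringE)
    \<comment> \<open>Adding 1 keeps \<open>\<eta>\<close> positive for the empty family.\<close>
    define \<eta> where "\<eta> = \<epsilon> / (real (card \<C>) + 1)"
    have \<eta>: "0 < \<eta>" "real (card \<C>) * \<eta> \<le> \<epsilon>" using \<epsilon> by (auto simp: \<eta>_def field_simps)
    have "\<forall>V\<in>\<C>. \<exists>K. K \<in> \<B> \<and> compact K \<and> closed K \<and> K \<subseteq> V \<and> m' (V - K) \<le> ennreal \<eta>"
      using tight_slab[OF _ \<eta>(1)] \<C>(3) by blast
    then obtain K where K: "\<And>V. V \<in> \<C> \<Longrightarrow> K V \<in> \<B> \<and> compact (K V) \<and> closed (K V) \<and> K V \<subseteq> V \<and> m' (V - K V) \<le> ennreal \<eta>"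
      by metis
    have inR: "V - K V \<in> generated_ring" if "V \<in> \<C>" for V
      using that K \<C>(3) by (intro R.Diff generated_ringI_Basic) auto
    have disj: "disjoint_family_on (\<lambda>V. V - K V) \<C>"
      using \<C>(2) by (auto simp: disjoint_family_on_def disjoint_def)
    have "U - (\<Union>V\<in>\<C>. K V) = (\<Union>V\<in>\<C>. V - K V)"
    proof (intro equalityI subsetI)
      fix z assume "z \<in> (\<Union>V\<in>\<C>. V - K V)"
      then obtain V where V: "V \<in> \<C>" "z \<in> V" "z \<notin> K V" by blast
      have "z \<notin> K W" if "W \<in> \<C>" for W
      proof
        assume "z \<in> K W"
        then have "z \<in> W" using K that by blast
        then have "W = V" using \<C>(2) V that by (auto simp: disjoint_def)
        then show False using V \<open>z \<in> K W\<close> by simp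
      qed
      then show "z \<in> U - (\<Union>V\<in>\<C>. K V)" using V \<C>(4) by blast
    qed (use \<C>(4) in blast)
    then have "m' (U - (\<Union>V\<in>\<C>. K V)) = (\<Sum>V\<in>\<C>. m' (V - K V))"
      using volume_finite_additive[OF vol, of \<C> "\<lambda>V. V - K V"] inR disj \<C>(1) by (simp add: R.finite_UN)
    also have "\<dots> \<le> (\<Sum>V\<in>\<C>. ennreal \<eta>)" using K by (intro sum_mono) auto
    also have "\<dots> = ennreal (real (card \<C>) * \<eta>)" using \<eta> by (simp add: ennreal_mult ennreal_of_nat_eq_real_of_nat)
    also have "\<dots> \<le> ennreal \<epsilon>" using \<eta> by (intro ennreal_leI)
    finally have "m' (U - (\<Union>V\<in>\<C>. K V)) \<le> ennreal \<epsilon>" .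
    moreover have "compact (\<Union>V\<in>\<C>. K V)" "closed (\<Union>V\<in>\<C>. K V)" using \<C>(1) K by (auto intro!: compact_UN)
    moreover have "(\<Union>V\<in>\<C>. K V) \<in> generated_ring"
      using \<C>(1) K by (intro R.finite_UN generated_ringI_Basic) auto
    moreover have "(\<Union>V\<in>\<C>. K V) \<subseteq> U" using K \<C>(4) by blast
    ultimately show ?thesis by blast
  qed
  have base: "\<exists>W\<in>generated_ring. open W \<and> z \<in> W \<and> W \<subseteq> U" if U: "open U" "z \<in> U" for U z
  proof -
    obtain x y s where z: "z = (x, y, s)" by (metis prod.collapse)
    obtain A V where AV: "open A" "open V" "(x, y, s) \<in> A \<times> V" "A \<times> V \<subseteq> U"
      using open_prod_elim[OF U(1), of "(x, y, s)"] U(2) z by metis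
    obtain B C where BC: "open B" "open C" "(y, s) \<in> B \<times> C" "B \<times> C \<subseteq> V"
      using open_prod_elim[OF AV(2), of "(y, s)"] AV(3) by auto
    have eq: "slab (A \<times> C) B = A \<times> B \<times> C" by (auto simp: slab_def)
    have "open (A \<times> B \<times> C)" "(x, y, s) \<in> A \<times> B \<times> C" "A \<times> B \<times> C \<subseteq> U"
      using AV BC by (auto intro!: open_Times)
    moreover have "A \<times> B \<times> C \<in> generated_ring"
      unfolding eq[symmetric] using AV BC by (intro slab_R borel_open open_Times)
    ultimately show ?thesis unfolding z by blast
  qed
  have "m' UNIV < \<infinity>"
    using m'_slab[of UNIV UNIV] UNIV_slab \<alpha>.emeasure_finite[of UNIV] by (simp add: \<mu>_UNIV less_top[symmetric])
  moreover have "generated_ring \<subseteq> sets borel"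
  proof
    fix U assume "U \<in> generated_ring"
    then obtain \<C> where "finite \<C>" "\<C> \<subseteq> \<B>" "U = \<Union>\<C>" by (rule generated_ringE)
    then show "U \<in> sets borel" by (auto simp: \<B>_def intro!: sets.finite_Union slab_borel)
  qed
  moreover have "UNIV \<in> generated_ring" using slab_R[of UNIV UNIV] UNIV_slab by simp
  ultimately obtain \<gamma> where \<gamma>: "\<gamma> \<in> radon_measures" and em: "\<And>U. U \<in> generated_ring \<Longrightarrow> emeasure \<gamma> U = m' U"
    using tight_volume_extends_to_radon_measure[OF R.ring_of_sets_axioms _ _ vol _ base tight] by metis
  have sets_\<gamma>: "sets \<gamma> = sets borel" using \<gamma> by (simp add: radon_measures_def)
  have space_\<gamma>: "space \<gamma> = UNIV" using sets_eq_imp_space_eq[OF sets_\<gamma>] by simp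
  have cont: "continuous_on UNIV (\<lambda>(x :: 'x, y :: 'x, s :: 's). (x, s))" "continuous_on UNIV (\<lambda>(x :: 'x, y :: 'x, s :: 's). (y, s))"
    by (simp_all add: case_prod_beta' continuous_intros)
  have meas: "(\<lambda>(x :: 'x, y :: 'x, s :: 's). (x, s)) \<in> measurable \<gamma> borel" "(\<lambda>(x :: 'x, y :: 'x, s :: 's). (y, s)) \<in> measurable \<gamma> borel"
    using cont by (simp_all add: borel_measurable_continuous_onI sets_\<gamma> cong: measurable_cong_sets)
  have "proj_XS \<gamma> = \<alpha>"
  proof (rule measure_eqI)
    fix D assume "D \<in> sets (proj_XS \<gamma>)"
    then have D: "D \<in> sets borel" by (simp add: proj_XS_def)
    have "(\<lambda>(x, y, s). (x, s)) -` D = slab D UNIV" by (auto simp: slab_def)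
    then show "emeasure (proj_XS \<gamma>) D = emeasure \<alpha> D"
      unfolding proj_XS_def using D em[OF slab_R[of D UNIV]]
      by (subst emeasure_distr[OF meas(1)]) (auto simp: space_\<gamma> m'_slab \<mu>_UNIV)
  qed (simp add: proj_XS_def sets_\<alpha>)
  \<comment> \<open>For the second projection a slab sees only sets \<open>B \<times> C\<close>, so
    equality is available on rectangles; \<open>\<beta>\<close> is written as its image under the
    identity in order to compare two continuous images of Radon measures.\<close>
  moreover have "proj_YS \<gamma> = distr \<beta> borel (\<lambda>z. z)"
    unfolding proj_YS_def
  proof (rule distr_radon_eqI_rectangles[OF \<gamma> cont(2) \<beta>])
    show "continuous_on UNIV (\<lambda>z :: 'x \<times> 's. z)" by (rule continuous_on_id)
    fix B :: "'x set" and C :: "'s set" assume [measurable]: "B \<in> sets borel" "C \<in> sets borel"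
    have "(\<lambda>(x, y, s). (y, s)) -` (B \<times> C) = slab (UNIV \<times> C) B" by (auto simp: slab_def)
    then have "emeasure (distr \<gamma> borel (\<lambda>(x, y, s). (y, s))) (B \<times> C) = emeasure \<beta> (B \<times> C)"
      using em[OF slab_R[of "UNIV \<times> C" B]] rect
      by (subst emeasure_distr[OF meas(2)]) (auto simp: space_\<gamma> m'_slab \<mu>_cyl)
    also have "\<dots> = emeasure (distr \<beta> borel (\<lambda>z. z)) (B \<times> C)"
      using rect by (subst emeasure_distr) (auto simp: space_\<beta> sets_\<beta> cong: measurable_cong_sets)
    finally show "emeasure (distr \<gamma> borel (\<lambda>(x, y, s). (y, s))) (B \<times> C) = emeasure (distr \<beta> borel (\<lambda>z. z)) (B \<times> C)" .
  qed
  moreover have "distr \<beta> borel (\<lambda>z. z) = \<beta>" by (rule distr_id2) (simp add: sets_\<beta>)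
  ultimately show thesis using that \<gamma> by simp
qed

section \<open>Duality\<close>

lemma proj_measurable:
  "(\<lambda>(x, y, s). (x, s)) \<in> measurable (borel :: ('x::topological_space \<times> 'x \<times> 's::topological_space) measure) borel"
  "(\<lambda>(x, y, s). (y, s)) \<in> measurable (borel :: ('x::topological_space \<times> 'x \<times> 's::topological_space) measure) borel"
  by (intro borel_measurable_continuous_onI; simp add: case_prod_beta; intro continuous_intros)+

lemma fst_snd_measurable_borel:
  "fst \<in> measurable (borel :: ('a::topological_space \<times> 'b::topological_space) measure) borel"
  "snd \<in> measurable (borel :: ('a::topological_space \<times> 'b::topological_space) measure) borel"
  by (intro borel_measurable_continuous_onI continuous_intros)+

lemma nn_integral_proj_XS:
  assumes "sets \<gamma> = sets borel" "F \<in> borel_measurable borel"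
  shows "(\<integral>\<^sup>+z. F z \<partial>proj_XS \<gamma>) = (\<integral>\<^sup>+(x, y, s). F (x, s) \<partial>\<gamma>)"
  unfolding proj_XS_def using assms proj_measurable(1)
  by (subst nn_integral_distr) (auto simp: case_prod_beta' measurable_cong_sets[OF assms(1) refl])

lemma nn_integral_proj_YS:
  assumes "sets \<gamma> = sets borel" "F \<in> borel_measurable borel"
  shows "(\<integral>\<^sup>+z. F z \<partial>proj_YS \<gamma>) = (\<integral>\<^sup>+(x, y, s). F (y, s) \<partial>\<gamma>)"
  unfolding proj_YS_def using assms proj_measurable(2)
  by (subst nn_integral_distr) (auto simp: case_prod_beta' measurable_cong_sets[OF assms(1) refl])

lemma nn_integral_mono_setwise:
  assumes "sets M = sets N" "\<And>B. B \<in> sets M \<Longrightarrow> emeasure M B \<le> emeasure N B"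
  shows "nn_integral M f \<le> nn_integral N f"
  using assms by (intro nn_integral_mono_measure) (simp_all add: le_measure)

text \<open>Integrating the dual constraint against \<open>\<gamma>\<close> gives the claim once the
  terms with \<open>h\<close> cancel. They do because the balance condition says that
  \<open>\<psi>\<close>, which is \<open>\<gamma>\<close> weighted by \<open>c\<close>, has the same
  image under both coordinates \<open>x\<close> and \<open>y\<close>. The cost assumption makes
  \<open>\<psi>\<close> finite, so that truncated terms can be subtracted and continuity from above
  is available.\<close>

lemma weak_duality:
  fixes \<pi>p \<pi>m :: "('x::topological_space \<times> 's::topological_space) measure" and c :: "'s \<Rightarrow> real"
  assumes sets: "sets \<pi>p = sets borel" "sets \<pi>m = sets borel"
    and c [measurable]: "c \<in> borel_measurable borel" and c_pos: "\<And>s. 0 < c s"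
    and cost: "(\<integral>\<^sup>+z. ennreal (c (snd z)) \<partial>\<pi>p) < \<infinity> \<or> (\<integral>\<^sup>+z. ennreal (c (snd z)) \<partial>\<pi>m) < \<infinity>"
    and \<gamma>: "\<gamma> \<in> \<Gamma> \<pi>p \<pi>m c" and adm: "(f, g, h) \<in> dual_admissible c"
  shows "total_cost c \<gamma> \<le> (\<integral>\<^sup>+z. ennreal (f z) \<partial>\<pi>p) + (\<integral>\<^sup>+z. ennreal (g z) \<partial>\<pi>m)"
proof -
  have fgh [measurable]: "f \<in> borel_measurable borel" "g \<in> borel_measurable borel" "h \<in> borel_measurable borel"
    and nonneg: "\<And>z. 0 \<le> f z" "\<And>z. 0 \<le> g z"
    and dual: "\<And>x y s. c s \<le> f (x, s) + g (y, s) + c s * h x - c s * h y"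
    using adm by (auto simp: dual_admissible_def)
  have sets_\<gamma> [measurable_cong]: "sets \<gamma> = sets borel"
    and le_p: "\<And>B. B \<in> sets borel \<Longrightarrow> emeasure (proj_XS \<gamma>) B \<le> emeasure \<pi>p B"
    and le_m: "\<And>B. B \<in> sets borel \<Longrightarrow> emeasure (proj_YS \<gamma>) B \<le> emeasure \<pi>m B"
    and bal: "\<And>A. A \<in> sets borel \<Longrightarrow>
        set_nn_integral \<gamma> (A \<times> UNIV \<times> UNIV) (\<lambda>(x, y, s). ennreal (c s)) =
        set_nn_integral \<gamma> (UNIV \<times> A \<times> UNIV) (\<lambda>(x, y, s). ennreal (c s))"
    using \<gamma> by (auto simp: \<Gamma>_def radon_measures_def)
  define xx where "xx z = fst z" for z :: "'x \<times> 'x \<times> 's"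
  define yy where "yy z = fst (snd z)" for z :: "'x \<times> 'x \<times> 's"
  define ss where "ss z = snd (snd z)" for z :: "'x \<times> 'x \<times> 's"
  have [measurable]: "xx \<in> measurable borel borel" "yy \<in> measurable borel borel" "ss \<in> measurable borel borel"
    unfolding xx_def yy_def ss_def by (intro borel_measurable_continuous_onI continuous_intros)+
  have [measurable]: "(\<lambda>z. (xx z, ss z)) \<in> measurable borel borel" "(\<lambda>z. (yy z, ss z)) \<in> measurable borel borel"
    unfolding xx_def yy_def ss_def by (intro borel_measurable_continuous_onI continuous_intros)+
  have space_\<gamma>: "space \<gamma> = UNIV" using sets_eq_imp_space_eq[OF sets_\<gamma>] by simp
  have int_p: "(\<integral>\<^sup>+z. F (xx z, ss z) \<partial>\<gamma>) \<le> (\<integral>\<^sup>+z. F z \<partial>\<pi>p)" if "F \<in> borel_measurable borel" for F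
    using nn_integral_proj_XS[OF sets_\<gamma> that] nn_integral_mono_setwise[of "proj_XS \<gamma>" \<pi>p F] le_p
    by (simp add: sets proj_XS_def case_prod_beta' xx_def ss_def)
  have int_m: "(\<integral>\<^sup>+z. F (yy z, ss z) \<partial>\<gamma>) \<le> (\<integral>\<^sup>+z. F z \<partial>\<pi>m)" if "F \<in> borel_measurable borel" for F
    using nn_integral_proj_YS[OF sets_\<gamma> that] nn_integral_mono_setwise[of "proj_YS \<gamma>" \<pi>m F] le_m
    by (simp add: sets proj_YS_def case_prod_beta' yy_def ss_def)
  define T where "T = (\<integral>\<^sup>+z. ennreal (c (ss z)) \<partial>\<gamma>)"
  have "(\<lambda>z. ennreal (c (snd z))) \<in> borel_measurable (borel :: ('x \<times> 's) measure)"
    using fst_snd_measurable_borel(2)[where 'a = 'x and 'b = 's] by measurable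
  \<comment> \<open>The cost depends on \<open>s\<close> only, so either projection bounds
    \<open>T\<close>.\<close>
  from int_p[OF this] int_m[OF this] cost have T_fin: "T < \<infinity>"
    unfolding T_def by (auto intro: le_less_trans)
  define \<psi> where "\<psi> = density \<gamma> (\<lambda>z. ennreal (c (ss z)))"
  have [measurable_cong]: "sets \<psi> = sets borel" by (simp add: \<psi>_def sets_\<gamma>)
  have \<psi>_fin: "emeasure \<psi> B < \<infinity>" for B
  proof -
    have "emeasure \<psi> B \<le> emeasure \<psi> (space \<psi>)" by (rule emeasure_space)
    also have "\<dots> = T" unfolding \<psi>_def T_def by (simp add: emeasure_density cong: nn_integral_cong)
    finally show ?thesis using T_fin by (rule le_less_trans)
  qed
  have "distr \<psi> borel xx = distr \<psi> borel yy"
  proof (rule measure_eqI)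
    fix A assume "A \<in> sets (distr \<psi> borel xx)"
    then have A [measurable]: "A \<in> sets borel" by simp
    have em: "emeasure (distr \<psi> borel r) A = (\<integral>\<^sup>+z. ennreal (c (ss z)) * indicator A (r z) \<partial>\<gamma>)"
      if [measurable]: "r \<in> measurable borel borel" for r
    proof -
      have "emeasure (distr \<psi> borel r) A = (\<integral>\<^sup>+a. indicator A a \<partial>distr \<psi> borel r)" by simp
      also have "\<dots> = (\<integral>\<^sup>+z. indicator A (r z) \<partial>\<psi>)" by (rule nn_integral_distr) measurable
      also have "\<dots> = (\<integral>\<^sup>+z. ennreal (c (ss z)) * indicator A (r z) \<partial>\<gamma>)"
        unfolding \<psi>_def by (rule nn_integral_density) measurable
      finally show ?thesis .
    qed
    have "emeasure (distr \<psi> borel xx) A = set_nn_integral \<gamma> (A \<times> UNIV \<times> UNIV) (\<lambda>(x, y, s). ennreal (c s))"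
      by (subst em) (auto intro!: nn_integral_cong simp: xx_def ss_def indicator_def)
    also have "\<dots> = set_nn_integral \<gamma> (UNIV \<times> A \<times> UNIV) (\<lambda>(x, y, s). ennreal (c s))" by (rule bal[OF A])
    also have "\<dots> = emeasure (distr \<psi> borel yy) A"
      by (subst em) (auto intro!: nn_integral_cong simp: yy_def ss_def indicator_def)
    finally show "emeasure (distr \<psi> borel xx) A = emeasure (distr \<psi> borel yy) A" .
  qed simp
  then have sym: "(\<integral>\<^sup>+z. H (xx z) \<partial>\<psi>) = (\<integral>\<^sup>+z. H (yy z) \<partial>\<psi>)" if [measurable]: "H \<in> borel_measurable borel" for H
    using nn_integral_distr[of xx \<psi> borel H] nn_integral_distr[of yy \<psi> borel H] by simp

  define bad where "bad n = {z. real n < \<bar>h (xx z)\<bar> \<or> real n < \<bar>h (yy z)\<bar>}" for n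
  have [measurable]: "bad n \<in> sets borel" for n unfolding bad_def by measurable
  \<comment> \<open>Since \<open>h\<close> need not be integrable, it is truncated to \<open>[-n, n]\<close>; the admissibility inequality
    survives outside \<open>bad n\<close>, and on \<open>bad n\<close> up to the error \<open>c\<close>.\<close>
  have trunc: "T \<le> (\<integral>\<^sup>+z. ennreal (f z) \<partial>\<pi>p) + (\<integral>\<^sup>+z. ennreal (g z) \<partial>\<pi>m) + emeasure \<psi> (bad n)" for n
  proof -
    \<comment> \<open>The shift by \<open>n\<close> makes \<open>k\<close> nonnegative, so that all
      integrals stay in the extended nonnegative reals; it drops out of the differences
      \<open>k x - k y\<close>.\<close>
    define k where "k x = max (- real n) (min (real n) (h x)) + real n" for x
    have [measurable]: "k \<in> borel_measurable borel" unfolding k_def[abs_def] by measurable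
    have k: "0 \<le> k x" "k x \<le> 2 * real n" for x by (auto simp: k_def)
    define R where "R = (\<integral>\<^sup>+z. ennreal (k (xx z)) \<partial>\<psi>)"
    have R_alt: "R = (\<integral>\<^sup>+z. ennreal (k (yy z)) \<partial>\<psi>)"
      unfolding R_def by (rule sym) measurable
    have "R \<le> (\<integral>\<^sup>+z. ennreal (2 * real n) \<partial>\<psi>)"
      unfolding R_def by (intro nn_integral_mono ennreal_leI k)
    also have "\<dots> < \<infinity>" using \<psi>_fin[of "space \<psi>"] by (simp add: ennreal_mult_less_top)
    finally have R_fin: "R < \<infinity>" .
    have R1: "R = (\<integral>\<^sup>+z. ennreal (c (ss z) * k (xx z)) \<partial>\<gamma>)" and R2: "R = (\<integral>\<^sup>+z. ennreal (c (ss z) * k (yy z)) \<partial>\<gamma>)"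
      subgoal unfolding R_def \<psi>_def using c_pos k by (subst nn_integral_density) (auto simp: ennreal_mult less_imp_le)
      subgoal unfolding R_alt \<psi>_def using c_pos k by (subst nn_integral_density) (auto simp: ennreal_mult less_imp_le)
      done
    have key: "c (ss z) + c (ss z) * k (yy z)
      \<le> f (xx z, ss z) + g (yy z, ss z) + c (ss z) * k (xx z) + c (ss z) * indicator (bad n) z" for z
    proof -
      define D where "D = h (xx z) - h (yy z)"
      have 1: "c (ss z) * (1 - D) \<le> f (xx z, ss z) + g (yy z, ss z)"
        using dual[of "ss z" "xx z" "yy z"] by (simp add: D_def algebra_simps)
      have 2: "0 \<le> f (xx z, ss z) + g (yy z, ss z)" using nonneg by (simp add: add_nonneg_nonneg)
      \<comment> \<open>Truncation is monotone and 1-Lipschitz, so the truncated difference lies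
        between 0 and \<open>D\<close>; hence 1 minus it is at most the larger of \<open>1\<close>
        and \<open>1 - D\<close>, which exceeds \<open>max 0 (1 - D)\<close> by at most 1.\<close>
      have "1 - (k (xx z) - k (yy z)) \<le> max 0 (1 - D) + indicator (bad n) z \<and>
        (z \<notin> bad n \<longrightarrow> k (xx z) - k (yy z) = D)"
        by (auto simp: D_def k_def bad_def indicator_def max_def min_def)
      then have "1 - (k (xx z) - k (yy z)) \<le> max 0 (1 - D) + indicator (bad n) z" by simp
      then have "c (ss z) * (1 - (k (xx z) - k (yy z))) \<le> c (ss z) * (max 0 (1 - D) + indicator (bad n) z)"
        using c_pos[of "ss z"] by (intro mult_left_mono) auto
      also have "c (ss z) * max 0 (1 - D) \<le> f (xx z, ss z) + g (yy z, ss z)"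
        using 1 2 by (auto simp: max_def)
      then have "c (ss z) * (max 0 (1 - D) + indicator (bad n) z)
        \<le> f (xx z, ss z) + g (yy z, ss z) + c (ss z) * indicator (bad n) z"
        by (simp add: distrib_left)
      finally show ?thesis by (simp add: algebra_simps)
    qed
    have "T + R = (\<integral>\<^sup>+z. ennreal (c (ss z) + c (ss z) * k (yy z)) \<partial>\<gamma>)"
      unfolding T_def R2 using c_pos k
      by (subst nn_integral_add[symmetric]) (auto simp: ennreal_plus less_imp_le intro!: nn_integral_cong)
    also have "\<dots> \<le> (\<integral>\<^sup>+z. ennreal (f (xx z, ss z)) + ennreal (g (yy z, ss z)) + ennreal (c (ss z) * k (xx z))
        + ennreal (c (ss z)) * indicator (bad n) z \<partial>\<gamma>)"
    proof (intro nn_integral_mono)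
      fix z
      have "ennreal (c (ss z) + c (ss z) * k (yy z)) \<le> ennreal (f (xx z, ss z) + g (yy z, ss z) + c (ss z) * k (xx z) + c (ss z) * indicator (bad n) z)"
        by (rule ennreal_leI[OF key])
      also have "\<dots> = ennreal (f (xx z, ss z)) + ennreal (g (yy z, ss z)) + ennreal (c (ss z) * k (xx z))
        + ennreal (c (ss z)) * indicator (bad n) z"
        using nonneg k c_pos[of "ss z"] by (auto simp: ennreal_plus indicator_def split: if_splits)
      finally show "ennreal (c (ss z) + c (ss z) * k (yy z)) \<le> \<dots>" .
    qed
    also have "\<dots> = (\<integral>\<^sup>+z. ennreal (f (xx z, ss z)) \<partial>\<gamma>) + (\<integral>\<^sup>+z. ennreal (g (yy z, ss z)) \<partial>\<gamma>) + R + emeasure \<psi> (bad n)"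
    proof -
      have "emeasure \<psi> (bad n) = (\<integral>\<^sup>+z. ennreal (c (ss z)) * indicator (bad n) z \<partial>\<gamma>)"
        unfolding \<psi>_def by (rule emeasure_density) (auto simp: sets_\<gamma>)
      then show ?thesis unfolding R1 by (simp add: nn_integral_add)
    qed
    also have "\<dots> \<le> (\<integral>\<^sup>+z. ennreal (f z) \<partial>\<pi>p) + (\<integral>\<^sup>+z. ennreal (g z) \<partial>\<pi>m) + R + emeasure \<psi> (bad n)"
      by (intro add_mono int_p int_m) auto
    finally have "R + T \<le> R + ((\<integral>\<^sup>+z. ennreal (f z) \<partial>\<pi>p) + (\<integral>\<^sup>+z. ennreal (g z) \<partial>\<pi>m) + emeasure \<psi> (bad n))"
      by (simp add: ac_simps)
    moreover have "R \<noteq> \<infinity>" using R_fin by auto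
    ultimately show ?thesis by (simp only: ennreal_add_left_cancel_le simp_thms)
  qed
  have "(\<lambda>n. emeasure \<psi> (bad n)) \<longlonglongrightarrow> emeasure \<psi> (\<Inter>n. bad n)"
  proof (rule Lim_emeasure_decseq)
    show "decseq bad" by (auto simp: decseq_def bad_def intro: le_less_trans)
    show "range bad \<subseteq> sets \<psi>" by (auto simp: \<psi>_def sets_\<gamma>)
  qed (use \<psi>_fin in \<open>auto simp: less_top\<close>)
  moreover have "(\<Inter>n. bad n) = {}"
  proof -
    have "\<exists>n. z \<notin> bad n" for z
    proof -
      obtain n where "max \<bar>h (xx z)\<bar> \<bar>h (yy z)\<bar> \<le> real n" using real_arch_simple by blast
      then show ?thesis by (intro exI[of _ n]) (auto simp: bad_def)
    qed
    then show ?thesis by blast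
  qed
  ultimately have lim: "(\<lambda>n. emeasure \<psi> (bad n)) \<longlonglongrightarrow> 0" by simp
  have "T \<le> (\<integral>\<^sup>+z. ennreal (f z) \<partial>\<pi>p) + (\<integral>\<^sup>+z. ennreal (g z) \<partial>\<pi>m)"
  proof (rule ennreal_le_epsilon)
    fix \<epsilon> :: real assume "0 < \<epsilon>"
    then have "eventually (\<lambda>n. emeasure \<psi> (bad n) < ennreal \<epsilon>) sequentially"
      using order_tendstoD(2)[OF lim, of "ennreal \<epsilon>"] by simp
    then obtain n where "emeasure \<psi> (bad n) < ennreal \<epsilon>"
      using eventually_happens by (metis trivial_limit_sequentially)
    then show "T \<le> (\<integral>\<^sup>+z. ennreal (f z) \<partial>\<pi>p) + (\<integral>\<^sup>+z. ennreal (g z) \<partial>\<pi>m) + ennreal \<epsilon>"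
      using trunc[of n] by (meson add_left_mono less_imp_le order_trans)
  qed
  then show ?thesis by (simp add: total_cost_def T_def ss_def case_prod_beta')
qed

section \<open>Strong duality and attainment\<close>

lemma radon_measures_density:
  assumes \<mu>: "\<mu> \<in> radon_measures" and u: "u \<in> borel_measurable borel" "\<And>z. u z \<le> 1"
  shows "density \<mu> (\<lambda>z. ennreal (u z)) \<in> radon_measures"
proof -
  have sets_\<mu> [measurable_cong]: "sets \<mu> = sets borel" and "finite_measure \<mu>"
    using \<mu> by (auto simp: radon_measures_def)
  interpret finite_measure \<mu> by fact
  let ?\<nu> = "density \<mu> (\<lambda>z. ennreal (u z))"
  have le: "emeasure ?\<nu> B \<le> emeasure \<mu> B" if "B \<in> sets borel" for B
  proof -
    have "emeasure ?\<nu> B = (\<integral>\<^sup>+z. ennreal (u z) * indicator B z \<partial>\<mu>)"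
      using u(1) that by (intro emeasure_density) (auto simp: sets_\<mu> cong: measurable_cong_sets)
    also have "\<dots> \<le> (\<integral>\<^sup>+z. indicator B z \<partial>\<mu>)"
      using u(2) by (intro nn_integral_mono) (auto simp: indicator_def)
    finally show ?thesis using that by (simp add: sets_\<mu>)
  qed
  interpret \<nu>: finite_measure ?\<nu>
  proof (rule finite_measureI)
    have "emeasure ?\<nu> UNIV \<le> emeasure \<mu> UNIV" by (rule le) simp
    also have "\<dots> < \<infinity>" by (simp add: less_top[symmetric])
    finally show "emeasure ?\<nu> (space ?\<nu>) \<noteq> \<infinity>"
      using sets_eq_imp_space_eq[OF sets_\<mu>] by simp
  qed
  show ?thesis
    unfolding radon_measures_def
  proof (safe)
    fix B :: "'a set" and \<epsilon> :: real assume B: "B \<in> sets borel" and "0 < \<epsilon>"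
    then obtain K where K: "compact K" "K \<in> sets borel" "K \<subseteq> B" "measure \<mu> (B - K) < \<epsilon>"
      using \<mu> unfolding radon_measures_def by blast
    \<comment> \<open>As the density is at most 1, a compact set that is good for
      \<open>\<mu>\<close> is good for the weighted measure.\<close>
    have "measure ?\<nu> (B - K) \<le> measure \<mu> (B - K)"
      using le[of "B - K"] B K by (simp add: \<nu>.emeasure_eq_measure emeasure_eq_measure)
    then show "\<exists>K. compact K \<and> K \<in> sets borel \<and> K \<subseteq> B \<and> measure ?\<nu> (B - K) < \<epsilon>"
      using K by (intro exI[of _ K]) auto
  qed (auto simp: sets_\<mu> \<nu>.finite_measure_axioms)
qed

text \<open>For fixed \<open>s\<close> the dual constraint separates \<open>x\<close> from \<open>y\<close>: it says that some \<open>k s\<close> satisfies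
  \<open>f (x, s) \<ge> c s * (1 - h x - k s)\<close> and \<open>g (y, s) \<ge> c s * (h y + k s)\<close>.\<close>

lemma dual_admissible_pair:
  assumes c: "c \<in> borel_measurable borel" "\<And>s. 0 < c s"
    and h: "h \<in> borel_measurable borel" and k: "k \<in> borel_measurable borel"
  shows "(\<lambda>z. max 0 (c (snd z) * (1 - h (fst z) - k (snd z))), \<lambda>z. max 0 (c (snd z) * (h (fst z) + k (snd z))), h)
    \<in> dual_admissible c"
proof -
  note [measurable] = c(1) h k fst_snd_measurable_borel
  have "c s \<le> max 0 (c s * (1 - h x - k s)) + max 0 (c s * (h y + k s)) + c s * h x - c s * h y" for x y s
  proof -
    have "c s * (1 - h x - k s) + c s * (h y + k s) + c s * h x - c s * h y = c s"
      by (simp add: algebra_simps)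
    then show ?thesis by linarith
  qed
  moreover have "(\<lambda>z. max 0 (c (snd z) * (1 - h (fst z) - k (snd z)))) \<in> borel_measurable borel"
    "(\<lambda>z. max 0 (c (snd z) * (h (fst z) + k (snd z)))) \<in> borel_measurable borel"
    by measurable
  ultimately show ?thesis using h by (auto simp: dual_admissible_def)
qed

lemma ennreal_max_0: "ennreal (max 0 x) = ennreal x"
  by (cases "0 \<le> x") (auto simp: max_def ennreal_neg)

theorem theorem2p3:
  fixes \<pi>p \<pi>m :: "('x::topological_space \<times> 's::topological_space) measure"
    and c :: "'s \<Rightarrow> real"
  assumes "completely_regular_space (euclidean :: 'x topology)"
    and "completely_regular_space (euclidean :: 's topology)"
    and "\<pi>p \<in> radon_measures"
    and "\<pi>m \<in> radon_measures"
    and "c \<in> borel_measurable borel"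
    and "\<And>s. c s > 0"
    and "integrable \<pi>p (\<lambda>(x, s). c s) \<or> integrable \<pi>m (\<lambda>(y, s). c s)"
  shows "\<exists>\<gamma>\<in>\<Gamma> \<pi>p \<pi>m c.
           (\<forall>\<gamma>'\<in>\<Gamma> \<pi>p \<pi>m c. total_cost c \<gamma>' \<le> total_cost c \<gamma>) \<and>
           total_cost c \<gamma> =
             (INF (f, g, h)\<in>dual_admissible c.
                (\<integral>\<^sup>+z. ennreal (f z) \<partial>\<pi>p) + (\<integral>\<^sup>+z. ennreal (g z) \<partial>\<pi>m))"
proof -
  note c [measurable] = assms(5) and c_pos = assms(6)
  note [measurable] = fst_snd_measurable_borel[where 'a = 'x and 'b = 's]
  have c_nonneg: "0 \<le> c s" for s using c_pos[of s] by simp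
  have sets_p [measurable_cong]: "sets \<pi>p = sets borel" and sets_m [measurable_cong]: "sets \<pi>m = sets borel"
    and fin: "finite_measure \<pi>p" "finite_measure \<pi>m"
    using assms(3,4) by (auto simp: radon_measures_def)
  have cost: "(\<integral>\<^sup>+z. ennreal (c (snd z)) \<partial>\<pi>p) < \<infinity> \<or> (\<integral>\<^sup>+z. ennreal (c (snd z)) \<partial>\<pi>m) < \<infinity>"
    using assms(7) c_nonneg by (auto simp: integrable_iff_bounded case_prod_beta')
  define I where "I = (INF (f, g, h)\<in>dual_admissible c. (\<integral>\<^sup>+z. ennreal (f z) \<partial>\<pi>p) + (\<integral>\<^sup>+z. ennreal (g z) \<partial>\<pi>m))"
  have I_le: "I \<le> (\<integral>\<^sup>+z. ennreal (c (snd z) * (1 - h (fst z) - k (snd z))) \<partial>\<pi>p)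
      + (\<integral>\<^sup>+z. ennreal (c (snd z) * (h (fst z) + k (snd z))) \<partial>\<pi>m)"
    if "h \<in> borel_measurable borel" "k \<in> borel_measurable borel" for h k
    using INF_lower[OF dual_admissible_pair[OF c c_pos that],
        of "\<lambda>(f, g, h). (\<integral>\<^sup>+z. ennreal (f z) \<partial>\<pi>p) + (\<integral>\<^sup>+z. ennreal (g z) \<partial>\<pi>m)"]
    by (simp add: I_def ennreal_max_0)
  \<comment> \<open>The pairs \<open>(0, 0)\<close> and \<open>(0, 1)\<close> for
    \<open>(h, k)\<close> give the integrals of \<open>c\<close> over \<open>\<pi>p\<close> and
    \<open>\<pi>m\<close>, so one finite cost integral makes \<open>I\<close> finite. Only then can
    \<open>I\<close> serve as the real number \<open>D\<close> of
    \<open>exact_circulation\<close>.\<close>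
  have "I < \<infinity>"
    using cost I_le[of "\<lambda>_. 0" "\<lambda>_. 0"] I_le[of "\<lambda>_. 0" "\<lambda>_. 1"] by (auto intro: le_less_trans)
  then have I_real: "ennreal (enn2real I) = I" by simp
  obtain u v :: "'x \<times> 's \<Rightarrow> real" where uv [measurable]: "u \<in> borel_measurable borel" "v \<in> borel_measurable borel"
    and range: "\<And>z. u z \<in> {0..1}" "\<And>z. v z \<in> {0..1}"
    and S: "distr (density \<pi>p (\<lambda>z. ennreal (u z))) borel snd = distr (density \<pi>m (\<lambda>z. ennreal (v z))) borel snd"
    and X: "\<And>A. A \<in> sets borel \<Longrightarrow> (\<integral>\<^sup>+z. ennreal (u z * c (snd z)) * indicator A (fst z) \<partial>\<pi>p)
        = (\<integral>\<^sup>+z. ennreal (v z * c (snd z)) * indicator A (fst z) \<partial>\<pi>m)"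
    and val: "I \<le> (\<integral>\<^sup>+z. ennreal (u z * c (snd z)) \<partial>\<pi>p)"
  proof (cases "(\<integral>\<^sup>+z. ennreal (c (snd z)) \<partial>\<pi>p) < \<infinity>")
    case True
    show thesis
    proof (rule exact_circulation[OF fin sets_p sets_m fst_snd_measurable_borel c c_pos True, of "enn2real I"])
      fix u v :: "'x \<times> 's \<Rightarrow> real"
      assume "u \<in> borel_measurable borel" "v \<in> borel_measurable borel"
        "\<And>z. u z \<in> {0..1}" "\<And>z. v z \<in> {0..1}"
        "distr (density \<pi>p (\<lambda>z. ennreal (u z))) borel snd = distr (density \<pi>m (\<lambda>z. ennreal (v z))) borel snd"
        "\<And>A. A \<in> sets borel \<Longrightarrow> (\<integral>\<^sup>+z. ennreal (u z * c (snd z)) * indicator A (fst z) \<partial>\<pi>p)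
          = (\<integral>\<^sup>+z. ennreal (v z * c (snd z)) * indicator A (fst z) \<partial>\<pi>m)"
        "ennreal (enn2real I) \<le> (\<integral>\<^sup>+z. ennreal (u z * c (snd z)) \<partial>\<pi>p)"
      then show thesis unfolding I_real by (rule that)
    qed (simp add: I_real I_le)
  next
    \<comment> \<open>\<open>exact_circulation\<close> asks for a finite cost of its first measure,
      so here the two measures change places.\<close>
    case False
    then have True: "(\<integral>\<^sup>+z. ennreal (c (snd z)) \<partial>\<pi>m) < \<infinity>" using cost by simp
    show thesis
    proof (rule exact_circulation[OF fin(2,1) sets_m sets_p fst_snd_measurable_borel c c_pos True, of "enn2real I"])
      fix h :: "'x \<Rightarrow> real" and k :: "'s \<Rightarrow> real"
      assume hk [measurable]: "h \<in> borel_measurable borel" "k \<in> borel_measurable borel"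
      \<comment> \<open>Exchanging the two marginals replaces \<open>h\<close> by \<open>-h\<close> and \<open>k\<close> by \<open>1 - k\<close>.\<close>
      have "(\<lambda>x. - h x) \<in> borel_measurable borel" "(\<lambda>s. 1 - k s) \<in> borel_measurable borel" by measurable
      from I_le[OF this] show "ennreal (enn2real I)
        \<le> (\<integral>\<^sup>+z. ennreal (c (snd z) * (1 - h (fst z) - k (snd z))) \<partial>\<pi>m)
          + (\<integral>\<^sup>+z. ennreal (c (snd z) * (h (fst z) + k (snd z))) \<partial>\<pi>p)"
        unfolding I_real by (simp add: add.commute algebra_simps)
    next
      fix v u :: "'x \<times> 's \<Rightarrow> real"
      assume *: "v \<in> borel_measurable borel" "u \<in> borel_measurable borel"
        "\<And>z. v z \<in> {0..1}" "\<And>z. u z \<in> {0..1}"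
        "distr (density \<pi>m (\<lambda>z. ennreal (v z))) borel snd = distr (density \<pi>p (\<lambda>z. ennreal (u z))) borel snd"
        "\<And>A. A \<in> sets borel \<Longrightarrow> (\<integral>\<^sup>+z. ennreal (v z * c (snd z)) * indicator A (fst z) \<partial>\<pi>m)
          = (\<integral>\<^sup>+z. ennreal (u z * c (snd z)) * indicator A (fst z) \<partial>\<pi>p)"
        "ennreal (enn2real I) \<le> (\<integral>\<^sup>+z. ennreal (v z * c (snd z)) \<partial>\<pi>m)"
      \<comment> \<open>The balance condition on all of \<open>X\<close> says that both weighted
        measures carry the same cost, so the value found for \<open>\<pi>m\<close> is also the one
        for \<open>\<pi>p\<close>.\<close>
      have "(\<integral>\<^sup>+z. ennreal (v z * c (snd z)) \<partial>\<pi>m) = (\<integral>\<^sup>+z. ennreal (u z * c (snd z)) \<partial>\<pi>p)"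
        using *(6)[of UNIV] by simp
      then have **: "I \<le> (\<integral>\<^sup>+z. ennreal (u z * c (snd z)) \<partial>\<pi>p)" using *(7) unfolding I_real by simp
      show thesis
      proof (rule that[OF *(2,1,4,3) *(5)[symmetric] _ **])
        show "(\<integral>\<^sup>+z. ennreal (u z * c (snd z)) * indicator A (fst z) \<partial>\<pi>p)
          = (\<integral>\<^sup>+z. ennreal (v z * c (snd z)) * indicator A (fst z) \<partial>\<pi>m)" if "A \<in> sets borel" for A
          using *(6)[OF that] by (rule sym)
      qed
    qed
  qed
  have u: "0 \<le> u z" "u z \<le> 1" and v: "0 \<le> v z" "v z \<le> 1" for z using range[of z] by auto
  define \<alpha> where "\<alpha> = density \<pi>p (\<lambda>z. ennreal (u z))"
  define \<beta> where "\<beta> = density \<pi>m (\<lambda>z. ennreal (v z))"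
  have \<alpha>: "\<alpha> \<in> radon_measures" and \<beta>: "\<beta> \<in> radon_measures"
    unfolding \<alpha>_def \<beta>_def using assms(3,4) uv u v by (auto intro: radon_measures_density)
  \<comment> \<open>The equality \<open>S\<close> is the common marginal that permits gluing; every
    remaining condition in \<open>\<Gamma>\<close> depends on \<open>\<gamma>\<close> through its
    two projections only.\<close>
  obtain \<gamma> where \<gamma>: "\<gamma> \<in> radon_measures" and proj: "proj_XS \<gamma> = \<alpha>" "proj_YS \<gamma> = \<beta>"
    using radon_measures_glue[OF completely_regular_imp_regular_space[OF assms(1)]
        completely_regular_imp_regular_space[OF assms(2)] \<alpha> \<beta>] S
    unfolding \<alpha>_def \<beta>_def by blast
  have sets_\<gamma>: "sets \<gamma> = sets borel" using \<gamma> by (simp add: radon_measures_def)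
  have int_\<alpha>: "(\<integral>\<^sup>+(x, y, s). F (x, s) \<partial>\<gamma>) = (\<integral>\<^sup>+z. ennreal (u z) * F z \<partial>\<pi>p)"
    and int_\<beta>: "(\<integral>\<^sup>+(x, y, s). F (y, s) \<partial>\<gamma>) = (\<integral>\<^sup>+z. ennreal (v z) * F z \<partial>\<pi>m)"
    if [measurable]: "F \<in> borel_measurable borel" for F
    unfolding nn_integral_proj_XS[OF sets_\<gamma> that, symmetric] nn_integral_proj_YS[OF sets_\<gamma> that, symmetric]
      proj \<alpha>_def \<beta>_def by (rule nn_integral_density; measurable)+
  have le: "emeasure (density \<pi> (\<lambda>z. ennreal (w z))) B \<le> emeasure \<pi> B"
    if sets_\<pi> [measurable_cong]: "sets \<pi> = sets borel" and [measurable]: "w \<in> borel_measurable borel" "B \<in> sets borel"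
      and w: "\<And>z. w z \<le> 1" for \<pi> :: "('x \<times> 's) measure" and w B
  proof -
    have "emeasure (density \<pi> (\<lambda>z. ennreal (w z))) B = (\<integral>\<^sup>+z. ennreal (w z) * indicator B z \<partial>\<pi>)"
      by (rule emeasure_density) (auto simp: sets_\<pi>)
    also have "\<dots> \<le> (\<integral>\<^sup>+z. indicator B z \<partial>\<pi>)"
      using w by (intro nn_integral_mono) (auto simp: indicator_def)
    finally show ?thesis by (simp add: sets_\<pi>)
  qed
  have "\<gamma> \<in> \<Gamma> \<pi>p \<pi>m c"
    unfolding \<Gamma>_def
  proof (intro CollectI conjI ballI \<gamma>)
    show "emeasure (proj_XS \<gamma>) B \<le> emeasure \<pi>p B" if "B \<in> sets borel" for B
      unfolding proj \<alpha>_def using that u by (intro le sets_p uv)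
    show "emeasure (proj_YS \<gamma>) B \<le> emeasure \<pi>m B" if "B \<in> sets borel" for B
      unfolding proj \<beta>_def using that v by (intro le sets_m uv)
    fix A :: "'x set" assume [measurable]: "A \<in> sets borel"
    define F where "F z = ennreal (c (snd z)) * indicator A (fst z)" for z
    have F [measurable]: "F \<in> borel_measurable borel" unfolding F_def by measurable
    have "set_nn_integral \<gamma> (A \<times> UNIV \<times> UNIV) (\<lambda>(x, y, s). ennreal (c s)) = (\<integral>\<^sup>+(x, y, s). F (x, s) \<partial>\<gamma>)"
      by (intro nn_integral_cong) (auto simp: F_def indicator_def)
    also have "\<dots> = (\<integral>\<^sup>+z. ennreal (u z * c (snd z)) * indicator A (fst z) \<partial>\<pi>p)"
      unfolding int_\<alpha>[OF F] using u c_nonneg by (simp add: F_def ennreal_mult mult.assoc)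
    also have "\<dots> = (\<integral>\<^sup>+z. ennreal (v z * c (snd z)) * indicator A (fst z) \<partial>\<pi>m)" by (rule X) measurable
    also have "\<dots> = (\<integral>\<^sup>+(x, y, s). F (y, s) \<partial>\<gamma>)"
      unfolding int_\<beta>[OF F] using v c_nonneg by (simp add: F_def ennreal_mult mult.assoc)
    also have "\<dots> = set_nn_integral \<gamma> (UNIV \<times> A \<times> UNIV) (\<lambda>(x, y, s). ennreal (c s))"
      by (intro nn_integral_cong) (auto simp: F_def indicator_def)
    finally show "set_nn_integral \<gamma> (A \<times> UNIV \<times> UNIV) (\<lambda>(x, y, s). ennreal (c s))
      = set_nn_integral \<gamma> (UNIV \<times> A \<times> UNIV) (\<lambda>(x, y, s). ennreal (c s))" .
  qed
  moreover have weak: "total_cost c \<gamma>' \<le> I" if "\<gamma>' \<in> \<Gamma> \<pi>p \<pi>m c" for \<gamma>'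
    unfolding I_def using weak_duality[OF sets_p sets_m c c_pos cost that]
    by (intro INF_greatest) auto
  moreover have "I \<le> total_cost c \<gamma>"
  proof -
    have "(\<lambda>z :: 'x \<times> 's. ennreal (c (snd z))) \<in> borel_measurable borel" by measurable
    from int_\<alpha>[OF this] have "total_cost c \<gamma> = (\<integral>\<^sup>+z. ennreal (u z * c (snd z)) \<partial>\<pi>p)"
      using u c_nonneg by (simp add: total_cost_def ennreal_mult)
    then show ?thesis using val by simp
  qed
  ultimately have "\<gamma> \<in> \<Gamma> \<pi>p \<pi>m c" "\<And>\<gamma>'. \<gamma>' \<in> \<Gamma> \<pi>p \<pi>m c \<Longrightarrow> total_cost c \<gamma>' \<le> total_cost c \<gamma>"
    "total_cost c \<gamma> = I"
    by (auto intro: antisym order_trans)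
  then show ?thesis unfolding I_def by blast
qed

end
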